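(* Let $W\in\mathcal{C}^\infty(\mathbb{R}^d)$ be real-valued with $W(-x)=W(x)$ and let $I\subset\mathbb{R}$ be a compact interval. Then $\Gamma=(\gamma^{(k)})_{k=1}^\infty\in\mathcal{C}^\infty(I,\mathfrak{G}_\infty^* )$ is a solution to the Vlasov hierarchy $$\partial_t\gamma^{(k)}+\sum_{i=1}^kv_i\cdot\nabla_{x_i}\gamma^{(k)}=2\sum_{i=1}^k\int_{\mathbb{R}^{2d}}dz_{k+1}\,\nabla W(x_i-x_{k+1})\cdot\nabla_{v_i}\gamma^{(k+1)},\qquad k\ge1$$ (in the sense of distributions) if and only if $\dot\Gamma=X_{\mathcal{H}_{VlH}}(\Gamma)$, where $X_{\mathcal{H}_{VlH}}$ is the unique Hamiltonian vector field generated by $\mathcal{H}_{VlH}$ with respect to the weak Lie-Poisson space $(\mathfrak{G}_\infty^*,\mathcal{A}_\infty,\{\cdot,\cdot\}_{\mathfrak{G}_\infty^*})$.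
   Context: Fix $d\in\mathbb{N}$. Points of $\mathbb{R}^{2d}$ are $z=(x,v)$. For $k\in\mathbb{N}$, $\mathfrak{g}_k$ is the real vector space of smooth functions $f:(\mathbb{R}^{2d})^k\to\mathbb{R}$ invariant under permutations of $z_1,\dots,z_k\in\mathbb{R}^{2d}$, with the topology generated by the seminorms $\sup_{|\alpha|\le n}\|\partial^\alpha f\|_{L^\infty(K)}$ ($K$ compact, $n\in\mathbb{N}$); $\mathfrak{g}_k^*$ is its strong dual (permutation-invariant compactly supported distributions). $\mathfrak{G}_\infty:=\bigoplus_{k=1}^\infty\mathfrak{g}_k$ with the locally convex direct sum topology (finitely many nonzero components), $\mathfrak{G}_\infty^*=\prod_{k=1}^\infty\mathfrak{g}_k^*$ its strong dual with the product topology; $\mathfrak{G}_\infty^{**}\cong\mathfrak{G}_\infty$, so Gâteaux derivatives $\mathrm{d}\mathcal{F}[\Gamma]$ of $\mathcal{F}\in\mathcal{C}^\infty(\mathfrak{G}_\infty^* )$ are identified with elements of $\mathfrak{G}_\infty$. Lie bracket on $\mathfrak{G}_\infty$: $[F,G]^{(k)}_{\mathfrak{G}_\infty}=\sum_{\ell,j\ge1,\ \ell+j-1=k}\mathrm{Sym}_k(f^{(\ell)}\wedge_1g^{(j)})$, where $$f^{(\ell)}\wedge_1g^{(j)}(z_1,\dots,z_k)=\ell j\big(\nabla_{x_1}f^{(\ell)}(z_1,\dots,z_\ell)\cdot\nabla_{v_1}g^{(j)}(z_1,z_{\ell+1},\dots,z_k)-\nabla_{x_1}g^{(j)}(z_1,\dots,z_j)\cdot\nabla_{v_1}f^{(\ell)}(z_1,z_{j+1},\dots,z_k)\big)$$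 and $\mathrm{Sym}_k(h)(z_1,\dots,z_k)=\frac1{k!}\sum_{\pi\in\mathbb{S}_k}h(z_{\pi(1)},\dots,z_{\pi(k)})$. Bracket of functionals: $\{\mathcal{F},\mathcal{G}\}_{\mathfrak{G}_\infty^*}(\Gamma)=\langle[\mathrm{d}\mathcal{F}[\Gamma],\mathrm{d}\mathcal{G}[\Gamma]]_{\mathfrak{G}_\infty},\Gamma\rangle$. $\mathcal{A}_\infty\subset\mathcal{C}^\infty(\mathfrak{G}_\infty^* )$ is the algebra generated under pointwise product by the functionals $\Gamma\mapsto\langle F,\Gamma\rangle$, $F\in\mathfrak{G}_\infty$, and the real constants. For $\mathcal{G}\in\mathcal{A}_\infty$, $X_{\mathcal{G}}$ is the unique $\mathcal{C}^\infty$ map $\mathfrak{G}_\infty^*\to\mathfrak{G}_\infty^*$ with $\mathrm{d}\mathcal{F}[\Gamma](X_{\mathcal{G}}(\Gamma))=\{\mathcal{F},\mathcal{G}\}_{\mathfrak{G}_\infty^*}(\Gamma)$ for all $\mathcal{F}\in\mathcal{A}_\infty$, $\Gamma\in\mathfrak{G}_\infty^*$. Smoothness is in the Gâteaux sense (all iterated directional derivatives exist and are jointly continuous). $\mathcal{H}_{VlH}(\Gamma):=\langle\mathbf{W}_{VlH},\Gamma\rangle_{\mathfrak{G}_\infty-\mathfrak{G}_\infty^*}$ with $\mathbf{W}_{VlH}:=(\tfrac12|v_1|^2,\ W(x_1-x_2),\ 0,0,\dots)\in\mathfrak{G}_\infty$. For a compactly supported distribution $\mu$ on $(\mathbb{R}^{2d})^{k+1}$,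 $\int_{\mathbb{R}^{2d}}dz_{k+1}\mu$ denotes the distribution $\phi\mapsto\langle\phi\otimes1,\mu\rangle$ on $(\mathbb{R}^{2d})^k$. *)

theory Defs
  imports "HOL-Analysis.Analysis" "HOL-Library.Function_Algebras"
begin

section \<open>Directional derivatives and smooth functions\<close>

instantiation "fun" :: (type, scaleR) scaleR
begin

definition scaleR_fun_def: "r *\<^sub>R f = (\<lambda>x. r *\<^sub>R f x)"

instance ..

end

lemma scaleR_fun_apply [simp]: "(r *\<^sub>R f) x = r *\<^sub>R f x"
  by (simp add: scaleR_fun_def)

instance "fun" :: (type, real_vector) real_vector
  by standard (auto simp: fun_eq_iff algebra_simps)

definition dir_deriv :: "'a::real_vector \<Rightarrow> ('a \<Rightarrow> real) \<Rightarrow> 'a \<Rightarrow> real" where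
  "dir_deriv e f x = deriv (\<lambda>t. f (x + t *\<^sub>R e)) 0"

definition dir_diff :: "'a::real_vector \<Rightarrow> ('a \<Rightarrow> real) \<Rightarrow> bool" where
  "dir_diff e f \<longleftrightarrow> (\<forall>x. (\<lambda>t. f (x + t *\<^sub>R e)) field_differentiable at 0)"

text \<open>
  A multi-index is given by the list \<open>es\<close> of the (basis) directions of differentiation,
  its order being \<open>length es\<close>; \<open>foldr dir_deriv es f\<close> is the corresponding iterated partial
  derivative.
\<close>

definition smooth_along :: "'a::{real_vector,topological_space} set \<Rightarrow> ('a \<Rightarrow> real) \<Rightarrow> bool" where
  "smooth_along E f \<longleftrightarrow>
     (\<forall>es\<in>lists E. continuous_on UNIV (foldr dir_deriv es f) \<and>
        (\<forall>e\<in>E. dir_diff e (foldr dir_deriv es f)))"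

lemma smooth_alongI:
  assumes "\<And>f. f \<in> S \<Longrightarrow> continuous_on UNIV f"
    and "\<And>f e. f \<in> S \<Longrightarrow> e \<in> E \<Longrightarrow> dir_diff e f"
    and "\<And>f e. f \<in> S \<Longrightarrow> e \<in> E \<Longrightarrow> dir_deriv e f \<in> S"
    and "f \<in> S"
  shows "smooth_along E f"
proof -
  have "foldr dir_deriv es f \<in> S" if "es \<in> lists E" for es
    using that by (induction es) (auto intro: assms)
  then show ?thesis
    unfolding smooth_along_def using assms by blast
qed

lemma smooth_along_continuous: "smooth_along E f \<Longrightarrow> continuous_on UNIV f"
  unfolding smooth_along_def by (metis foldr.simps(1) id_apply lists.Nil)

lemma smooth_along_dir_diff: "smooth_along E f \<Longrightarrow> e \<in> E \<Longrightarrow> dir_diff e f"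
  unfolding smooth_along_def by (metis foldr.simps(1) id_apply lists.Nil)

lemma smooth_along_dir_deriv:
  assumes "smooth_along E f" "e \<in> E"
  shows "smooth_along E (dir_deriv e f)"
  unfolding smooth_along_def
proof (intro ballI)
  fix es assume "es \<in> lists E"
  then have "es @ [e] \<in> lists E" using assms(2) by simp
  then show "continuous_on UNIV (foldr dir_deriv es (dir_deriv e f)) \<and>
      (\<forall>e'\<in>E. dir_diff e' (foldr dir_deriv es (dir_deriv e f)))"
    using assms(1)[unfolded smooth_along_def, rule_format, of "es @ [e]"] by simp
qed

lemma dir_deriv_const [simp]: "dir_deriv e (\<lambda>_. c) = (\<lambda>_. 0)"
  by (simp add: dir_deriv_def fun_eq_iff)

lemma dir_diff_const [simp]: "dir_diff e (\<lambda>_. c)"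
  by (simp add: dir_diff_def)

lemma smooth_along_const: "smooth_along E (\<lambda>_. c)"
  by (rule smooth_alongI[of "range (\<lambda>c _. c)"]) auto

lemma dir_deriv_add:
  "dir_diff e f \<Longrightarrow> dir_diff e g \<Longrightarrow>
     dir_deriv e (\<lambda>x. f x + g x) = (\<lambda>x. dir_deriv e f x + dir_deriv e g x)"
  by (simp add: dir_deriv_def dir_diff_def fun_eq_iff)

lemma dir_diff_add: "dir_diff e f \<Longrightarrow> dir_diff e g \<Longrightarrow> dir_diff e (\<lambda>x. f x + g x)"
  unfolding dir_diff_def by (auto intro: field_differentiable_add)

lemma dir_deriv_mult:
  "dir_diff e f \<Longrightarrow> dir_diff e g \<Longrightarrow>
     dir_deriv e (\<lambda>x. f x * g x) = (\<lambda>x. f x * dir_deriv e g x + dir_deriv e f x * g x)"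
  by (simp add: dir_deriv_def dir_diff_def fun_eq_iff)

lemma dir_diff_mult: "dir_diff e f \<Longrightarrow> dir_diff e g \<Longrightarrow> dir_diff e (\<lambda>x. f x * g x)"
  unfolding dir_diff_def by (auto intro: field_differentiable_mult)

lemma smooth_along_add:
  assumes "smooth_along E f" "smooth_along E g"
  shows "smooth_along E (\<lambda>x. f x + g x)"
proof (rule smooth_alongI[of "{\<lambda>x. f x + g x | f g. smooth_along E f \<and> smooth_along E g}"])
  fix h e assume h: "h \<in> {\<lambda>x. f x + g x | f g. smooth_along E f \<and> smooth_along E g}" and e: "e \<in> E"
  then show "dir_diff e h" by (auto intro: dir_diff_add smooth_along_dir_diff)
  from h obtain f g where fg: "h = (\<lambda>x. f x + g x)" "smooth_along E f" "smooth_along E g" by blast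
  then have "dir_deriv e h = (\<lambda>x. dir_deriv e f x + dir_deriv e g x)"
    using e by (simp add: dir_deriv_add smooth_along_dir_diff)
  with fg e show "dir_deriv e h \<in> {\<lambda>x. f x + g x | f g. smooth_along E f \<and> smooth_along E g}"
    using smooth_along_dir_deriv by blast
qed (use assms in \<open>auto intro: continuous_on_add smooth_along_continuous\<close>)

inductive_set product_sums :: "'a::{real_vector,topological_space} set \<Rightarrow> ('a \<Rightarrow> real) set"
  for E where
  prod: "smooth_along E f \<Longrightarrow> smooth_along E g \<Longrightarrow> (\<lambda>x. f x * g x) \<in> product_sums E"
| add: "p \<in> product_sums E \<Longrightarrow> q \<in> product_sums E \<Longrightarrow> (\<lambda>x. p x + q x) \<in> product_sums E"

lemma smooth_along_mult:
  assumes "smooth_along E f" "smooth_along E g"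
  shows "smooth_along E (\<lambda>x. f x * g x)"
proof (rule smooth_alongI[of "product_sums E"])
  show diff: "dir_diff e h" if "h \<in> product_sums E" "e \<in> E" for h e
    using that
    by (induction) (auto intro: dir_diff_add dir_diff_mult smooth_along_dir_diff)
  show "dir_deriv e h \<in> product_sums E" if "h \<in> product_sums E" "e \<in> E" for h e
    using that
  proof (induction)
    case (prod f g)
    then have "dir_deriv e (\<lambda>x. f x * g x) = (\<lambda>x. f x * dir_deriv e g x + dir_deriv e f x * g x)"
      by (simp add: dir_deriv_mult smooth_along_dir_diff)
    with prod show ?case
      by (auto intro!: product_sums.intros smooth_along_dir_deriv)
  next
    case (add p q)
    then show ?case by (simp add: dir_deriv_add diff product_sums.add)
  qed
  show "continuous_on UNIV h" if "h \<in> product_sums E" for h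
    using that
    by (induction) (auto intro: continuous_on_add continuous_on_mult smooth_along_continuous)
qed (use assms in \<open>auto intro: product_sums.prod\<close>)

lemma smooth_along_sum:
  "(\<And>i. i \<in> A \<Longrightarrow> smooth_along E (f i)) \<Longrightarrow> smooth_along E (\<lambda>x. \<Sum>i\<in>A. f i x)"
  by (induction A rule: infinite_finite_induct) (auto intro: smooth_along_const smooth_along_add)


section \<open>The spaces \<open>\<gg>\<^sub>k\<close> and their strong duals\<close>

type_synonym 'd phase = "(real^'d) \<times> (real^'d)"

text \<open>
  A point \<open>(z\<^sub>1, \<dots>, z\<^sub>k)\<close> of \<open>(\<real>\<^sup>2\<^sup>d)\<^sup>k\<close> is given by any sequence \<open>z :: nat \<Rightarrow> 'd phase\<close> with these
  entries at the positions \<open>1, \<dots>, k\<close>, and a function on \<open>(\<real>\<^sup>2\<^sup>d)\<^sup>k\<close> is a function of sequences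
  that depends on these entries only.  In particular, a function on \<open>(\<real>\<^sup>2\<^sup>d)\<^sup>k\<close> is also one on
  \<open>(\<real>\<^sup>2\<^sup>d)\<^sup>m\<close> for \<open>m \<ge> k\<close>.  The topology on sequences is the product topology, which for
  such functions induces the usual notion of continuity on \<open>(\<real>\<^sup>2\<^sup>d)\<^sup>k\<close>.
\<close>

type_synonym 'd config = "nat \<Rightarrow> 'd phase"

definition depends_upto :: "nat \<Rightarrow> ('d::finite config \<Rightarrow> real) \<Rightarrow> bool" where
  "depends_upto k f \<longleftrightarrow> (\<forall>z z'. (\<forall>i\<in>{1..k}. z i = z' i) \<longrightarrow> f z = f z')"

definition dir :: "nat \<Rightarrow> 'd::finite phase \<Rightarrow> 'd config" where
  "dir i b = (\<lambda>j. if j = i then b else 0)"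

definition dirs :: "nat \<Rightarrow> 'd::finite config set" where
  "dirs k = {dir i b | i b. i \<in> {1..k} \<and> b \<in> Basis}"

definition smooth_fns :: "nat \<Rightarrow> ('d::finite config \<Rightarrow> real) set" where
  "smooth_fns k = {f. depends_upto k f \<and> smooth_along (dirs k) f}"

definition g_space :: "nat \<Rightarrow> ('d::finite config \<Rightarrow> real) set" where
  "g_space k = {f \<in> smooth_fns k. \<forall>\<pi>. \<pi> permutes {1..k} \<longrightarrow> (\<forall>z. f (z \<circ> \<pi>) = f z)}"

definition g_seminorm :: "nat \<Rightarrow> 'd::finite config set \<Rightarrow> nat \<Rightarrow> ('d config \<Rightarrow> real) \<Rightarrow> real" where
  "g_seminorm k K n f =
     Sup {\<bar>foldr dir_deriv es f z\<bar> | es z. es \<in> lists (dirs k) \<and> length es \<le> n \<and> z \<in> K}"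

text \<open>The projections to \<open>(\<real>\<^sup>2\<^sup>d)\<^sup>k\<close> of the compact sets of sequences are the compact sets.\<close>

definition g_top :: "nat \<Rightarrow> ('d::finite config \<Rightarrow> real) topology" where
  "g_top k = topology_generated_by
     {{g \<in> g_space k. g_seminorm k K n (g - f) < \<epsilon>} | f K n \<epsilon>.
        f \<in> g_space k \<and> compact K \<and> K \<noteq> {} \<and> \<epsilon> > 0}"

definition g_bounded :: "nat \<Rightarrow> ('d::finite config \<Rightarrow> real) set \<Rightarrow> bool" where
  "g_bounded k B \<longleftrightarrow> B \<subseteq> g_space k \<and>
     (\<forall>U. openin (g_top k) U \<and> 0 \<in> U \<longrightarrow> (\<exists>r>0. B \<subseteq> (\<lambda>f. r *\<^sub>R f) ` U))"

text \<open>
  The functionals are set to \<open>0\<close> outside \<open>\<gg>\<^sub>k\<close>, so that elements of the dual are determined by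
  their restrictions to \<open>\<gg>\<^sub>k\<close>.
\<close>

definition g_dual :: "nat \<Rightarrow> (('d::finite config \<Rightarrow> real) \<Rightarrow> real) set" where
  "g_dual k = {\<gamma>.
     (\<forall>f\<in>g_space k. \<forall>g\<in>g_space k. \<gamma> (f + g) = \<gamma> f + \<gamma> g) \<and>
     (\<forall>c. \<forall>f\<in>g_space k. \<gamma> (c *\<^sub>R f) = c * \<gamma> f) \<and>
     continuous_map (g_top k) euclideanreal \<gamma> \<and>
     (\<forall>f. f \<notin> g_space k \<longrightarrow> \<gamma> f = 0)}"

definition strong_top :: "nat \<Rightarrow> (('d::finite config \<Rightarrow> real) \<Rightarrow> real) topology" where
  "strong_top k = topology_generated_by
     {{\<gamma>' \<in> g_dual k. (SUP f\<in>B. \<bar>\<gamma>' f - \<gamma> f\<bar>) < \<epsilon>} | \<gamma> B \<epsilon>.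
        \<gamma> \<in> g_dual k \<and> g_bounded k B \<and> B \<noteq> {} \<and> \<epsilon> > 0}"


section \<open>The space \<open>\<GG>\<^sub>\<infinity>\<close> and its dual\<close>

lemma zero_in_g_space: "(\<lambda>_. 0) \<in> g_space k"
  by (auto simp: g_space_def smooth_fns_def depends_upto_def intro: smooth_along_const)

lemma zero_in_g_dual: "(\<lambda>_. 0) \<in> g_dual k"
  by (simp add: g_dual_def)

text \<open>Sequences are indexed by \<open>k \<ge> 1\<close>; the spurious entry at \<open>0\<close> is set to \<open>0\<close>.\<close>

typedef (overloaded) 'd::finite G_inf =
  "{F :: nat \<Rightarrow> 'd config \<Rightarrow> real.
      F 0 = (\<lambda>_. 0) \<and> (\<forall>k\<ge>1. F k \<in> g_space k) \<and> finite {k. F k \<noteq> (\<lambda>_. 0)}}"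
  morphisms component Abs_G_inf
  by (rule exI[of _ "\<lambda>_ _. 0"]) (simp add: zero_in_g_space)

typedef (overloaded) 'd::finite G_dual =
  "{\<Gamma> :: nat \<Rightarrow> ('d config \<Rightarrow> real) \<Rightarrow> real.
      \<Gamma> 0 = (\<lambda>_. 0) \<and> (\<forall>k\<ge>1. \<Gamma> k \<in> g_dual k)}"
  morphisms dual_component Abs_G_dual
  by (rule exI[of _ "\<lambda>_ _. 0"]) (simp add: zero_in_g_dual)

setup_lifting type_definition_G_inf
setup_lifting type_definition_G_dual

lemma add_in_g_dual: "\<gamma> \<in> g_dual k \<Longrightarrow> \<delta> \<in> g_dual k \<Longrightarrow> (\<lambda>f. \<gamma> f + \<delta> f) \<in> g_dual k"
  by (simp add: g_dual_def continuous_map_add algebra_simps)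

lemma scale_in_g_dual: "\<gamma> \<in> g_dual k \<Longrightarrow> (\<lambda>f. r * \<gamma> f) \<in> g_dual k"
  by (simp add: g_dual_def continuous_map_real_mult algebra_simps)

instantiation G_dual :: (finite) real_vector
begin

lift_definition zero_G_dual :: "'a G_dual" is "\<lambda>_ _. 0"
  by (simp add: zero_in_g_dual)

lift_definition plus_G_dual :: "'a G_dual \<Rightarrow> 'a G_dual \<Rightarrow> 'a G_dual"
  is "\<lambda>\<Gamma> \<Delta> k f. \<Gamma> k f + \<Delta> k f"
  by (simp add: add_in_g_dual)

lift_definition scaleR_G_dual :: "real \<Rightarrow> 'a G_dual \<Rightarrow> 'a G_dual"
  is "\<lambda>r \<Gamma> k f. r * \<Gamma> k f"
  by (simp add: scale_in_g_dual)

definition uminus_G_dual :: "'a G_dual \<Rightarrow> 'a G_dual" where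
  "uminus_G_dual \<Gamma> = (-1) *\<^sub>R \<Gamma>"

definition minus_G_dual :: "'a G_dual \<Rightarrow> 'a G_dual \<Rightarrow> 'a G_dual" where
  "minus_G_dual \<Gamma> \<Delta> = \<Gamma> + - \<Delta>"

instance
  by standard
    (auto simp: uminus_G_dual_def minus_G_dual_def,
     (transfer, auto simp: fun_eq_iff algebra_simps)+)

end

text \<open>The product topology: the coarsest one that makes all \<open>\<Gamma> \<mapsto> \<gamma>\<^sup>(\<^sup>k\<^sup>)\<close> continuous.\<close>

instantiation G_dual :: (finite) topological_space
begin

definition open_G_dual :: "'a G_dual set \<Rightarrow> bool" where
  "open_G_dual = generate_topology
     {{\<Gamma>. dual_component \<Gamma> k \<in> U} | k U. k \<ge> 1 \<and> openin (strong_top k) U}"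

instance
  by standard (auto simp: open_G_dual_def intro: generate_topology.intros)

end

definition pairing :: "'d::finite G_inf \<Rightarrow> 'd G_dual \<Rightarrow> real" where
  "pairing F \<Gamma> = (\<Sum>k | component F k \<noteq> (\<lambda>_. 0). dual_component \<Gamma> k (component F k))"


section \<open>The Lie bracket\<close>

definition Sym :: "nat \<Rightarrow> ('d::finite config \<Rightarrow> real) \<Rightarrow> 'd config \<Rightarrow> real" where
  "Sym k h z = (\<Sum>\<pi> | \<pi> permutes {1..k}. h (z \<circ> \<pi>)) / fact k"

definition dx :: "nat \<Rightarrow> (real^'d::finite) \<Rightarrow> ('d config \<Rightarrow> real) \<Rightarrow> 'd config \<Rightarrow> real" where
  "dx i b = dir_deriv (dir i (b, 0))"

definition dv :: "nat \<Rightarrow> (real^'d::finite) \<Rightarrow> ('d config \<Rightarrow> real) \<Rightarrow> 'd config \<Rightarrow> real" where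
  "dv i b = dir_deriv (dir i (0, b))"

text \<open>\<open>z \<circ> skip l\<close> is \<open>(z\<^sub>1, z\<^bsub>l+1\<^esub>, z\<^bsub>l+2\<^esub>, \<dots>)\<close>.\<close>

definition skip :: "nat \<Rightarrow> nat \<Rightarrow> nat" where
  "skip l i = (if i = 1 then 1 else i + l - 1)"

definition wedge1 ::
    "nat \<Rightarrow> nat \<Rightarrow> ('d::finite config \<Rightarrow> real) \<Rightarrow> ('d config \<Rightarrow> real) \<Rightarrow> 'd config \<Rightarrow> real" where
  "wedge1 l j f g z = real l * real j *
     ((\<Sum>b\<in>Basis. dx 1 b f z * dv 1 b g (z \<circ> skip l)) -
      (\<Sum>b\<in>Basis. dx 1 b g z * dv 1 b f (z \<circ> skip j)))"

lemma smooth_fns_I: "depends_upto k f \<Longrightarrow> smooth_along (dirs k) f \<Longrightarrow> f \<in> smooth_fns k"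
  by (simp add: smooth_fns_def)

lemma smooth_fns_const: "(\<lambda>_. c) \<in> smooth_fns k"
  by (auto simp: smooth_fns_def depends_upto_def intro: smooth_along_const)

lemma depends_upto_combine:
  "depends_upto k f \<Longrightarrow> depends_upto k g \<Longrightarrow> depends_upto k (\<lambda>z. c (f z) (g z))"
  unfolding depends_upto_def by metis

lemma smooth_fns_add:
  "f \<in> smooth_fns k \<Longrightarrow> g \<in> smooth_fns k \<Longrightarrow> (\<lambda>z. f z + g z) \<in> smooth_fns k"
  by (simp add: smooth_fns_def smooth_along_add depends_upto_combine)

lemma smooth_fns_mult:
  "f \<in> smooth_fns k \<Longrightarrow> g \<in> smooth_fns k \<Longrightarrow> (\<lambda>z. f z * g z) \<in> smooth_fns k"
  by (simp add: smooth_fns_def smooth_along_mult depends_upto_combine)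

lemma smooth_fns_cmult: "f \<in> smooth_fns k \<Longrightarrow> (\<lambda>z. c * f z) \<in> smooth_fns k"
  by (intro smooth_fns_mult smooth_fns_const)

lemma smooth_fns_diff:
  "f \<in> smooth_fns k \<Longrightarrow> g \<in> smooth_fns k \<Longrightarrow> (\<lambda>z. f z - g z) \<in> smooth_fns k"
  using smooth_fns_add[of f k "\<lambda>z. (-1) * g z"] smooth_fns_cmult[of g k "-1"] by simp

lemma smooth_fns_sum:
  "(\<And>i. i \<in> A \<Longrightarrow> f i \<in> smooth_fns k) \<Longrightarrow> (\<lambda>z. \<Sum>i\<in>A. f i z) \<in> smooth_fns k"
  by (induction A rule: infinite_finite_induct) (auto intro: smooth_fns_const smooth_fns_add)

lemma depends_upto_dir_deriv:
  assumes "depends_upto k f"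
  shows "depends_upto k (dir_deriv e f)"
  unfolding depends_upto_def dir_deriv_def
proof (intro allI impI)
  fix z z' :: "'a config" assume "\<forall>i\<in>{1..k}. z i = z' i"
  then have "f (z + t *\<^sub>R e) = f (z' + t *\<^sub>R e)" for t
    using assms[unfolded depends_upto_def, rule_format, of "z + t *\<^sub>R e" "z' + t *\<^sub>R e"] by simp
  then show "deriv (\<lambda>t. f (z + t *\<^sub>R e)) 0 = deriv (\<lambda>t. f (z' + t *\<^sub>R e)) 0" by simp
qed

lemma dirs_I: "1 \<le> i \<Longrightarrow> i \<le> k \<Longrightarrow> b \<in> Basis \<Longrightarrow> dir i b \<in> dirs k"
  unfolding dirs_def by fastforce

lemma smooth_fns_dir_deriv:
  "f \<in> smooth_fns k \<Longrightarrow> e \<in> dirs k \<Longrightarrow> dir_deriv e f \<in> smooth_fns k"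
  by (simp add: smooth_fns_def depends_upto_dir_deriv smooth_along_dir_deriv)

lemma smooth_fns_dx: "f \<in> smooth_fns k \<Longrightarrow> b \<in> Basis \<Longrightarrow> 1 \<le> i \<Longrightarrow> i \<le> k \<Longrightarrow> dx i b f \<in> smooth_fns k"
  unfolding dx_def by (intro smooth_fns_dir_deriv dirs_I) (auto simp: Basis_prod_def)

lemma smooth_fns_dv: "f \<in> smooth_fns k \<Longrightarrow> b \<in> Basis \<Longrightarrow> 1 \<le> i \<Longrightarrow> i \<le> k \<Longrightarrow> dv i b f \<in> smooth_fns k"
  unfolding dv_def by (intro smooth_fns_dir_deriv dirs_I) (auto simp: Basis_prod_def)

lemma reindex_dir:
  assumes f: "depends_upto j f" and \<sigma>: "inj_on \<sigma> {1..j}"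
  obtains (hit) p where "p \<in> {1..j}" "\<sigma> p = i"
      "\<And>z t. f ((z + t *\<^sub>R dir i b) \<circ> \<sigma>) = f ((z \<circ> \<sigma>) + t *\<^sub>R dir p b)"
  | (miss) "\<And>z t. f ((z + t *\<^sub>R dir i b) \<circ> \<sigma>) = f (z \<circ> \<sigma>)"
proof (cases "\<exists>p\<in>{1..j}. \<sigma> p = i")
  case True
  then obtain p where p: "p \<in> {1..j}" "\<sigma> p = i" by blast
  have iff: "\<sigma> q = i \<longleftrightarrow> q = p" if "q \<in> {1..j}" for q
    using inj_onD[OF \<sigma>, of q p] p that by metis
  have "f ((z + t *\<^sub>R dir i b) \<circ> \<sigma>) = f ((z \<circ> \<sigma>) + t *\<^sub>R dir p b)" for z t
    by (rule f[unfolded depends_upto_def, rule_format]) (simp add: dir_def iff)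
  with p show ?thesis by (rule hit)
next
  case False
  then have iff: "\<sigma> q \<noteq> i" if "q \<in> {1..j}" for q
    using that by metis
  have "f ((z + t *\<^sub>R dir i b) \<circ> \<sigma>) = f (z \<circ> \<sigma>)" for z t
    by (rule f[unfolded depends_upto_def, rule_format]) (simp add: dir_def iff)
  then show ?thesis by (rule miss)
qed

lemma smooth_fns_reindex:
  fixes f :: "'d::finite config \<Rightarrow> real"
  assumes f: "f \<in> smooth_fns j" and \<sigma>: "inj_on \<sigma> {1..j}" "\<sigma> ` {1..j} \<subseteq> {1..k}"
  shows "(\<lambda>z. f (z \<circ> \<sigma>)) \<in> smooth_fns k"
proof (rule smooth_fns_I)
  show "depends_upto k (\<lambda>z. f (z \<circ> \<sigma>))"
    unfolding depends_upto_def
  proof (intro allI impI)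
    fix z z' :: "'d config" assume "\<forall>i\<in>{1..k}. z i = z' i"
    then have "\<forall>i\<in>{1..j}. (z \<circ> \<sigma>) i = (z' \<circ> \<sigma>) i" using \<sigma>(2) by (simp add: image_subset_iff)
    then show "f (z \<circ> \<sigma>) = f (z' \<circ> \<sigma>)"
      using f unfolding smooth_fns_def depends_upto_def by blast
  qed
  let ?S = "{\<lambda>z. f (z \<circ> \<sigma>) | f :: 'd config \<Rightarrow> real. f \<in> smooth_fns j}"
  show "smooth_along (dirs k) (\<lambda>z. f (z \<circ> \<sigma>))"
  proof (rule smooth_alongI[of ?S])
    fix h :: "'d config \<Rightarrow> real" assume "h \<in> ?S"
    then obtain f where h: "h = (\<lambda>z. f (z \<circ> \<sigma>))" and f: "f \<in> smooth_fns j"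
      by (elim CollectE exE conjE)
    then have dep: "depends_upto j f" and sm: "smooth_along (dirs j) f"
      by (simp_all add: smooth_fns_def)
    have "continuous_on UNIV (\<lambda>z :: 'd config. z \<circ> \<sigma>)"
      unfolding comp_def
      by (intro continuous_on_coordinatewise_then_product continuous_on_product_coordinates)
    from continuous_on_compose2[OF smooth_along_continuous[OF sm] this]
    show "continuous_on UNIV h" unfolding h by simp
    fix e :: "'d config" assume "e \<in> dirs k"
    then obtain i b where e: "e = dir i b" "b \<in> Basis" by (auto simp: dirs_def)
    have *: "dir_diff e h \<and> dir_deriv e h \<in> ?S"
      using dep \<sigma>(1)
    proof (cases rule: reindex_dir[where i = i and b = b])
      case (hit p)
      then have p: "dir p b \<in> dirs j" using e by (intro dirs_I) auto
      have "dir_diff e h"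
        using smooth_along_dir_diff[OF sm p] hit by (simp add: dir_diff_def h e)
      moreover have "dir_deriv e h = (\<lambda>z. dir_deriv (dir p b) f (z \<circ> \<sigma>))"
        using hit by (simp add: dir_deriv_def h e fun_eq_iff)
      ultimately show ?thesis
        by (intro conjI CollectI exI[of _ "dir_deriv (dir p b) f"] smooth_fns_dir_deriv[OF f p])
    next
      case miss
      have "dir_diff e h"
        using miss by (simp add: dir_diff_def h e)
      moreover have "dir_deriv e h = (\<lambda>z. (\<lambda>_. 0) (z \<circ> \<sigma>))"
        using miss by (simp add: dir_deriv_def h e fun_eq_iff)
      ultimately show ?thesis
        by (intro conjI CollectI exI[of _ "\<lambda>_. 0"] smooth_fns_const)
    qed
    show "dir_diff e h" by (rule conjunct1[OF *])
    show "dir_deriv e h \<in> ?S" by (rule conjunct2[OF *])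
  next
    show "(\<lambda>z. f (z \<circ> \<sigma>)) \<in> ?S"
      by (intro CollectI exI[of _ f] conjI refl f)
  qed
qed

lemma smooth_fns_mono: "f \<in> smooth_fns j \<Longrightarrow> j \<le> k \<Longrightarrow> f \<in> smooth_fns k"
  using smooth_fns_reindex[of f j id k] by simp

lemma smooth_fns_Sym:
  assumes "h \<in> smooth_fns k"
  shows "Sym k h \<in> smooth_fns k"
proof -
  have "(\<lambda>z. h (z \<circ> \<pi>)) \<in> smooth_fns k" if "\<pi> permutes {1..k}" for \<pi>
    by (rule smooth_fns_reindex[of h k \<pi> k])
      (simp_all only: assms permutes_inj_on[OF that] permutes_image[OF that] order_refl)
  then have "(\<lambda>z. (1 / fact k) * (\<Sum>\<pi> | \<pi> permutes {1..k}. h (z \<circ> \<pi>))) \<in> smooth_fns k"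
    by (intro smooth_fns_cmult smooth_fns_sum) auto
  moreover have "Sym k h = (\<lambda>z. (1 / fact k) * (\<Sum>\<pi> | \<pi> permutes {1..k}. h (z \<circ> \<pi>)))"
    by (simp add: Sym_def fun_eq_iff)
  ultimately show ?thesis by simp
qed

lemma Sym_permute:
  assumes "\<rho> permutes {1..k}"
  shows "Sym k h (z \<circ> \<rho>) = Sym k h z"
proof -
  have "(\<Sum>\<pi> | \<pi> permutes {1..k}. h (z \<circ> \<rho> \<circ> \<pi>)) = (\<Sum>\<pi> | \<pi> permutes {1..k}. h (z \<circ> \<pi>))"
    using assms
    by (intro sum.reindex_bij_witness[of _ "\<lambda>\<pi>. inv \<rho> \<circ> \<pi>" "\<lambda>\<pi>. \<rho> \<circ> \<pi>"])
      (auto simp: permutes_compose permutes_inv o_assoc permutes_inv_o)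
  then show ?thesis by (simp add: Sym_def)
qed

lemma Sym_in_g_space: "h \<in> smooth_fns k \<Longrightarrow> Sym k h \<in> g_space k"
  by (simp add: g_space_def smooth_fns_Sym Sym_permute)

lemma g_space_sum:
  "(\<And>i. i \<in> A \<Longrightarrow> f i \<in> g_space k) \<Longrightarrow> (\<lambda>z. \<Sum>i\<in>A. f i z) \<in> g_space k"
  by (auto simp: g_space_def intro!: smooth_fns_sum sum.cong)

lemma smooth_fns_wedge1:
  assumes f: "f \<in> smooth_fns l" and g: "g \<in> smooth_fns j" and "l \<ge> 1" "j \<ge> 1" "l + j - 1 = k"
  shows "wedge1 l j f g \<in> smooth_fns k"
proof -
  have re: "(\<lambda>z. h (z \<circ> skip m)) \<in> smooth_fns k"
    if "h \<in> smooth_fns n" "n \<ge> 1" "m \<ge> 1" "m + n - 1 = k" for h :: "'a config \<Rightarrow> real" and n m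
  proof (rule smooth_fns_reindex[OF that(1)])
    show "inj_on (skip m) {1..n}"
    proof (rule inj_onI)
      fix p q assume "p \<in> {1..n}" "q \<in> {1..n}" "skip m p = skip m q"
      then show "p = q" using that(3) unfolding skip_def atLeastAtMost_iff by presburger
    qed
    show "skip m ` {1..n} \<subseteq> {1..k}"
    proof (rule image_subsetI)
      fix p assume "p \<in> {1..n}"
      then show "skip m p \<in> {1..k}"
        using that(2-4) unfolding skip_def atLeastAtMost_iff by presburger
    qed
  qed
  have lift: "h \<in> smooth_fns k" if "h \<in> smooth_fns n" "n \<le> k" for h :: "'a config \<Rightarrow> real" and n
    using that smooth_fns_mono by blast
  have 1: "(\<lambda>z. dx 1 b f z * dv 1 b g (z \<circ> skip l)) \<in> smooth_fns k" if "b \<in> Basis" for b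
    by (rule smooth_fns_mult[OF lift[OF smooth_fns_dx[OF f that]] re[OF smooth_fns_dv[OF g that]]])
      (use assms in simp_all)
  have 2: "(\<lambda>z. dx 1 b g z * dv 1 b f (z \<circ> skip j)) \<in> smooth_fns k" if "b \<in> Basis" for b
    by (rule smooth_fns_mult[OF lift[OF smooth_fns_dx[OF g that]] re[OF smooth_fns_dv[OF f that]]])
      (use assms in simp_all)
  show ?thesis
    unfolding wedge1_def
    by (intro smooth_fns_cmult smooth_fns_diff smooth_fns_sum 1 2)
qed

lemma wedge1_zero: "wedge1 l j (\<lambda>_. 0) g = (\<lambda>_. 0)" "wedge1 l j f (\<lambda>_. 0) = (\<lambda>_. 0)"
  by (auto simp: wedge1_def dx_def dv_def)

lemma Sym_zero: "Sym k (\<lambda>_. 0) = (\<lambda>_. 0)"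
  by (auto simp: Sym_def)

definition lie_seq ::
    "(nat \<Rightarrow> 'd::finite config \<Rightarrow> real) \<Rightarrow> (nat \<Rightarrow> 'd config \<Rightarrow> real) \<Rightarrow> nat \<Rightarrow> 'd config \<Rightarrow> real" where
  "lie_seq F G k z =
     (\<Sum>(l, j) \<in> {(l, j). l \<ge> 1 \<and> j \<ge> 1 \<and> l + j - 1 = k}. Sym k (wedge1 l j (F l) (G j)) z)"

lemma lie_seq_in_g_space:
  assumes "\<forall>k\<ge>1. F k \<in> g_space k" "\<forall>k\<ge>1. G k \<in> g_space k"
  shows "lie_seq F G k \<in> g_space k"
proof -
  have "Sym k (wedge1 (fst p) (snd p) (F (fst p)) (G (snd p))) \<in> g_space k"
    if "p \<in> {(l, j). l \<ge> 1 \<and> j \<ge> 1 \<and> l + j - 1 = k}" for p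
  proof (rule Sym_in_g_space, rule smooth_fns_wedge1)
    show "fst p \<ge> 1" "snd p \<ge> 1" "fst p + snd p - 1 = k"
      using that by auto
    then show "F (fst p) \<in> smooth_fns (fst p)" "G (snd p) \<in> smooth_fns (snd p)"
      using assms unfolding g_space_def by blast+
  qed
  then have "(\<lambda>z. \<Sum>p\<in>{(l, j). l \<ge> 1 \<and> j \<ge> 1 \<and> l + j - 1 = k}.
      Sym k (wedge1 (fst p) (snd p) (F (fst p)) (G (snd p))) z) \<in> g_space k"
    by (rule g_space_sum)
  moreover have "lie_seq F G k = (\<lambda>z. \<Sum>p\<in>{(l, j). l \<ge> 1 \<and> j \<ge> 1 \<and> l + j - 1 = k}.
      Sym k (wedge1 (fst p) (snd p) (F (fst p)) (G (snd p))) z)"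
    unfolding lie_seq_def case_prod_unfold by (rule ext) (rule refl)
  ultimately show ?thesis by (simp only:)
qed

lemma lie_seq_0: "lie_seq F G 0 = (\<lambda>_. 0)"
proof
  fix z
  have "{(l, j). l \<ge> 1 \<and> j \<ge> 1 \<and> l + j - 1 = (0::nat)} = {}" by auto
  then show "lie_seq F G 0 z = 0" unfolding lie_seq_def by (simp only: sum.empty)
qed

lemma finite_lie_seq:
  assumes "finite {k. F k \<noteq> (\<lambda>_. 0)}" "finite {k. G k \<noteq> (\<lambda>_. 0)}"
  shows "finite {k. lie_seq F G k \<noteq> (\<lambda>_. 0)}"
proof (rule finite_subset)
  let ?A = "(\<lambda>(l, j). l + j - 1) ` ({k. F k \<noteq> (\<lambda>_. 0)} \<times> {k. G k \<noteq> (\<lambda>_. 0)})"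
  show "finite ?A"
    using assms by (intro finite_imageI finite_cartesian_product)
  have "lie_seq F G k = (\<lambda>_. 0)" if k: "k \<notin> ?A" for k
  proof
    fix z
    have "Sym k (wedge1 l j (F l) (G j)) z = 0" if "l + j - 1 = k" for l j
    proof (cases "F l = (\<lambda>_. 0)")
      case True
      then show ?thesis by (simp only: wedge1_zero Sym_zero)
    next
      case False
      have "G j = (\<lambda>_. 0)"
      proof (rule ccontr)
        assume "G j \<noteq> (\<lambda>_. 0)"
        with False have "(l, j) \<in> {k. F k \<noteq> (\<lambda>_. 0)} \<times> {k. G k \<noteq> (\<lambda>_. 0)}"
          by (simp only: mem_Sigma_iff mem_Collect_eq simp_thms)
        from imageI[OF this, of "\<lambda>(l, j). l + j - 1"] have "k \<in> ?A"
          unfolding prod.case that .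
        with k show False ..
      qed
      then show ?thesis by (simp only: wedge1_zero Sym_zero)
    qed
    then show "lie_seq F G k z = 0"
      unfolding lie_seq_def by (intro sum.neutral) auto
  qed
  then show "{k. lie_seq F G k \<noteq> (\<lambda>_. 0)} \<subseteq> ?A"
    by blast
qed

lift_definition lie :: "'d::finite G_inf \<Rightarrow> 'd G_inf \<Rightarrow> 'd G_inf" is lie_seq
  by (intro conjI allI impI lie_seq_0 lie_seq_in_g_space finite_lie_seq) simp_all


section \<open>Smoothness in the sense of Gateaux\<close>

definition has_curve_deriv ::
    "(real \<Rightarrow> 'a::{real_vector,topological_space}) \<Rightarrow> 'a \<Rightarrow> real \<Rightarrow> real set \<Rightarrow> bool" where
  "has_curve_deriv c y t I \<longleftrightarrow> ((\<lambda>s. (c s - c t) /\<^sub>R (s - t)) \<longlongrightarrow> y) (at t within I)"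

text \<open>
  \<open>D n x h\<close> is the \<open>n\<close>-th directional derivative of \<open>\<Phi>\<close> at \<open>x\<close> in the directions
  \<open>h 0, \<dots>, h (n - 1)\<close>.
\<close>

definition gateaux_smooth ::
    "('a::{real_vector,topological_space} \<Rightarrow> 'b::{real_vector,topological_space}) \<Rightarrow> bool" where
  "gateaux_smooth \<Phi> \<longleftrightarrow> (\<exists>D :: nat \<Rightarrow> 'a \<Rightarrow> (nat \<Rightarrow> 'a) \<Rightarrow> 'b.
     (\<forall>x h. D 0 x h = \<Phi> x) \<and>
     (\<forall>n x h. has_curve_deriv (\<lambda>t. D n (x + t *\<^sub>R h n) h) (D (Suc n) x h) 0 UNIV) \<and>
     (\<forall>n. continuous_on UNIV (\<lambda>(x, h). D n x h)))"

definition smooth_curve_on :: "real set \<Rightarrow> (real \<Rightarrow> 'a::{real_vector,topological_space}) \<Rightarrow> bool" where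
  "smooth_curve_on I c \<longleftrightarrow> (\<exists>D :: nat \<Rightarrow> real \<Rightarrow> 'a.
     (\<forall>t\<in>I. D 0 t = c t) \<and>
     (\<forall>n. \<forall>t\<in>I. has_curve_deriv (D n) (D (Suc n) t) t I) \<and>
     (\<forall>n. continuous_on I (D n)))"


section \<open>The weak Lie-Poisson structure\<close>

inductive_set A_inf :: "('d::finite G_dual \<Rightarrow> real) set" where
  const: "(\<lambda>_. c) \<in> A_inf"
| linear: "pairing F \<in> A_inf"
| add: "\<F> \<in> A_inf \<Longrightarrow> \<G> \<in> A_inf \<Longrightarrow> (\<lambda>\<Gamma>. \<F> \<Gamma> + \<G> \<Gamma>) \<in> A_inf"
| mult: "\<F> \<in> A_inf \<Longrightarrow> \<G> \<in> A_inf \<Longrightarrow> (\<lambda>\<Gamma>. \<F> \<Gamma> * \<G> \<Gamma>) \<in> A_inf"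

text \<open>
  The Gateaux derivative of \<open>\<F>\<close> at \<open>\<Gamma>\<close> as an element of \<open>\<GG>\<^sub>\<infinity>\<close>, under the identification of
  \<open>\<GG>\<^sub>\<infinity>\<close> with its bidual.
\<close>

definition grad :: "('d::finite G_dual \<Rightarrow> real) \<Rightarrow> 'd G_dual \<Rightarrow> 'd G_inf" where
  "grad \<F> \<Gamma> = (THE F. \<forall>\<Delta>. pairing F \<Delta> = dir_deriv \<Delta> \<F> \<Gamma>)"

definition poisson ::
    "('d::finite G_dual \<Rightarrow> real) \<Rightarrow> ('d G_dual \<Rightarrow> real) \<Rightarrow> 'd G_dual \<Rightarrow> real" where
  "poisson \<F> \<G> \<Gamma> = pairing (lie (grad \<F> \<Gamma>) (grad \<G> \<Gamma>)) \<Gamma>"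

definition is_hamiltonian_vf ::
    "('d::finite G_dual \<Rightarrow> real) \<Rightarrow> ('d G_dual \<Rightarrow> 'd G_dual) \<Rightarrow> bool" where
  "is_hamiltonian_vf \<G> X \<longleftrightarrow> gateaux_smooth X \<and>
     (\<forall>\<F>\<in>A_inf. \<forall>\<Gamma>. dir_deriv (X \<Gamma>) \<F> \<Gamma> = poisson \<F> \<G> \<Gamma>)"

definition hamiltonian_vf :: "('d::finite G_dual \<Rightarrow> real) \<Rightarrow> 'd G_dual \<Rightarrow> 'd G_dual" where
  "hamiltonian_vf \<G> = (THE X. is_hamiltonian_vf \<G> X)"


section \<open>The Vlasov hierarchy\<close>

definition W_VlH_seq :: "((real^'d) \<Rightarrow> real) \<Rightarrow> nat \<Rightarrow> 'd::finite config \<Rightarrow> real" where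
  "W_VlH_seq W k =
     (if k = 1 then (\<lambda>z. (1/2) * (norm (snd (z 1)))\<^sup>2)
      else if k = 2 then (\<lambda>z. W (fst (z 1) - fst (z 2)))
      else (\<lambda>_. 0))"

lemma W_VlH_seq_in_g_space:
  assumes W: "smooth_along Basis W" "\<And>x. W (- x) = W x" and "k \<ge> 1"
  shows "W_VlH_seq W k \<in> g_space k"
proof -
  consider "k = 1" | "k = 2" | "k \<noteq> 1" "k \<noteq> 2" by blast
  then show ?thesis
  proof cases
    case 1
    let ?P = "\<lambda>b (z :: 'a config). snd (z 1) \<bullet> b"
    have P: "?P b \<in> smooth_fns 1" if "b \<in> Basis" for b
    proof (rule smooth_fns_I)
      show "depends_upto 1 (?P b)" by (simp add: depends_upto_def)
      have line: "?P b (z + t *\<^sub>R e) = ?P b z + t * ?P b e" for z t and e :: "'a config"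
        by (simp add: inner_add_left)
      show "smooth_along (dirs 1) (?P b)"
      proof (rule smooth_alongI[of "insert (?P b) (range (\<lambda>c _. c))"])
        have deriv: "((\<lambda>t. ?P b (z + t *\<^sub>R e)) has_field_derivative ?P b e) (at 0)"
          for z and e :: "'a config"
          unfolding line by (auto intro!: derivative_eq_intros)
        fix f and e :: "'a config" assume f: "f \<in> insert (?P b) (range (\<lambda>c _. c))"
        have "continuous_on UNIV (?P b)"
          by (intro continuous_intros continuous_on_product_coordinates)
        with f show "continuous_on UNIV f" by auto
        have "dir_diff e (?P b)"
          unfolding dir_diff_def field_differentiable_def using deriv by blast
        with f show "dir_diff e f" by auto
        have "dir_deriv e (?P b) = (\<lambda>_. ?P b e)"
          unfolding dir_deriv_def by (rule ext) (rule DERIV_imp_deriv[OF deriv])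
        with f show "dir_deriv e f \<in> insert (?P b) (range (\<lambda>c _. c))" by auto
      qed simp
    qed
    have "(norm (snd (z 1)))\<^sup>2 = (\<Sum>b\<in>Basis. ?P b z * ?P b z)" for z :: "'a config"
      unfolding power2_norm_eq_inner by (rule euclidean_inner)
    moreover have "(\<lambda>z. (1/2) * (\<Sum>b\<in>Basis. ?P b z * ?P b z)) \<in> smooth_fns 1"
      by (intro smooth_fns_cmult smooth_fns_sum smooth_fns_mult P)
    ultimately have "W_VlH_seq W 1 \<in> smooth_fns 1"
      by (simp add: W_VlH_seq_def)
    then show ?thesis
      using 1 by (auto simp: g_space_def)
  next
    case 2
    let ?L = "\<lambda>z :: 'a config. fst (z 1) - fst (z 2)"
    let ?S = "{\<lambda>z. c * V (?L z) | c V. smooth_along Basis V}"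
    have line: "?L (z + t *\<^sub>R e) = ?L z + t *\<^sub>R ?L e" for z t and e :: "'a config"
      by (simp add: algebra_simps)
    have "smooth_along (dirs 2) (\<lambda>z. 1 * W (?L z))"
    proof (rule smooth_alongI[of ?S])
      fix f and e :: "'a config" assume "f \<in> ?S"
      then obtain c V where f: "f = (\<lambda>z. c * V (?L z))" and V: "smooth_along Basis V"
        by (elim CollectE exE conjE)
      have "continuous_on UNIV ?L"
        by (intro continuous_intros continuous_on_product_coordinates)
      from continuous_on_compose2[OF smooth_along_continuous[OF V] this]
      show "continuous_on UNIV f" unfolding f by (intro continuous_intros) simp
      assume "e \<in> dirs 2"
      then obtain i b where e: "e = dir i b" "i = 1 \<or> i = 2" "b \<in> Basis"
        unfolding dirs_def by fastforce
      then obtain s b' where s: "?L e = s *\<^sub>R b'" "b' \<in> Basis"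
      proof -
        have "?L e = fst b \<or> ?L e = - fst b" using e by (auto simp: dir_def)
        moreover have "fst b = 0 \<or> fst b \<in> Basis" using e(3) by (auto simp: Basis_prod_def)
        moreover obtain b0 :: "real^'a" where "b0 \<in> Basis" using nonempty_Basis by blast
        ultimately show ?thesis
          using that[of 0 b0] that[of 1 "fst b"] that[of "-1" "fst b"] by auto
      qed
      have deriv: "((\<lambda>t. f (z + t *\<^sub>R e)) has_field_derivative c * s * dir_deriv b' V (?L z)) (at 0)"
        for z
      proof -
        have "((\<lambda>t. V (?L z + t *\<^sub>R b')) has_field_derivative dir_deriv b' V (?L z)) (at (s * 0))"
          using smooth_along_dir_diff[OF V s(2)]
          by (simp add: dir_diff_def dir_deriv_def field_differentiable_derivI)
        then have "((\<lambda>t. V (?L z + (s * t) *\<^sub>R b')) has_field_derivative dir_deriv b' V (?L z) * s) (at 0)"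
          by (rule DERIV_chain2) (auto intro!: derivative_eq_intros)
        then have "((\<lambda>t. c * V (?L z + (s * t) *\<^sub>R b')) has_field_derivative
            c * (dir_deriv b' V (?L z) * s)) (at 0)"
          by (rule DERIV_cmult)
        then show ?thesis
          unfolding f line s(1) by (simp add: mult_ac)
      qed
      show "dir_diff e f"
        unfolding dir_diff_def field_differentiable_def using deriv by blast
      have "dir_deriv e f = (\<lambda>z. (c * s) * dir_deriv b' V (?L z))"
        unfolding dir_deriv_def[of e] by (rule ext) (rule DERIV_imp_deriv[OF deriv])
      then show "dir_deriv e f \<in> ?S"
        using smooth_along_dir_deriv[OF V s(2)]
        by (intro CollectI exI[of _ "c * s"] exI[of _ "dir_deriv b' V"] conjI)
    next
      show "(\<lambda>z. 1 * W (?L z)) \<in> ?S"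
        by (intro CollectI exI[of _ 1] exI[of _ W] conjI refl W)
    qed
    moreover have "depends_upto 2 (\<lambda>z. W (?L z))"
      by (simp add: depends_upto_def)
    moreover have "W (?L (z \<circ> \<pi>)) = W (?L z)" if "\<pi> permutes {1..2}" for \<pi> z
    proof -
      have "\<pi> 1 \<in> {1..2}" "\<pi> 2 \<in> {1..2}"
        using permutes_in_image[OF that] by simp_all
      moreover have "\<pi> 1 \<noteq> \<pi> 2"
        using injD[OF permutes_inj[OF that], of 1 2] by auto
      ultimately have "(\<pi> 1 = 1 \<and> \<pi> 2 = 2) \<or> (\<pi> 1 = 2 \<and> \<pi> 2 = 1)"
        unfolding atLeastAtMost_iff by linarith
      moreover have "W (fst (z 2) - fst (z 1)) = W (fst (z 1) - fst (z 2))"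
        using W(2)[of "fst (z 1) - fst (z 2)"] by simp
      ultimately show ?thesis by auto
    qed
    ultimately show ?thesis
      using 2 by (auto simp: W_VlH_seq_def g_space_def smooth_fns_def)
  next
    case 3
    then show ?thesis by (simp add: W_VlH_seq_def zero_in_g_space)
  qed
qed

text \<open>By the preceding lemma, this is well-defined for smooth even \<open>W\<close>.\<close>

definition W_VlH :: "((real^'d) \<Rightarrow> real) \<Rightarrow> 'd::finite G_inf" where
  "W_VlH W = Abs_G_inf (W_VlH_seq W)"

lemma component_W_VlH:
  assumes "smooth_along Basis W" "\<And>x. W (- x) = W x"
  shows "component (W_VlH W) = W_VlH_seq W"
proof -
  have "{k. W_VlH_seq W k \<noteq> (\<lambda>_. 0)} \<subseteq> {1, 2}"
    by (auto simp: W_VlH_seq_def)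
  then have "finite {k. W_VlH_seq W k \<noteq> (\<lambda>_. 0)}"
    by (rule finite_subset) simp
  then show ?thesis
    unfolding W_VlH_def
    by (intro Abs_G_inf_inverse CollectI conjI allI impI W_VlH_seq_in_g_space assms)
      (simp_all add: W_VlH_seq_def)
qed

definition H_VlH :: "((real^'d) \<Rightarrow> real) \<Rightarrow> 'd::finite G_dual \<Rightarrow> real" where
  "H_VlH W = pairing (W_VlH W)"

text \<open>
  Compactly supported distributions on \<open>(\<real>\<^sup>2\<^sup>d)\<^sup>k\<close>, as functionals on \<open>smooth_fns k\<close>.
\<close>

type_synonym 'd distr = "('d config \<Rightarrow> real) \<Rightarrow> real"

text \<open>The permutation-invariant distribution on \<open>(\<real>\<^sup>2\<^sup>d)\<^sup>k\<close> given by an element of the dual of \<open>\<gg>\<^sub>k\<close>.\<close>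

definition distr_of :: "'d::finite G_dual \<Rightarrow> nat \<Rightarrow> 'd distr" where
  "distr_of \<Gamma> k \<phi> = dual_component \<Gamma> k (Sym k \<phi>)"

definition distr_mult :: "('d::finite config \<Rightarrow> real) \<Rightarrow> 'd distr \<Rightarrow> 'd distr" where
  "distr_mult a \<mu> \<phi> = \<mu> (\<lambda>z. a z * \<phi> z)"

definition distr_dx :: "nat \<Rightarrow> (real^'d::finite) \<Rightarrow> 'd distr \<Rightarrow> 'd distr" where
  "distr_dx i b \<mu> \<phi> = - \<mu> (dx i b \<phi>)"

definition distr_dv :: "nat \<Rightarrow> (real^'d::finite) \<Rightarrow> 'd distr \<Rightarrow> 'd distr" where
  "distr_dv i b \<mu> \<phi> = - \<mu> (dv i b \<phi>)"

text \<open>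
  Integrating out \<open>z\<^bsub>k+1\<^esub>\<close>; the argument of \<open>\<mu>\<close> is \<open>\<phi> \<otimes> 1\<close>.
\<close>

definition distr_marginal :: "nat \<Rightarrow> 'd::finite distr \<Rightarrow> 'd distr" where
  "distr_marginal k \<mu> \<phi> = \<mu> (\<lambda>z. \<phi> (\<lambda>i. if i \<in> {1..k} then z i else 0))"

definition transport_term :: "'d::finite G_dual \<Rightarrow> nat \<Rightarrow> nat \<Rightarrow> 'd distr" where
  "transport_term \<Gamma> k i =
     (\<Sum>b\<in>Basis. distr_mult (\<lambda>z. snd (z i) \<bullet> b) (distr_dx i b (distr_of \<Gamma> k)))"

definition interaction_term ::
    "((real^'d) \<Rightarrow> real) \<Rightarrow> 'd::finite G_dual \<Rightarrow> nat \<Rightarrow> nat \<Rightarrow> 'd distr" where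
  "interaction_term W \<Gamma> k i = distr_marginal k
     (\<Sum>b\<in>Basis. distr_mult (\<lambda>z. dir_deriv b W (fst (z i) - fst (z (k + 1))))
        (distr_dv i b (distr_of \<Gamma> (k + 1))))"

text \<open>
  The equation is tested, at each time, against all (not only the symmetric) test functions
  \<open>\<phi>\<close> on \<open>(\<real>\<^sup>2\<^sup>d)\<^sup>k\<close>; since the distributions have compact support, \<open>\<phi>\<close> need not.
\<close>

definition vlasov_hierarchy ::
    "((real^'d) \<Rightarrow> real) \<Rightarrow> real set \<Rightarrow> (real \<Rightarrow> 'd::finite G_dual) \<Rightarrow> bool" where
  "vlasov_hierarchy W I \<Gamma> \<longleftrightarrow>
     (\<forall>k\<ge>1. \<forall>t\<in>I. \<forall>\<phi>\<in>smooth_fns k.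
        vector_derivative (\<lambda>s. distr_of (\<Gamma> s) k \<phi>) (at t within I)
          + (\<Sum>i=1..k. transport_term (\<Gamma> t) k i \<phi>)
        = 2 * (\<Sum>i=1..k. interaction_term W (\<Gamma> t) k i \<phi>))"

end

theory Submission
  imports Defs
begin

text \<open>
  For a linear functional \<open>\<H> = \<langle>H, \<cdot>\<rangle>\<close> the gradient is the constant \<open>H\<close>, so the equations
  defining its Hamiltonian vector field reduce to \<open>\<langle>F, X \<Gamma>\<rangle> = \<langle>[F, H], \<Gamma>\<rangle>\<close> for all
  \<open>F \<in> \<GG>\<^sub>\<infinity>\<close>.  They have a unique solution: \<open>X\<close> is the transpose of \<open>F \<mapsto> [F, H]\<close>, which is
  continuous in the seminorms of \<open>\<gg>\<^sub>k\<close> and therefore preserves bounded sets, so that \<open>X\<close> is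
  linear and strongly continuous, hence smooth.  For \<open>H = W\<^bsub>VlH\<^esub>\<close> and \<open>F = Sym \<phi>\<close> in
  degree \<open>k\<close> the bracket lives in degrees \<open>k\<close> and \<open>k + 1\<close>, and the symmetrization turns it
  into the transport and the interaction terms of the hierarchy tested against \<open>\<phi>\<close>.  Since
  the curve is differentiable in the strong sense, its derivative is determined by testing.
\<close>

section \<open>Continuous linear operators between the spaces of smooth functions\<close>

text \<open>Three obstacles shape the proof. The pieces of the bracket (a derivative in
  \<open>z 1\<close>, a multiplication, a substitution of arguments) destroy permutation invariance,
  so the estimates live on \<open>smooth_fns k\<close>, and a final \<open>Sym\<close> restores
  symmetry. Boundedness in \<open>\<gg>\<^sub>k\<close> means absorption by open sets, so seminorm
  estimates reach the strong topology only by way of continuous maps into \<open>g_top\<close>.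
  Finally, \<open>grad\<close>, \<open>hamiltonian_vf\<close>, \<open>deriv\<close> and
  \<open>vector_derivative\<close> are description or choice operators, which say something only
  where a unique value exists: point evaluations show that the pairing determines its first
  argument, elements of a single degree that it determines its second, and the assumed smoothness of
  the curve supplies the derivative in time. As for constants, \<open>wedge1 k j\<close> carries the
  factor \<open>k * j\<close>: the \<open>k\<close> becomes the sum over particles, and
  \<open>j = 2\<close> for the potential is the 2 of the hierarchy.\<close>

lemma finite_dirs: "finite (dirs k)"
  unfolding dirs_def by (rule finite_image_set2) simp_all

lemma smooth_fns_foldr:
  "f \<in> smooth_fns k \<Longrightarrow> es \<in> lists (dirs k) \<Longrightarrow> foldr dir_deriv es f \<in> smooth_fns k"
  by (induction es) (auto intro: smooth_fns_dir_deriv)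

lemma smooth_fns_dir_diff: "f \<in> smooth_fns k \<Longrightarrow> e \<in> dirs k \<Longrightarrow> dir_diff e f"
  by (auto simp: smooth_fns_def intro: smooth_along_dir_diff)

lemma smooth_fns_lincomb:
  "f \<in> smooth_fns k \<Longrightarrow> g \<in> smooth_fns k \<Longrightarrow> (\<lambda>z. c * f z + d * g z) \<in> smooth_fns k"
  by (intro smooth_fns_add smooth_fns_cmult)

lemma dir_deriv_cmult: "dir_diff e f \<Longrightarrow> dir_deriv e (\<lambda>z. c * f z) = (\<lambda>z. c * dir_deriv e f z)"
  using dir_deriv_mult[of e "\<lambda>_. c" f] by simp

lemma dir_deriv_lincomb:
  assumes "dir_diff e f" "dir_diff e g"
  shows "dir_deriv e (\<lambda>z. c * f z + d * g z) = (\<lambda>z. c * dir_deriv e f z + d * dir_deriv e g z)"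
  using assms dir_deriv_add[of e "\<lambda>z. c * f z" "\<lambda>z. d * g z"]
    dir_diff_mult[of e "\<lambda>_. c" f] dir_diff_mult[of e "\<lambda>_. d" g]
  by (simp add: dir_deriv_cmult)

lemma dir_diff_sum:
  "(\<And>i. i \<in> A \<Longrightarrow> dir_diff e (f i)) \<Longrightarrow> dir_diff e (\<lambda>z. \<Sum>i\<in>A. f i z)"
  by (induction A rule: infinite_finite_induct) (auto intro: dir_diff_add)

lemma dir_deriv_sum:
  assumes "\<And>i. i \<in> A \<Longrightarrow> dir_diff e (f i)"
  shows "dir_deriv e (\<lambda>z. \<Sum>i\<in>A. f i z) = (\<lambda>z. \<Sum>i\<in>A. dir_deriv e (f i) z)"
  using assms
  by (induction A rule: infinite_finite_induct) (auto simp: dir_deriv_add dir_diff_sum)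

lemma foldr_dir_deriv_lincomb:
  assumes "f \<in> smooth_fns k" "g \<in> smooth_fns k" "es \<in> lists (dirs k)"
  shows "foldr dir_deriv es (\<lambda>z. c * f z + d * g z) =
    (\<lambda>z. c * foldr dir_deriv es f z + d * foldr dir_deriv es g z)"
  using assms(3)
proof (induction es)
  case (Cons e es)
  have "dir_diff e (foldr dir_deriv es h)" if "h \<in> smooth_fns k" for h
    using Cons that by (intro smooth_fns_dir_diff[OF smooth_fns_foldr]) auto
  with Cons assms(1,2) show ?case by (simp add: dir_deriv_lincomb)
qed simp

text \<open>A \<open>Sup\<close> of reals bounds its set only if the set is bounded. It is: there
  are finitely many lists of at most \<open>n\<close> directions, and each iterated derivative is
  continuous on the compact set \<open>K\<close>.\<close>

lemma g_seminorm_upper: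
  assumes "f \<in> smooth_fns k" "compact K" "es \<in> lists (dirs k)" "length es \<le> n" "z \<in> K"
  shows "\<bar>foldr dir_deriv es f z\<bar> \<le> g_seminorm k K n f"
  unfolding g_seminorm_def
proof (rule cSup_upper)
  let ?L = "{es. set es \<subseteq> dirs k \<and> length es \<le> n}"
  have "bdd_above ((\<lambda>z. \<bar>foldr dir_deriv es f z\<bar>) ` K)" if "es \<in> ?L" for es
  proof -
    have "continuous_on UNIV (foldr dir_deriv es f)"
      using that assms(1) by (auto simp: smooth_fns_def smooth_along_def lists_eq_set)
    then have "continuous_on K (\<lambda>z. \<bar>foldr dir_deriv es f z\<bar>)"
      by (intro continuous_intros) (auto intro: continuous_on_subset)
    with assms(2) show ?thesis
      by (intro bounded_imp_bdd_above compact_imp_bounded compact_continuous_image)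
  qed
  then have "bdd_above (\<Union>es\<in>?L. (\<lambda>z. \<bar>foldr dir_deriv es f z\<bar>) ` K)"
    by (subst bdd_above_UN) (auto intro: finite_lists_length_le finite_dirs)
  then show "bdd_above {\<bar>foldr dir_deriv es f z\<bar> |es z.
      es \<in> lists (dirs k) \<and> length es \<le> n \<and> z \<in> K}"
    by (rule bdd_above_mono) (auto simp: lists_eq_set)
qed (use assms in blast)

lemma g_seminorm_least:
  assumes "K \<noteq> {}"
    and "\<And>es z. es \<in> lists (dirs k) \<Longrightarrow> length es \<le> n \<Longrightarrow> z \<in> K \<Longrightarrow> \<bar>foldr dir_deriv es f z\<bar> \<le> C"
  shows "g_seminorm k K n f \<le> C"
  unfolding g_seminorm_def
proof (rule cSup_least)
  from assms(1) obtain z where "z \<in> K" by blast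
  then have "\<bar>foldr dir_deriv [] f z\<bar> \<in> {\<bar>foldr dir_deriv es f z\<bar> |es z.
      es \<in> lists (dirs k) \<and> length es \<le> n \<and> z \<in> K}"
    by (intro CollectI exI[of _ "[]"] exI[of _ z]) simp
  then show "{\<bar>foldr dir_deriv es f z\<bar> |es z.
      es \<in> lists (dirs k) \<and> length es \<le> n \<and> z \<in> K} \<noteq> {}" by blast
qed (use assms(2) in blast)

lemma g_seminorm_nonneg:
  assumes "f \<in> smooth_fns k" "compact K" "K \<noteq> {}"
  shows "0 \<le> g_seminorm k K n f"
proof -
  from assms(3) obtain z where "z \<in> K" by blast
  with g_seminorm_upper[OF assms(1,2), of "[]" n z] show ?thesis by simp
qed

lemma g_seminorm_mono:
  assumes "f \<in> smooth_fns k" "compact K'" "K \<noteq> {}" "K \<subseteq> K'" "n \<le> n'"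
  shows "g_seminorm k K n f \<le> g_seminorm k K' n' f"
  using assms by (intro g_seminorm_least g_seminorm_upper) auto

lemma g_seminorm_lincomb:
  fixes f g :: "'d::finite config \<Rightarrow> real"
  assumes "f \<in> smooth_fns k" "g \<in> smooth_fns k" "compact K" "K \<noteq> {}"
  shows "g_seminorm k K n (\<lambda>z. c * f z + d * g z) \<le>
    \<bar>c\<bar> * g_seminorm k K n f + \<bar>d\<bar> * g_seminorm k K n g"
proof (rule g_seminorm_least)
  fix es :: "'d config list" and z
  assume es: "es \<in> lists (dirs k)" "length es \<le> n" and z: "z \<in> K"
  have "\<bar>foldr dir_deriv es (\<lambda>z. c * f z + d * g z) z\<bar> \<le>
      \<bar>c\<bar> * \<bar>foldr dir_deriv es f z\<bar> + \<bar>d\<bar> * \<bar>foldr dir_deriv es g z\<bar>"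
    using foldr_dir_deriv_lincomb[OF assms(1,2) es(1)] abs_triangle_ineq
    by (simp flip: abs_mult)
  also have "\<dots> \<le> \<bar>c\<bar> * g_seminorm k K n f + \<bar>d\<bar> * g_seminorm k K n g"
    using assms es z by (intro add_mono mult_left_mono g_seminorm_upper) auto
  finally show "\<bar>foldr dir_deriv es (\<lambda>z. c * f z + d * g z) z\<bar> \<le> \<dots>" .
qed fact

lemma g_seminorm_dir_deriv:
  fixes f :: "'d::finite config \<Rightarrow> real"
  assumes "f \<in> smooth_fns k" "e \<in> dirs k" "compact K" "K \<noteq> {}"
  shows "g_seminorm k K n (dir_deriv e f) \<le> g_seminorm k K (Suc n) f"
proof (rule g_seminorm_least)
  fix es :: "'d config list" and z
  assume "es \<in> lists (dirs k)" "length es \<le> n" "z \<in> K"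
  with assms show "\<bar>foldr dir_deriv es (dir_deriv e f) z\<bar> \<le> g_seminorm k K (Suc n) f"
    using g_seminorm_upper[of f k K "es @ [e]" "Suc n" z] by simp
qed fact

text \<open>The domain is \<open>smooth_fns k\<close> because the unsymmetrized pieces of the
  bracket have to compose. \<open>K'\<close> and \<open>n'\<close> may differ from \<open>K\<close>
  and \<open>n\<close>: a substitution moves the compact set, a derivative raises the order.\<close>

definition cont_op ::
    "nat \<Rightarrow> nat \<Rightarrow> (('d::finite config \<Rightarrow> real) \<Rightarrow> 'd config \<Rightarrow> real) \<Rightarrow> bool" where
  "cont_op k m T \<longleftrightarrow>
     (\<forall>f\<in>smooth_fns k. T f \<in> smooth_fns m) \<and>
     (\<forall>f\<in>smooth_fns k. \<forall>g\<in>smooth_fns k. \<forall>c d.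
        T (\<lambda>z. c * f z + d * g z) = (\<lambda>z. c * T f z + d * T g z)) \<and>
     (\<forall>K n. compact K \<and> K \<noteq> {} \<longrightarrow> (\<exists>K' n' C. compact K' \<and> K' \<noteq> {} \<and> C \<ge> 0 \<and>
        (\<forall>f\<in>smooth_fns k. g_seminorm m K n (T f) \<le> C * g_seminorm k K' n' f)))"

lemma cont_opI:
  assumes "\<And>f. f \<in> smooth_fns k \<Longrightarrow> T f \<in> smooth_fns m"
    and "\<And>f g c d. f \<in> smooth_fns k \<Longrightarrow> g \<in> smooth_fns k \<Longrightarrow>
      T (\<lambda>z. c * f z + d * g z) = (\<lambda>z. c * T f z + d * T g z)"
    and "\<And>K n. compact K \<Longrightarrow> K \<noteq> {} \<Longrightarrow> \<exists>K' n' C. compact K' \<and> K' \<noteq> {} \<and> C \<ge> 0 \<and>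
        (\<forall>f\<in>smooth_fns k. g_seminorm m K n (T f) \<le> C * g_seminorm k K' n' f)"
  shows "cont_op k m T"
  unfolding cont_op_def by (intro conjI ballI allI impI; (elim conjE)?; rule assms; assumption)

lemma cont_op_closed: "cont_op k m T \<Longrightarrow> f \<in> smooth_fns k \<Longrightarrow> T f \<in> smooth_fns m"
  by (simp add: cont_op_def)

lemma cont_op_lincomb:
  "cont_op k m T \<Longrightarrow> f \<in> smooth_fns k \<Longrightarrow> g \<in> smooth_fns k \<Longrightarrow>
     T (\<lambda>z. c * f z + d * g z) = (\<lambda>z. c * T f z + d * T g z)"
  by (simp add: cont_op_def)

lemma cont_op_bound:
  assumes "cont_op k m T" "compact K" "K \<noteq> {}"
  obtains K' n' C where "compact K'" "K' \<noteq> {}" "C \<ge> 0"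
    "\<And>f. f \<in> smooth_fns k \<Longrightarrow> g_seminorm m K n (T f) \<le> C * g_seminorm k K' n' f"
proof -
  have "\<exists>K' n' C. compact K' \<and> K' \<noteq> {} \<and> C \<ge> 0 \<and>
        (\<forall>f\<in>smooth_fns k. g_seminorm m K n (T f) \<le> C * g_seminorm k K' n' f)"
    using assms unfolding cont_op_def by simp
  then show ?thesis using that by blast
qed

section \<open>Compositions and linear combinations of continuous operators\<close>

lemma cont_op_compose:
  assumes "cont_op k m T" "cont_op m l S"
  shows "cont_op k l (\<lambda>f. S (T f))"
proof (rule cont_opI)
  fix f g :: "'a config \<Rightarrow> real" and c d :: real
  assume "f \<in> smooth_fns k" "g \<in> smooth_fns k"
  then show "S (T (\<lambda>z. c * f z + d * g z)) = (\<lambda>z. c * S (T f) z + d * S (T g) z)"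
    using assms by (simp add: cont_op_lincomb cont_op_closed)
next
  fix K :: "'a config set" and n assume "compact K" "K \<noteq> {}"
  with assms(2) obtain K1 n1 C1 where 1: "compact K1" "K1 \<noteq> {}" "C1 \<ge> 0"
    "\<And>f. f \<in> smooth_fns m \<Longrightarrow> g_seminorm l K n (S f) \<le> C1 * g_seminorm m K1 n1 f"
    by (rule cont_op_bound[where n = n]) blast
  from assms(1) 1(1,2) obtain K2 n2 C2 where 2: "compact K2" "K2 \<noteq> {}" "C2 \<ge> 0"
    "\<And>f. f \<in> smooth_fns k \<Longrightarrow> g_seminorm m K1 n1 (T f) \<le> C2 * g_seminorm k K2 n2 f"
    by (rule cont_op_bound[where n = n1]) blast
  have "g_seminorm l K n (S (T f)) \<le> (C1 * C2) * g_seminorm k K2 n2 f"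
    if f: "f \<in> smooth_fns k" for f
    using 1(4)[OF cont_op_closed[OF assms(1) f]] mult_left_mono[OF 2(4)[OF f] 1(3)]
    by (simp add: mult.assoc)
  with 1 2 show "\<exists>K' n' C. compact K' \<and> K' \<noteq> {} \<and> C \<ge> 0 \<and>
      (\<forall>f\<in>smooth_fns k. g_seminorm l K n (S (T f)) \<le> C * g_seminorm k K' n' f)"
    by (intro exI[of _ K2] exI[of _ n2] exI[of _ "C1 * C2"]) simp
qed (intro cont_op_closed[OF assms(2)] cont_op_closed[OF assms(1)])

lemma cont_op_pair:
  assumes "cont_op k m S" "cont_op k m T"
  shows "cont_op k m (\<lambda>f z. c * S f z + d * T f z)"
proof (rule cont_opI)
  fix f g :: "'a config \<Rightarrow> real" and c' d' :: real
  assume "f \<in> smooth_fns k" "g \<in> smooth_fns k"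
  then show "(\<lambda>z. c * S (\<lambda>z. c' * f z + d' * g z) z + d * T (\<lambda>z. c' * f z + d' * g z) z) =
      (\<lambda>z. c' * (c * S f z + d * T f z) + d' * (c * S g z + d * T g z))"
    using assms by (simp add: cont_op_lincomb algebra_simps)
next
  fix K :: "'a config set" and n assume K: "compact K" "K \<noteq> {}"
  with assms(1) obtain K1 n1 C1 where 1: "compact K1" "K1 \<noteq> {}" "C1 \<ge> 0"
    "\<And>f. f \<in> smooth_fns k \<Longrightarrow> g_seminorm m K n (S f) \<le> C1 * g_seminorm k K1 n1 f"
    by (rule cont_op_bound[where n = n]) blast
  from assms(2) K obtain K2 n2 C2 where 2: "compact K2" "K2 \<noteq> {}" "C2 \<ge> 0"
    "\<And>f. f \<in> smooth_fns k \<Longrightarrow> g_seminorm m K n (T f) \<le> C2 * g_seminorm k K2 n2 f"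
    by (rule cont_op_bound[where n = n]) blast
  \<comment> \<open>A common seminorm that dominates those of both estimates.\<close>
  let ?q = "g_seminorm k (K1 \<union> K2) (max n1 n2)"
  have "g_seminorm m K n (\<lambda>z. c * S f z + d * T f z) \<le> (\<bar>c\<bar> * C1 + \<bar>d\<bar> * C2) * ?q f"
    if f: "f \<in> smooth_fns k" for f
  proof -
    have "g_seminorm m K n (S f) \<le> C1 * ?q f"
      using 1(4)[OF f] mult_left_mono[OF g_seminorm_mono[OF f, of "K1 \<union> K2" K1 n1 "max n1 n2"] 1(3)]
        1 2 by (simp add: compact_Un)
    moreover have "g_seminorm m K n (T f) \<le> C2 * ?q f"
      using 2(4)[OF f] mult_left_mono[OF g_seminorm_mono[OF f, of "K1 \<union> K2" K2 n2 "max n1 n2"] 2(3)]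
        1 2 by (simp add: compact_Un)
    ultimately have "\<bar>c\<bar> * g_seminorm m K n (S f) + \<bar>d\<bar> * g_seminorm m K n (T f) \<le>
        \<bar>c\<bar> * (C1 * ?q f) + \<bar>d\<bar> * (C2 * ?q f)"
      by (intro add_mono mult_left_mono) simp_all
    with g_seminorm_lincomb[OF cont_op_closed[OF assms(1) f] cont_op_closed[OF assms(2) f] K,
        of n c d]
    show ?thesis by (simp add: algebra_simps)
  qed
  with 1 2 show "\<exists>K' n' C. compact K' \<and> K' \<noteq> {} \<and> C \<ge> 0 \<and>
      (\<forall>f\<in>smooth_fns k. g_seminorm m K n (\<lambda>z. c * S f z + d * T f z) \<le> C * g_seminorm k K' n' f)"
    by (intro exI[of _ "K1 \<union> K2"] exI[of _ "max n1 n2"] exI[of _ "\<bar>c\<bar> * C1 + \<bar>d\<bar> * C2"])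
      (simp add: compact_Un)
qed (intro smooth_fns_lincomb cont_op_closed[OF assms(1)] cont_op_closed[OF assms(2)])

lemma cont_op_zero: "cont_op k m (\<lambda>f z. 0)"
proof (rule cont_opI)
  fix K :: "'a config set" and n assume K: "compact K" "K \<noteq> {}"
  have "g_seminorm m K n (\<lambda>z. 0) \<le> 0"
    using g_seminorm_lincomb[OF smooth_fns_const smooth_fns_const K, of m n 0 _ 0] by simp
  with K show "\<exists>K' n' C. compact K' \<and> K' \<noteq> {} \<and> C \<ge> 0 \<and>
      (\<forall>f\<in>smooth_fns k. g_seminorm m K n (\<lambda>z. 0) \<le> C * g_seminorm k K' n' f)"
    by (intro exI[of _ K] exI[of _ n] exI[of _ 0]) simp
qed (simp_all add: smooth_fns_const)

lemma cont_op_add: "cont_op k m S \<Longrightarrow> cont_op k m T \<Longrightarrow> cont_op k m (\<lambda>f z. S f z + T f z)"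
  using cont_op_pair[of k m S T 1 1] by simp

lemma cont_op_diff: "cont_op k m S \<Longrightarrow> cont_op k m T \<Longrightarrow> cont_op k m (\<lambda>f z. S f z - T f z)"
  using cont_op_pair[of k m S T 1 "-1"] by simp

lemma cont_op_cmult: "cont_op k m S \<Longrightarrow> cont_op k m (\<lambda>f z. c * S f z)"
  using cont_op_pair[of k m S "\<lambda>f z. 0" c 0] by (simp add: cont_op_zero)

lemma cont_op_sum:
  "(\<And>i. i \<in> A \<Longrightarrow> cont_op k m (T i)) \<Longrightarrow> cont_op k m (\<lambda>f z. \<Sum>i\<in>A. T i f z)"
  by (induction A rule: infinite_finite_induct) (auto intro: cont_op_zero cont_op_add)

section \<open>Derivatives, multiplications and substitutions as continuous operators\<close>

lemma cont_op_dir_deriv: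
  assumes "e \<in> dirs k"
  shows "cont_op k k (dir_deriv e)"
proof (rule cont_opI)
  fix K :: "'a config set" and n assume K: "compact K" "K \<noteq> {}"
  with assms show "\<exists>K' n' C. compact K' \<and> K' \<noteq> {} \<and> C \<ge> 0 \<and>
      (\<forall>f\<in>smooth_fns k. g_seminorm k K n (dir_deriv e f) \<le> C * g_seminorm k K' n' f)"
    by (intro exI[of _ K] exI[of _ "Suc n"] exI[of _ 1]) (simp add: g_seminorm_dir_deriv)
qed (intro smooth_fns_dir_deriv dir_deriv_lincomb smooth_fns_dir_diff[where k = k] assms; assumption)+

text \<open>The Leibniz rule without binomial coefficients: one derivative turns
  \<open>a * f\<close> into \<open>a * f' + a' * f\<close>, and the induction hypothesis bounds the
  remaining derivatives of both products. Since \<open>a'\<close> takes the place of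
  \<open>a\<close>, the induction keeps \<open>a\<close> general.\<close>

lemma derivs_mult_bound:
  fixes a :: "'d::finite config \<Rightarrow> real"
  assumes K: "compact K" "K \<noteq> {}" and a: "a \<in> smooth_fns k"
  shows "\<exists>C\<ge>0. \<forall>f\<in>smooth_fns k. \<forall>es\<in>lists (dirs k). length es \<le> n \<longrightarrow>
    (\<forall>z\<in>K. \<bar>foldr dir_deriv es (\<lambda>z. a z * f z) z\<bar> \<le> C * g_seminorm k K n f)"
  using a
proof (induction n arbitrary: a)
  case 0
  let ?C = "g_seminorm k K 0 a"
  have "\<bar>a z * f z\<bar> \<le> ?C * g_seminorm k K 0 f" if "f \<in> smooth_fns k" "z \<in> K" for f z
    using g_seminorm_upper[OF 0 K(1), of "[]" 0 z] g_seminorm_upper[OF that(1) K(1), of "[]" 0 z]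
      that(2) by (simp add: abs_mult mult_mono')
  with g_seminorm_nonneg[OF 0 K] show ?case by (intro exI[of _ ?C]) auto
next
  case (Suc n)
  let ?B = "\<lambda>a C. \<forall>f\<in>smooth_fns k. \<forall>es\<in>lists (dirs k). length es \<le> n \<longrightarrow>
    (\<forall>z\<in>K. \<bar>foldr dir_deriv es (\<lambda>z. a z * f z) z\<bar> \<le> C * g_seminorm k K n f)"
  obtain C0 where C0: "C0 \<ge> 0" "?B a C0"
    using Suc.IH[OF Suc.prems] by (elim exE conjE)
  have "\<forall>e\<in>dirs k. \<exists>C\<ge>0. ?B (dir_deriv e a) C"
    using Suc.IH smooth_fns_dir_deriv[OF Suc.prems] by (intro ballI) simp
  from bchoice[OF this] obtain C'
    where "\<forall>e\<in>dirs k. C' e \<ge> 0 \<and> ?B (dir_deriv e a) (C' e)" ..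
  then have C': "C' e \<ge> 0 \<and> ?B (dir_deriv e a) (C' e)" if "e \<in> dirs k" for e
    using that by (rule bspec)
  \<comment> \<open>Summing over the finitely many directions makes the constant independent of the
    direction that is differentiated first.\<close>
  let ?C = "C0 + sum C' (dirs k)"
  have ge: "C' e \<le> sum C' (dirs k)" if "e \<in> dirs k" for e
    by (rule member_le_sum) (use that C' finite_dirs in auto)
  have S: "sum C' (dirs k) \<ge> 0" using C' by (intro sum_nonneg) simp
  with C0(1) have C: "?C \<ge> 0" by simp
  have "\<bar>foldr dir_deriv es (\<lambda>z. a z * f z) z\<bar> \<le> ?C * g_seminorm k K (Suc n) f"
    if f: "f \<in> smooth_fns k" and es: "es \<in> lists (dirs k)" "length es \<le> Suc n" and z: "z \<in> K"
    for f z and es :: "'d config list"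
  proof -
    have nn: "0 \<le> g_seminorm k K n f" by (rule g_seminorm_nonneg[OF f K])
    have mono: "g_seminorm k K n f \<le> g_seminorm k K (Suc n) f"
      by (rule g_seminorm_mono[OF f K(1,2)]) simp_all
    show ?thesis
    \<comment> \<open>\<open>foldr\<close> applies the last element first, so splitting the list at
      its end peels off the innermost derivative, the one that meets the product.\<close>
    proof (cases es rule: rev_cases)
      case Nil
      then have "\<bar>foldr dir_deriv es (\<lambda>z. a z * f z) z\<bar> \<le> C0 * g_seminorm k K n f"
        using bspec[OF bspec[OF C0(2) f], of "[]"] z by simp
      also have "\<dots> \<le> ?C * g_seminorm k K (Suc n) f"
        using C0(1) S C mono nn by (intro mult_mono) simp_all
      finally show ?thesis .
    next
      case (snoc es' e)
      with es have e: "e \<in> dirs k" "es' \<in> lists (dirs k)" "length es' \<le> n" by auto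
      let ?f' = "dir_deriv e f" and ?a' = "dir_deriv e a"
      have f': "?f' \<in> smooth_fns k" and a': "?a' \<in> smooth_fns k"
        using f Suc.prems e(1) by (auto intro: smooth_fns_dir_deriv)
      have "dir_deriv e (\<lambda>z. a z * f z) = (\<lambda>z. 1 * (a z * ?f' z) + 1 * (?a' z * f z))"
        using dir_deriv_mult[OF smooth_fns_dir_diff[OF Suc.prems e(1)]
          smooth_fns_dir_diff[OF f e(1)]] by simp
      then have "foldr dir_deriv es (\<lambda>z. a z * f z) =
          foldr dir_deriv es' (\<lambda>z. 1 * (a z * ?f' z) + 1 * (?a' z * f z))"
        unfolding snoc by simp
      also have "\<dots> = (\<lambda>z. 1 * foldr dir_deriv es' (\<lambda>z. a z * ?f' z) z
          + 1 * foldr dir_deriv es' (\<lambda>z. ?a' z * f z) z)"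
        by (rule foldr_dir_deriv_lincomb[where k = k]) (intro smooth_fns_mult Suc.prems f f' a' e(2))+
      finally have "\<bar>foldr dir_deriv es (\<lambda>z. a z * f z) z\<bar> \<le>
          \<bar>foldr dir_deriv es' (\<lambda>z. a z * ?f' z) z\<bar> + \<bar>foldr dir_deriv es' (\<lambda>z. ?a' z * f z) z\<bar>"
        by simp
      also have "\<dots> \<le> C0 * g_seminorm k K n ?f' + C' e * g_seminorm k K n f"
        using C0(2) C'[OF e(1)] f f' e(2,3) z by (intro add_mono) auto
      also have "\<dots> \<le> C0 * g_seminorm k K (Suc n) f + sum C' (dirs k) * g_seminorm k K (Suc n) f"
        using C0(1) C'[OF e(1)] ge[OF e(1)] mono nn g_seminorm_dir_deriv[OF f e(1) K]
          g_seminorm_nonneg[OF f' K]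
        by (intro add_mono mult_mono) auto
      finally show ?thesis by (simp add: algebra_simps)
    qed
  qed
  with C show ?case by (intro exI[of _ ?C]) simp
qed

lemma cont_op_mult:
  assumes "a \<in> smooth_fns k"
  shows "cont_op k k (\<lambda>f z. a z * f z)"
proof (rule cont_opI)
  fix K :: "'a config set" and n assume K: "compact K" "K \<noteq> {}"
  obtain C where C: "C \<ge> 0" "\<forall>f\<in>smooth_fns k. \<forall>es\<in>lists (dirs k). length es \<le> n \<longrightarrow>
    (\<forall>z\<in>K. \<bar>foldr dir_deriv es (\<lambda>z. a z * f z) z\<bar> \<le> C * g_seminorm k K n f)"
    using derivs_mult_bound[OF K assms] by blast
  then have "g_seminorm k K n (\<lambda>z. a z * f z) \<le> C * g_seminorm k K n f"
    if "f \<in> smooth_fns k" for f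
    using that by (intro g_seminorm_least K(2)) auto
  with K C show "\<exists>K' n' C. compact K' \<and> K' \<noteq> {} \<and> C \<ge> 0 \<and>
      (\<forall>f\<in>smooth_fns k. g_seminorm k K n (\<lambda>z. a z * f z) \<le> C * g_seminorm k K' n' f)"
    by blast
qed (simp_all add: smooth_fns_mult assms algebra_simps)

text \<open>A direction moves a single entry of \<open>z\<close>. As \<open>\<sigma>\<close> is
  injective, at most one argument of \<open>f\<close> reads that entry, so the chain rule has one
  term or none.\<close>

lemma dir_deriv_reindex:
  fixes f :: "'d::finite config \<Rightarrow> real"
  assumes f: "f \<in> smooth_fns j" and \<sigma>: "inj_on \<sigma> {1..j}" and e: "e \<in> dirs k"
  shows "dir_deriv e (\<lambda>z. f (z \<circ> \<sigma>)) = (\<lambda>_. 0) \<or>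
    (\<exists>e'\<in>dirs j. dir_deriv e (\<lambda>z. f (z \<circ> \<sigma>)) = (\<lambda>z. dir_deriv e' f (z \<circ> \<sigma>)))"
proof -
  obtain i b where e: "e = dir i b" "b \<in> Basis" using e by (auto simp: dirs_def)
  from f have "depends_upto j f" by (simp add: smooth_fns_def)
  then show ?thesis
    using \<sigma>
  proof (cases rule: reindex_dir[where i = i and b = b])
    case (hit p)
    then have "dir_deriv e (\<lambda>z. f (z \<circ> \<sigma>)) = (\<lambda>z. dir_deriv (dir p b) f (z \<circ> \<sigma>))"
      by (simp add: dir_deriv_def e fun_eq_iff)
    moreover have "dir p b \<in> dirs j" using hit e by (intro dirs_I) auto
    ultimately show ?thesis by blast
  next
    case miss
    then show ?thesis by (simp add: dir_deriv_def e fun_eq_iff)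
  qed
qed

lemma foldr_dir_deriv_zero: "foldr dir_deriv es (\<lambda>_. 0) = (\<lambda>_. 0)"
  by (induction es) simp_all

lemma foldr_dir_deriv_reindex:
  fixes f :: "'d::finite config \<Rightarrow> real"
  assumes f: "f \<in> smooth_fns j" and \<sigma>: "inj_on \<sigma> {1..j}" and es: "es \<in> lists (dirs k)"
  shows "foldr dir_deriv es (\<lambda>z. f (z \<circ> \<sigma>)) = (\<lambda>_. 0) \<or>
    (\<exists>es'\<in>lists (dirs j). length es' = length es \<and>
      foldr dir_deriv es (\<lambda>z. f (z \<circ> \<sigma>)) = (\<lambda>z. foldr dir_deriv es' f (z \<circ> \<sigma>)))"
  using es f
\<comment> \<open>The innermost derivative replaces \<open>f\<close> by one of its derivatives or by
  \<open>0\<close>, hence the induction from the end of the list with \<open>f\<close>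
  general.\<close>
proof (induction es arbitrary: f rule: rev_induct)
  case (snoc e es)
  have foldr_snoc: "foldr dir_deriv (es @ [e]) h = foldr dir_deriv es (dir_deriv e h)"
    for es e and h :: "'d config \<Rightarrow> real" by simp
  from snoc.prems have "e \<in> dirs k" and es: "es \<in> lists (dirs k)" by auto
  then consider "dir_deriv e (\<lambda>z. f (z \<circ> \<sigma>)) = (\<lambda>_. 0)"
    | e' where "e' \<in> dirs j" "dir_deriv e (\<lambda>z. f (z \<circ> \<sigma>)) = (\<lambda>z. dir_deriv e' f (z \<circ> \<sigma>))"
    using dir_deriv_reindex[OF snoc.prems(2) \<sigma>] by blast
  then show ?case
  proof cases
    case 1
    then show ?thesis unfolding foldr_snoc by (simp only: foldr_dir_deriv_zero simp_thms)
  next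
    case 2
    have eq: "foldr dir_deriv (es @ [e]) (\<lambda>z. f (z \<circ> \<sigma>)) =
        foldr dir_deriv es (\<lambda>z. dir_deriv e' f (z \<circ> \<sigma>))"
      unfolding foldr_snoc 2(2) ..
    from snoc.IH[OF es smooth_fns_dir_deriv[OF snoc.prems(2) 2(1)]] show ?thesis
    proof (elim disjE bexE conjE)
      fix es' assume "es' \<in> lists (dirs j)" "length es' = length es"
        and "foldr dir_deriv es (\<lambda>z. dir_deriv e' f (z \<circ> \<sigma>)) =
          (\<lambda>z. foldr dir_deriv es' (dir_deriv e' f) (z \<circ> \<sigma>))"
      then show ?thesis
        unfolding eq using 2(1)
        by (intro disjI2 bexI[of _ "es' @ [e']"]) (auto simp: foldr_snoc comp_def)
    next
      assume "foldr dir_deriv es (\<lambda>z. dir_deriv e' f (z \<circ> \<sigma>)) = (\<lambda>_. 0)"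
      then show ?thesis unfolding eq by (rule disjI1)
    qed
  qed
qed (auto intro: bexI[of _ "[]"])

text \<open>Substitution costs no derivatives and has constant 1; only the compact set changes, to
  its image under the continuous map \<open>z \<mapsto> z \<circ> \<sigma>\<close>.\<close>

lemma cont_op_reindex:
  assumes \<sigma>: "inj_on \<sigma> {1..j}" "\<sigma> ` {1..j} \<subseteq> {1..k}"
  shows "cont_op j k (\<lambda>f z. f (z \<circ> \<sigma>))"
proof (rule cont_opI)
  fix K :: "'a config set" and n assume K: "compact K" "K \<noteq> {}"
  let ?K = "(\<lambda>z. z \<circ> \<sigma>) ` K"
  have "continuous_on UNIV (\<lambda>z :: 'a config. z \<circ> \<sigma>)"
    unfolding comp_def
    by (intro continuous_on_coordinatewise_then_product continuous_on_product_coordinates)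
  then have K': "compact ?K" "?K \<noteq> {}"
    using K by (auto intro!: compact_continuous_image intro: continuous_on_subset)
  have "g_seminorm k K n (\<lambda>z. f (z \<circ> \<sigma>)) \<le> 1 * g_seminorm j ?K n f"
    if f: "f \<in> smooth_fns j" for f :: "'a config \<Rightarrow> real"
  proof (rule g_seminorm_least)
    fix es :: "'a config list" and z
    assume es: "es \<in> lists (dirs k)" "length es \<le> n" and z: "z \<in> K"
    from foldr_dir_deriv_reindex[OF f \<sigma>(1) es(1)]
    show "\<bar>foldr dir_deriv es (\<lambda>z. f (z \<circ> \<sigma>)) z\<bar> \<le> 1 * g_seminorm j ?K n f"
    proof (elim disjE bexE conjE)
      fix es' assume "es' \<in> lists (dirs j)" "length es' = length es"
        "foldr dir_deriv es (\<lambda>z. f (z \<circ> \<sigma>)) = (\<lambda>z. foldr dir_deriv es' f (z \<circ> \<sigma>))"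
      with es z f K' show ?thesis by (simp add: g_seminorm_upper)
    qed (use g_seminorm_nonneg[OF f K'] in simp)
  qed fact
  with K' show "\<exists>K' n' C. compact K' \<and> K' \<noteq> {} \<and> C \<ge> 0 \<and>
      (\<forall>f\<in>smooth_fns j. g_seminorm k K n (\<lambda>z. f (z \<circ> \<sigma>)) \<le> C * g_seminorm j K' n' f)"
    by (intro exI[of _ ?K] exI[of _ n] exI[of _ 1]) simp
qed (simp_all add: smooth_fns_reindex[OF _ assms])

text \<open>Substituting along \<open>id\<close> reads a function of \<open>j\<close> entries as one
  of \<open>m\<close> entries; its derivatives in the added directions vanish.\<close>

lemma cont_op_mono: "cont_op k j T \<Longrightarrow> j \<le> m \<Longrightarrow> cont_op k m T"
  using cont_op_compose[of k j T m "\<lambda>f z. f (z \<circ> id)"] cont_op_reindex[of id j m] by simp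

lemma cont_op_Sym: "cont_op k k (Sym k)"
proof -
  have "cont_op k k (\<lambda>(f :: 'a config \<Rightarrow> real) z. f (z \<circ> \<pi>))" if "\<pi> permutes {1..k}" for \<pi>
    by (rule cont_op_reindex)
      (simp_all only: permutes_inj_on[OF that] permutes_image[OF that] order_refl)
  then have "cont_op k k (\<lambda>(h :: 'a config \<Rightarrow> real) z.
      (1 / fact k) * (\<Sum>\<pi> | \<pi> permutes {1..k}. h (z \<circ> \<pi>)))"
    by (intro cont_op_cmult cont_op_sum) auto
  moreover have "Sym k = (\<lambda>(h :: 'a config \<Rightarrow> real) z.
      (1 / fact k) * (\<Sum>\<pi> | \<pi> permutes {1..k}. h (z \<circ> \<pi>)))"
    by (simp add: Sym_def fun_eq_iff)
  ultimately show ?thesis by simp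
qed

lemma reindex_skip:
  assumes "l \<ge> 1" "j \<ge> 1" "l + j - 1 = k"
  shows "inj_on (skip l) {1..j}" "skip l ` {1..j} \<subseteq> {1..k}"
proof -
  show "inj_on (skip l) {1..j}"
  proof (rule inj_onI)
    fix p q assume "p \<in> {1..j}" "q \<in> {1..j}" "skip l p = skip l q"
    then show "p = q" using assms(1) unfolding skip_def atLeastAtMost_iff by presburger
  qed
  show "skip l ` {1..j} \<subseteq> {1..k}"
  proof (rule image_subsetI)
    fix p assume "p \<in> {1..j}"
    then show "skip l p \<in> {1..k}"
      using assms by (auto simp: skip_def)
  qed
qed

text \<open>With \<open>g\<close> fixed, each summand is a derivative of \<open>f\<close>, possibly
  followed by a substitution, times a smooth coefficient made from \<open>g\<close>.\<close>

lemma cont_op_wedge1: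
  fixes g :: "'d::finite config \<Rightarrow> real"
  assumes g: "g \<in> smooth_fns j" and lj: "l \<ge> 1" "j \<ge> 1" "l + j - 1 = k"
  shows "cont_op l k (\<lambda>f. wedge1 l j f g)"
proof -
  have le: "l \<le> k" "j \<le> k" using lj by auto
  have b: "dir 1 (b, 0) \<in> dirs m" "dir 1 (0, b) \<in> dirs m"
    if "b \<in> Basis" "m \<ge> 1" for m and b :: "real^'d"
    using that by (auto intro!: dirs_I simp: Basis_prod_def)
  have 1: "cont_op l k (\<lambda>f z. dv 1 b g (z \<circ> skip l) * dx 1 b f z)" if "b \<in> Basis" for b
  proof (rule cont_op_compose[OF _ cont_op_mult])
    show "cont_op l k (dx 1 b)"
      unfolding dx_def by (rule cont_op_mono[OF cont_op_dir_deriv le(1)]) (rule b(1)[OF that lj(1)])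
    show "(\<lambda>z. dv 1 b g (z \<circ> skip l)) \<in> smooth_fns k"
      using smooth_fns_reindex[OF smooth_fns_dv[OF g that order_refl lj(2)] reindex_skip[OF lj]] .
  qed
  have 2: "cont_op l k (\<lambda>f z. dx 1 b g z * dv 1 b f (z \<circ> skip j))" if "b \<in> Basis" for b
  proof (rule cont_op_compose[OF _ cont_op_mult])
    have "cont_op l l (dv 1 b :: ('d config \<Rightarrow> real) \<Rightarrow> _)"
      unfolding dv_def by (rule cont_op_dir_deriv) (rule b(2)[OF that lj(1)])
    then show "cont_op l k (\<lambda>f z. dv 1 b f (z \<circ> skip j))"
      by (rule cont_op_compose[OF _ cont_op_reindex[OF reindex_skip]]) (use lj in simp_all)
    show "dx 1 b g \<in> smooth_fns k"
      by (rule smooth_fns_mono[OF smooth_fns_dx[OF g that order_refl lj(2)] le(2)])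
  qed
  have "cont_op l k (\<lambda>f z. real l * real j *
     ((\<Sum>b\<in>Basis. dv 1 b g (z \<circ> skip l) * dx 1 b f z) -
      (\<Sum>b\<in>Basis. dx 1 b g z * dv 1 b f (z \<circ> skip j))))"
    by (intro cont_op_cmult cont_op_diff cont_op_sum 1 2)
  moreover have "(\<lambda>f. wedge1 l j f g) = (\<lambda>f z. real l * real j *
     ((\<Sum>b\<in>Basis. dv 1 b g (z \<circ> skip l) * dx 1 b f z) -
      (\<Sum>b\<in>Basis. dx 1 b g z * dv 1 b f (z \<circ> skip j))))"
    by (simp add: wedge1_def fun_eq_iff mult.commute)
  ultimately show ?thesis by (simp only:)
qed

section \<open>The topologies of \<open>\<gg>\<^sub>k\<close> and its strong dual\<close>

lemma g_space_smooth: "f \<in> g_space k \<Longrightarrow> f \<in> smooth_fns k"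
  by (simp add: g_space_def)

lemma g_space_lincomb:
  "f \<in> g_space k \<Longrightarrow> g \<in> g_space k \<Longrightarrow> (\<lambda>z. c * f z + d * g z) \<in> g_space k"
  by (simp add: g_space_def smooth_fns_lincomb)

lemma g_space_scaleR: "f \<in> g_space k \<Longrightarrow> c *\<^sub>R f \<in> g_space k"
  using g_space_lincomb[of f k f c 0] by (simp add: scaleR_fun_def)

lemma fun_diff_lincomb: "f - g = (\<lambda>z. 1 * f z + (- 1) * g z)" for f g :: "'a \<Rightarrow> real"
  by (simp add: fun_eq_iff)

lemma g_space_diff: "f \<in> g_space k \<Longrightarrow> g \<in> g_space k \<Longrightarrow> f - g \<in> g_space k"
  unfolding fun_diff_lincomb by (rule g_space_lincomb)

lemma g_seminorm_scale:
  assumes "f \<in> g_space k" "compact K" "K \<noteq> {}"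
  shows "g_seminorm k K n (\<lambda>z. c * f z) \<le> \<bar>c\<bar> * g_seminorm k K n f"
  using g_seminorm_lincomb[OF assms(1,1)[THEN g_space_smooth] assms(2,3), of n c 0] by simp

lemma g_seminorm_diff_triangle:
  assumes "f \<in> g_space k" "g \<in> g_space k" "h \<in> g_space k" "compact K" "K \<noteq> {}"
  shows "g_seminorm k K n (f - h) \<le> g_seminorm k K n (f - g) + g_seminorm k K n (g - h)"
proof -
  have "f - h = (\<lambda>z. 1 * (f - g) z + 1 * (g - h) z)" by (simp add: fun_eq_iff)
  with g_seminorm_lincomb[of "f - g" k "g - h" K n 1 1] assms show ?thesis
    by (simp add: g_space_diff g_space_smooth)
qed

lemma g_seminorm_zero:
  assumes "compact K" "K \<noteq> {}"
  shows "g_seminorm k K n 0 = 0"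
  using g_seminorm_scale[OF zero_in_g_space assms, of k n 0]
    g_seminorm_nonneg[OF g_space_smooth[OF zero_in_g_space] assms, of k n]
  by (simp add: zero_fun_def)

section \<open>Open sets and continuous maps in the seminorm topology\<close>

lemma openin_g_ball:
  assumes "f \<in> g_space k" "compact K" "K \<noteq> {}" "\<epsilon> > 0"
  shows "openin (g_top k) {g \<in> g_space k. g_seminorm k K n (g - f) < \<epsilon>}"
  unfolding g_top_def using assms by (intro topology_generated_by_Basis) blast

lemma topspace_g_top:
  "topspace (g_top k) = (g_space k :: ('d::finite config \<Rightarrow> real) set)"
proof
  show "topspace (g_top k) \<subseteq> (g_space k :: ('d config \<Rightarrow> real) set)"
    unfolding g_top_def topology_generated_by_topspace by blast
  show "(g_space k :: ('d config \<Rightarrow> real) set) \<subseteq> topspace (g_top k)"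
  proof
    fix f :: "'d config \<Rightarrow> real" assume f: "f \<in> g_space k"
    let ?U = "{g \<in> g_space k. g_seminorm k {0} 0 (g - f) < 1}"
    have "openin (g_top k) ?U" using f by (intro openin_g_ball) simp_all
    then have "?U \<subseteq> topspace (g_top k)" by (rule openin_subset)
    moreover have "f \<in> ?U" using f by (simp add: g_seminorm_zero)
    ultimately show "f \<in> topspace (g_top k)" by (rule subsetD)
  qed
qed

lemma openin_g_topI:
  assumes "V \<subseteq> g_space k"
    and "\<And>f. f \<in> V \<Longrightarrow> \<exists>K n \<epsilon>. compact K \<and> K \<noteq> {} \<and> \<epsilon> > 0 \<and>
      {g \<in> g_space k. g_seminorm k K n (g - f) < \<epsilon>} \<subseteq> V"
  shows "openin (g_top k) V"
proof (subst openin_subopen, rule ballI)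
  fix f assume f: "f \<in> V"
  from assms(2)[OF this] obtain K n \<epsilon> where K: "compact K" "K \<noteq> {}" "\<epsilon> > 0"
    "{g \<in> g_space k. g_seminorm k K n (g - f) < \<epsilon>} \<subseteq> V" by (elim exE conjE)
  moreover have "f \<in> g_space k" using f assms(1) by (rule rev_subsetD)
  ultimately show "\<exists>T. openin (g_top k) T \<and> f \<in> T \<and> T \<subseteq> V"
    by (intro exI[of _ "{g \<in> g_space k. g_seminorm k K n (g - f) < \<epsilon>}"] conjI openin_g_ball)
      (simp_all add: g_seminorm_zero)
qed

lemma continuous_map_into_g_top:
  assumes "\<And>x. x \<in> topspace X \<Longrightarrow> \<phi> x \<in> g_space k"
    and "\<And>h K n \<epsilon>. h \<in> g_space k \<Longrightarrow> compact K \<Longrightarrow> K \<noteq> {} \<Longrightarrow> \<epsilon> > 0 \<Longrightarrow>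
      openin X {x \<in> topspace X. g_seminorm k K n (\<phi> x - h) < \<epsilon>}"
  shows "continuous_map X (g_top k) \<phi>"
  unfolding g_top_def
proof (rule continuous_on_generated_topo, goal_cases)
  case (1 U)
  then obtain h K n \<epsilon> where U: "h \<in> g_space k" "compact K" "K \<noteq> {}" "\<epsilon> > 0"
    "U = {g \<in> g_space k. g_seminorm k K n (g - h) < \<epsilon>}" by (elim CollectE exE conjE)
  have "\<phi> -` U \<inter> topspace X = {x \<in> topspace X. g_seminorm k K n (\<phi> x - h) < \<epsilon>}"
    unfolding U(5) using assms(1) by (intro equalityI subsetI) simp_all
  with assms(2)[OF U(1-4)] show ?case by simp
next
  case 2
  have "\<phi> ` topspace X \<subseteq> topspace (g_top k)"
    unfolding topspace_g_top using assms(1) by (rule image_subsetI)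
  then show ?case unfolding g_top_def topology_generated_by_topspace .
qed

lemma continuous_map_cont_op:
  assumes T: "cont_op k m T" and g: "\<And>f. f \<in> g_space k \<Longrightarrow> T f \<in> g_space m"
  shows "continuous_map (g_top k) (g_top m) T"
proof (rule continuous_map_into_g_top)
  fix h :: "'a config \<Rightarrow> real" and K :: "'a config set" and n and \<epsilon> :: real
  assume h: "h \<in> g_space m" and K: "compact K" "K \<noteq> {}" and "\<epsilon> > 0"
  obtain K' n' C where b: "compact K'" "K' \<noteq> {}" "C \<ge> 0"
    "\<And>f. f \<in> smooth_fns k \<Longrightarrow> g_seminorm m K n (T f) \<le> C * g_seminorm k K' n' f"
    by (rule cont_op_bound[OF T K, of n]) blast
  show "openin (g_top k) {f \<in> topspace (g_top k). g_seminorm m K n (T f - h) < \<epsilon>}"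
    unfolding topspace_g_top
  proof (rule openin_g_topI)
    fix f assume f: "f \<in> {f \<in> g_space k. g_seminorm m K n (T f - h) < \<epsilon>}"
    \<comment> \<open>\<open>C + 1\<close> instead of \<open>C\<close> excludes division by zero and
      makes \<open>C * ?\<delta>\<close> strictly smaller than the gap.\<close>
    let ?\<delta> = "(\<epsilon> - g_seminorm m K n (T f - h)) / (C + 1)"
    have in_ball: "g_seminorm m K n (T f' - h) < \<epsilon>"
      if f': "f' \<in> g_space k" "g_seminorm k K' n' (f' - f) < ?\<delta>" for f'
    proof -
      have "T (f' - f) = T f' - T f"
        using f f' cont_op_lincomb[OF T, of f' f 1 "-1"]
        by (simp add: fun_diff_lincomb g_space_smooth)
      then have "g_seminorm m K n (T f' - T f) \<le> C * g_seminorm k K' n' (f' - f)"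
        using b(4)[of "f' - f"] f f' by (simp add: g_space_diff g_space_smooth)
      also have "\<dots> \<le> C * ?\<delta>" using f'(2) b(3) by (intro mult_left_mono) simp_all
      also have "\<dots> < \<epsilon> - g_seminorm m K n (T f - h)"
        using f b(3) by (simp add: field_simps)
      finally show ?thesis
        using g_seminorm_diff_triangle[OF g[OF f'(1)] g h K, of f n] f by simp
    qed
    show "\<exists>K' n' \<delta>. compact K' \<and> K' \<noteq> {} \<and> \<delta> > 0 \<and> {g \<in> g_space k. g_seminorm k K' n' (g - f) < \<delta>} \<subseteq>
        {f \<in> g_space k. g_seminorm m K n (T f - h) < \<epsilon>}"
      using b(1-3) f in_ball
      by (intro exI[of _ K'] exI[of _ n'] exI[of _ ?\<delta>] conjI subsetI) simp_all
  qed simp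
qed (simp add: topspace_g_top g)

text \<open>Used for absorption: \<open>c *\<^sub>R f\<close> lies in a given neighbourhood of
  \<open>0\<close> once \<open>c\<close> is small.\<close>

lemma continuous_map_scaleR_g_top:
  assumes f: "f \<in> g_space k"
  shows "continuous_map euclideanreal (g_top k) (\<lambda>c. c *\<^sub>R f)"
proof (rule continuous_map_into_g_top)
  fix h :: "'a config \<Rightarrow> real" and K :: "'a config set" and n and \<epsilon> :: real
  assume h: "h \<in> g_space k" and K: "compact K" "K \<noteq> {}"
  \<comment> \<open>The \<open>+ 1\<close> keeps the divisor positive when the seminorm of
    \<open>f\<close> vanishes.\<close>
  let ?q = "g_seminorm k K n" and ?M = "g_seminorm k K n f + 1"
  have M: "?M > 0" using g_seminorm_nonneg[OF g_space_smooth[OF f] K, of n] by simp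
  have "open {c. ?q (c *\<^sub>R f - h) < \<epsilon>}"
    unfolding open_dist
  proof (rule ballI, intro exI conjI allI impI)
    fix c assume c: "c \<in> {c. ?q (c *\<^sub>R f - h) < \<epsilon>}"
    with M show "0 < (\<epsilon> - ?q (c *\<^sub>R f - h)) / ?M" by simp
    fix c' assume c': "dist c' c < (\<epsilon> - ?q (c *\<^sub>R f - h)) / ?M"
    have "?q (c' *\<^sub>R f - c *\<^sub>R f) \<le> \<bar>c' - c\<bar> * ?q f"
      using g_seminorm_scale[OF f K, of n "c' - c"]
      by (simp add: fun_diff_def scaleR_fun_def left_diff_distrib)
    also have "\<dots> \<le> \<bar>c' - c\<bar> * ?M" by (intro mult_left_mono) simp_all
    also have "\<dots> < \<epsilon> - ?q (c *\<^sub>R f - h)" using c' M by (simp add: dist_real_def field_simps)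
    finally show "c' \<in> {c. ?q (c *\<^sub>R f - h) < \<epsilon>}"
      using g_seminorm_diff_triangle[OF g_space_scaleR[OF f] g_space_scaleR[OF f] h K, of n c' c]
      by simp
  qed
  then show "openin euclideanreal {c \<in> topspace euclideanreal. ?q (c *\<^sub>R f - h) < \<epsilon>}" by simp
qed (simp add: g_space_scaleR f)

text \<open>Makes evaluation at a single \<open>f\<close> one of the seminorms of the strong
  topology, which therefore refines pointwise convergence.\<close>

lemma g_bounded_singleton:
  assumes f: "f \<in> g_space k"
  shows "g_bounded k {f}"
  unfolding g_bounded_def
proof (intro conjI allI impI)
  fix U :: "('a config \<Rightarrow> real) set" assume U: "openin (g_top k) U \<and> 0 \<in> U"
  have "open {c. c *\<^sub>R f \<in> U}"
    using openin_continuous_map_preimage[OF continuous_map_scaleR_g_top[OF f], of U] U by simp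
  moreover have "0 \<in> {c. c *\<^sub>R f \<in> U}" using U by (simp add: scaleR_fun_def zero_fun_def)
  ultimately obtain e where e: "e > 0" "ball 0 e \<subseteq> {c. c *\<^sub>R f \<in> U}"
    by (rule openE)
  \<comment> \<open>Any nonzero scalar in the ball would do; its inverse is the absorbing
    factor.\<close>
  have "e / 2 \<in> ball 0 e" using e(1) by simp
  with e(2) have "(e / 2) *\<^sub>R f \<in> U" by blast
  then have "(2 / e) *\<^sub>R ((e / 2) *\<^sub>R f) \<in> (\<lambda>f. (2 / e) *\<^sub>R f) ` U" by (rule imageI)
  moreover have "(2 / e) *\<^sub>R ((e / 2) *\<^sub>R f) = f" using e(1) by (simp add: fun_eq_iff)
  ultimately have "f \<in> (\<lambda>f. (2 / e) *\<^sub>R f) ` U" by (simp only:)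
  then show "\<exists>r>0. {f} \<subseteq> (\<lambda>f. r *\<^sub>R f) ` U" using e(1) by (intro exI[of _ "2 / e"]) simp
qed (simp add: f)

text \<open>The preimage of a neighbourhood of \<open>0\<close> under \<open>T\<close> is a
  neighbourhood of \<open>0\<close> and absorbs \<open>B\<close>; by linearity the same factor
  \<open>r\<close> serves the image.\<close>

lemma g_bounded_image:
  assumes T: "cont_op k m T" and g: "\<And>f. f \<in> g_space k \<Longrightarrow> T f \<in> g_space m"
    and B: "g_bounded k B"
  shows "g_bounded m (T ` B)"
  unfolding g_bounded_def
proof (intro conjI allI impI)
  show "T ` B \<subseteq> g_space m" using B g unfolding g_bounded_def by (intro image_subsetI) blast
  fix U :: "('a config \<Rightarrow> real) set" assume U: "openin (g_top m) U \<and> 0 \<in> U"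
  let ?V = "{f \<in> g_space k. T f \<in> U}"
  have "openin (g_top k) ?V"
    using openin_continuous_map_preimage[OF continuous_map_cont_op[OF T g], of U] U
    by (simp add: topspace_g_top)
  moreover have "0 \<in> ?V"
    using cont_op_lincomb[OF T smooth_fns_const smooth_fns_const, of 0 0 0 0] U zero_in_g_space[of k]
    by (simp add: zero_fun_def)
  ultimately obtain r where r: "r > 0" "B \<subseteq> (\<lambda>f. r *\<^sub>R f) ` ?V"
    using B unfolding g_bounded_def by meson
  have "T f \<in> (\<lambda>f. r *\<^sub>R f) ` U" if "f \<in> B" for f
  proof -
    from that r(2) obtain f' where f': "f = r *\<^sub>R f'" "f' \<in> g_space k" "T f' \<in> U" by blast
    have "T f = r *\<^sub>R T f'"
      using cont_op_lincomb[OF T g_space_smooth g_space_smooth, OF f'(2) f'(2), of r 0]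
      unfolding f'(1) by (simp add: scaleR_fun_def)
    then show ?thesis using f'(3) by (rule image_eqI)
  qed
  with r(1) show "\<exists>r>0. T ` B \<subseteq> (\<lambda>f. r *\<^sub>R f) ` U" by (intro exI[of _ r] conjI image_subsetI)
qed

section \<open>Functionals and the strong topology\<close>

lemma g_dual_lincomb:
  assumes "\<gamma> \<in> g_dual k" "f \<in> g_space k" "g \<in> g_space k"
  shows "\<gamma> (\<lambda>z. c * f z + d * g z) = c * \<gamma> f + d * \<gamma> g"
proof -
  have "(\<lambda>z. c * f z + d * g z) = c *\<^sub>R f + d *\<^sub>R g" by (simp add: fun_eq_iff)
  with assms g_space_scaleR[OF assms(2), of c] g_space_scaleR[OF assms(3), of d] show ?thesis
    by (simp add: g_dual_def)
qed

lemma g_dualI: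
  assumes lin: "\<And>f g c d. f \<in> g_space k \<Longrightarrow> g \<in> g_space k \<Longrightarrow>
      \<gamma> (\<lambda>z. c * f z + d * g z) = c * \<gamma> f + d * \<gamma> g"
    and cont: "continuous_map (g_top k) euclideanreal \<gamma>"
    and out: "\<And>f. f \<notin> g_space k \<Longrightarrow> \<gamma> f = 0"
  shows "\<gamma> \<in> g_dual k"
proof -
  have "\<gamma> (f + g) = \<gamma> f + \<gamma> g" if "f \<in> g_space k" "g \<in> g_space k" for f g
    using lin[OF that, of 1 1] by (simp add: plus_fun_def)
  moreover have "\<gamma> (c *\<^sub>R f) = c * \<gamma> f" if "f \<in> g_space k" for f c
    using lin[OF that that, of c 0] by (simp add: scaleR_fun_def)
  ultimately show ?thesis using cont out by (simp add: g_dual_def)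
qed

lemma g_dual_zero: "\<gamma> \<in> g_dual k \<Longrightarrow> \<gamma> (\<lambda>_. 0) = 0"
  using g_dual_lincomb[OF _ zero_in_g_space zero_in_g_space, of \<gamma> k 0 0] by simp

lemma g_dual_sum:
  assumes "\<gamma> \<in> g_dual k" "\<And>i. i \<in> A \<Longrightarrow> f i \<in> g_space k"
  shows "\<gamma> (\<lambda>z. \<Sum>i\<in>A. f i z) = (\<Sum>i\<in>A. \<gamma> (f i))"
  using assms(2)
proof (induction A rule: infinite_finite_induct)
  case (insert x A)
  then show ?case
    using g_dual_lincomb[OF assms(1), of "f x" "\<lambda>z. \<Sum>i\<in>A. f i z" 1 1] g_space_sum[of A f k] by simp
qed (simp_all add: g_dual_zero[OF assms(1)])

text \<open>The factor with which the preimage of \<open>{-1<..<1}\<close> absorbs \<open>B\<close>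
  is the bound.\<close>

lemma g_dual_bounded:
  assumes "\<gamma> \<in> g_dual k" "g_bounded k B"
  obtains r where "\<And>f. f \<in> B \<Longrightarrow> \<bar>\<gamma> f\<bar> \<le> r"
proof -
  let ?U = "{f \<in> g_space k. \<gamma> f \<in> {-1<..<1}}"
  have "openin (g_top k) ?U"
    using openin_continuous_map_preimage[of "g_top k" euclideanreal \<gamma> "{-1<..<1}"] assms(1)
    by (simp add: g_dual_def topspace_g_top)
  moreover have "0 \<in> ?U"
    using g_dual_zero[OF assms(1)] zero_in_g_space[of k] by (simp add: zero_fun_def)
  ultimately obtain r where r: "r > 0" "B \<subseteq> (\<lambda>f. r *\<^sub>R f) ` ?U"
    using assms(2) unfolding g_bounded_def by meson
  have "\<bar>\<gamma> f\<bar> \<le> r" if "f \<in> B" for f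
  proof -
    from that r(2) obtain f' where f': "f = r *\<^sub>R f'" "f' \<in> g_space k" "\<gamma> f' \<in> {-1<..<1}" by blast
    then have "\<gamma> f = r * \<gamma> f'" using assms(1) by (simp add: g_dual_def)
    then have "\<bar>\<gamma> f\<bar> = r * \<bar>\<gamma> f'\<bar>" using r(1) by (simp add: abs_mult)
    also have "\<dots> \<le> r * 1" using r(1) f'(3) by (intro mult_left_mono) auto
    finally show ?thesis by simp
  qed
  then show ?thesis by (rule that)
qed

text \<open>Both functionals are bounded on \<open>B\<close>, so the supremum in the strong seminorm
  is a genuine upper bound.\<close>

lemma strong_upper:
  assumes "\<gamma> \<in> g_dual k" "\<gamma>' \<in> g_dual k" "g_bounded k B" "f \<in> B"
  shows "\<bar>\<gamma>' f - \<gamma> f\<bar> \<le> (SUP f\<in>B. \<bar>\<gamma>' f - \<gamma> f\<bar>)"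
proof (rule cSUP_upper[OF assms(4)])
  obtain r where r: "\<And>f. f \<in> B \<Longrightarrow> \<bar>\<gamma> f\<bar> \<le> r" by (rule g_dual_bounded[OF assms(1,3)]) blast
  obtain r' where r': "\<And>f. f \<in> B \<Longrightarrow> \<bar>\<gamma>' f\<bar> \<le> r'" by (rule g_dual_bounded[OF assms(2,3)]) blast
  have "\<bar>\<gamma>' f - \<gamma> f\<bar> \<le> r' + r" if "f \<in> B" for f
    using r[OF that] r'[OF that] by simp
  then show "bdd_above ((\<lambda>f. \<bar>\<gamma>' f - \<gamma> f\<bar>) ` B)" by (rule bdd_aboveI2)
qed

lemma openin_strong_ball:
  assumes "\<gamma> \<in> g_dual k" "g_bounded k B" "B \<noteq> {}" "\<epsilon> > 0"
  shows "openin (strong_top k) {\<gamma>' \<in> g_dual k. (SUP f\<in>B. \<bar>\<gamma>' f - \<gamma> f\<bar>) < \<epsilon>}"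
  unfolding strong_top_def using assms by (intro topology_generated_by_Basis) blast

lemma continuous_map_into_strong_top:
  assumes "\<And>x. x \<in> topspace X \<Longrightarrow> \<phi> x \<in> g_dual k"
    and "\<And>\<gamma> B \<epsilon>. \<gamma> \<in> g_dual k \<Longrightarrow> g_bounded k B \<Longrightarrow> B \<noteq> {} \<Longrightarrow> \<epsilon> > 0 \<Longrightarrow>
      openin X {x \<in> topspace X. (SUP f\<in>B. \<bar>\<phi> x f - \<gamma> f\<bar>) < \<epsilon>}"
  shows "continuous_map X (strong_top k) \<phi>"
  unfolding strong_top_def
proof (rule continuous_on_generated_topo, goal_cases)
  case (1 U)
  then obtain \<gamma> B \<epsilon> where U: "\<gamma> \<in> g_dual k" "g_bounded k B" "B \<noteq> {}" "\<epsilon> > 0"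
    "U = {\<gamma>' \<in> g_dual k. (SUP f\<in>B. \<bar>\<gamma>' f - \<gamma> f\<bar>) < \<epsilon>}" by (elim CollectE exE conjE)
  have "\<phi> -` U \<inter> topspace X = {x \<in> topspace X. (SUP f\<in>B. \<bar>\<phi> x f - \<gamma> f\<bar>) < \<epsilon>}"
    unfolding U(5) using assms(1) by (intro equalityI subsetI) simp_all
  with assms(2)[OF U(1-4)] show ?case by simp
next
  case 2
  show ?case
  proof (rule image_subsetI)
    fix x assume "x \<in> topspace X"
    then have x: "\<phi> x \<in> g_dual k" by (rule assms(1))
    \<comment> \<open>The carrier of a generated topology is the union of its generators, so
      \<open>\<phi> x\<close> has to be put into one of them; the bounded set
      \<open>{\<lambda>_. 0}\<close> provides it.\<close>
    let ?U = "{\<gamma>' \<in> g_dual k. (SUP f\<in>{\<lambda>_. 0}. \<bar>\<gamma>' f - \<phi> x f\<bar>) < 1}"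
    have "\<phi> x \<in> ?U" using x by simp
    moreover have "?U \<in> {{\<gamma>' \<in> g_dual k. (SUP f\<in>B. \<bar>\<gamma>' f - \<gamma> f\<bar>) < \<epsilon>} | \<gamma> B \<epsilon>.
        \<gamma> \<in> g_dual k \<and> g_bounded k B \<and> B \<noteq> {} \<and> \<epsilon> > 0}"
      using x g_bounded_singleton[OF zero_in_g_space, of k]
      by (intro CollectI exI[of _ "\<phi> x"] exI[of _ "{\<lambda>_. 0}"] exI[of _ 1] conjI refl) simp_all
    ultimately show "\<phi> x \<in> \<Union> {{\<gamma>' \<in> g_dual k. (SUP f\<in>B. \<bar>\<gamma>' f - \<gamma> f\<bar>) < \<epsilon>} | \<gamma> B \<epsilon>.
        \<gamma> \<in> g_dual k \<and> g_bounded k B \<and> B \<noteq> {} \<and> \<epsilon> > 0}" by (rule UnionI[rotated])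
  qed
qed

text \<open>The transpose of \<open>T\<close>, cut off outside \<open>g_space k\<close> as the
  encoding of the dual demands.\<close>

lemma g_dual_cont_op:
  assumes \<gamma>: "\<gamma> \<in> g_dual m" and T: "cont_op k m T"
    and g: "\<And>f. f \<in> g_space k \<Longrightarrow> T f \<in> g_space m"
  shows "(\<lambda>f. if f \<in> g_space k then \<gamma> (T f) else 0) \<in> g_dual k"
proof (rule g_dualI)
  fix f h :: "'a config \<Rightarrow> real" and c d :: real
  assume f: "f \<in> g_space k" and h: "h \<in> g_space k"
  then show "(if (\<lambda>z. c * f z + d * h z) \<in> g_space k then \<gamma> (T (\<lambda>z. c * f z + d * h z)) else 0) =
      c * (if f \<in> g_space k then \<gamma> (T f) else 0) + d * (if h \<in> g_space k then \<gamma> (T h) else 0)"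
    using cont_op_lincomb[OF T f[THEN g_space_smooth] h[THEN g_space_smooth], of c d]
      g_dual_lincomb[OF \<gamma> g g, of f h c d]
    by (simp add: g_space_lincomb)
next
  have "continuous_map (g_top k) euclideanreal (\<gamma> \<circ> T)"
    using \<gamma> by (intro continuous_map_compose[OF continuous_map_cont_op[OF T g]])
      (simp_all add: g_dual_def)
  then show "continuous_map (g_top k) euclideanreal (\<lambda>f. if f \<in> g_space k then \<gamma> (T f) else 0)"
    by (rule continuous_map_eq) (simp add: topspace_g_top)
qed simp

text \<open>Point evaluations separate the elements of \<open>g_space k\<close>, on which the
  uniqueness of gradients rests.\<close>

lemma point_evaluation_in_g_dual: "(\<lambda>f. if f \<in> g_space k then f z else 0) \<in> g_dual k"
proof (rule g_dualI)
  show "continuous_map (g_top k) euclideanreal (\<lambda>f. if f \<in> g_space k then f z else 0)"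
    unfolding continuous_map_def topspace_g_top
  proof (intro conjI allI impI)
    fix U :: "real set" assume "openin euclideanreal U"
    then have U: "open U" by simp
    show "openin (g_top k) {f \<in> g_space k. (if f \<in> g_space k then f z else 0) \<in> U}"
    proof (rule openin_g_topI)
      fix f assume f: "f \<in> {f \<in> g_space k. (if f \<in> g_space k then f z else 0) \<in> U}"
      then obtain e where e: "e > 0" "\<And>y. \<bar>y - f z\<bar> < e \<Longrightarrow> y \<in> U"
        using U unfolding open_real by fastforce
      have "g z \<in> U" if g: "g \<in> g_space k" "g_seminorm k {z} 0 (g - f) < e" for g
      proof (rule e(2))
        have "g - f \<in> smooth_fns k" using f g by (simp add: g_space_diff g_space_smooth)
        from g_seminorm_upper[OF this, of "{z}" "[]" 0 z] g(2) show "\<bar>g z - f z\<bar> < e" by simp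
      qed
      with e(1) show "\<exists>K n \<epsilon>. compact K \<and> K \<noteq> {} \<and> \<epsilon> > 0 \<and>
          {g \<in> g_space k. g_seminorm k K n (g - f) < \<epsilon>} \<subseteq>
          {f \<in> g_space k. (if f \<in> g_space k then f z else 0) \<in> U}"
        by (intro exI[of _ "{z}"] exI[of _ 0] exI[of _ e]) auto
    qed simp
  qed simp
qed (simp_all add: g_space_lincomb)

section \<open>The product topology on \<open>G_dual\<close>\<close>

lemma dual_component_in_g_dual: "k \<ge> 1 \<Longrightarrow> dual_component \<Gamma> k \<in> g_dual k"
  using dual_component[of \<Gamma>] by simp

lemma open_dual_component:
  "k \<ge> 1 \<Longrightarrow> openin (strong_top k) U \<Longrightarrow> open {\<Gamma>. dual_component \<Gamma> k \<in> U}"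
  unfolding open_G_dual_def by (rule generate_topology.Basis) blast

lemma continuous_on_G_dual:
  fixes X :: "'a::topological_space \<Rightarrow> 'd::finite G_dual"
  assumes "\<And>k. k \<ge> 1 \<Longrightarrow> continuous_map euclidean (strong_top k) (\<lambda>x. dual_component (X x) k)"
  shows "continuous_on UNIV X"
proof (rule continuous_on_generate_topology[OF open_G_dual_def])
  fix B :: "'d G_dual set"
  assume "B \<in> {{\<Gamma>. dual_component \<Gamma> k \<in> U} | k U. k \<ge> 1 \<and> openin (strong_top k) U}"
  then obtain k U where B: "B = {\<Gamma>. dual_component \<Gamma> k \<in> U}" "k \<ge> 1" "openin (strong_top k) U"
    by (elim CollectE exE conjE)
  have "open {x. dual_component (X x) k \<in> U}"
    using openin_continuous_map_preimage[OF assms[OF B(2)] B(3)] by simp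
  then show "\<exists>C. open C \<and> C \<inter> UNIV = X -` B \<inter> UNIV"
    unfolding B(1) by (intro exI[of _ "{x. dual_component (X x) k \<in> U}"]) auto
qed

text \<open>Lets limits in \<open>G_dual\<close> be tested by numbers; \<open>{f}\<close> is the
  bounded set whose strong ball controls the value at \<open>f\<close>.\<close>

lemma continuous_on_evaluation:
  fixes f :: "'d::finite config \<Rightarrow> real"
  assumes k: "k \<ge> 1" and f: "f \<in> g_space k"
  shows "continuous_on UNIV (\<lambda>\<Gamma>. dual_component \<Gamma> k f)"
  unfolding continuous_on_open_vimage[OF open_UNIV]
proof (intro allI impI)
  fix V :: "real set" assume V: "open V"
  show "open ((\<lambda>\<Gamma>. dual_component \<Gamma> k f) -` V \<inter> UNIV)"
  proof (subst open_subopen, rule ballI)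
    fix \<Gamma>\<^sub>0 assume "\<Gamma>\<^sub>0 \<in> (\<lambda>\<Gamma>. dual_component \<Gamma> k f) -` V \<inter> UNIV"
    then obtain e where e: "e > 0" "\<And>y. \<bar>y - dual_component \<Gamma>\<^sub>0 k f\<bar> < e \<Longrightarrow> y \<in> V"
      using V unfolding open_real by fastforce
    let ?U = "{\<gamma> \<in> g_dual k. (SUP g\<in>{f}. \<bar>\<gamma> g - dual_component \<Gamma>\<^sub>0 k g\<bar>) < e}"
    have "open {\<Gamma>. dual_component \<Gamma> k \<in> ?U}"
      by (intro open_dual_component openin_strong_ball dual_component_in_g_dual
          g_bounded_singleton k f e(1)) simp
    then show "\<exists>T. open T \<and> \<Gamma>\<^sub>0 \<in> T \<and> T \<subseteq> (\<lambda>\<Gamma>. dual_component \<Gamma> k f) -` V \<inter> UNIV"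
      using e by (intro exI[of _ "{\<Gamma>. dual_component \<Gamma> k \<in> ?U}"])
        (auto simp: dual_component_in_g_dual[OF k])
  qed
qed

section \<open>Strong continuity of sums and transposes\<close>

lemma topspace_strong_top: "topspace (strong_top k) \<subseteq> g_dual k"
  unfolding strong_top_def topology_generated_by_topspace by blast

lemma strong_least:
  fixes \<gamma> \<gamma>' :: "'a \<Rightarrow> real"
  assumes "B \<noteq> {}" "\<And>f. f \<in> B \<Longrightarrow> \<bar>\<gamma>' f - \<gamma> f\<bar> \<le> c"
  shows "(SUP f\<in>B. \<bar>\<gamma>' f - \<gamma> f\<bar>) \<le> c"
  by (rule cSUP_least) (use assms in auto)

lemma continuous_map_strong_in_dual:
  "continuous_map X (strong_top k) \<phi> \<Longrightarrow> x \<in> topspace X \<Longrightarrow> \<phi> x \<in> g_dual k"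
  using continuous_map_funspace[of X "strong_top k" \<phi>] topspace_strong_top[of k] by blast

text \<open>Serves the vector field, whose component in degree \<open>k\<close> is a finite sum of
  transposes, one for each nonzero component of \<open>H\<close>.\<close>

lemma continuous_map_strong_add:
  fixes \<phi> \<psi> :: "'a \<Rightarrow> ('d::finite config \<Rightarrow> real) \<Rightarrow> real"
  assumes \<phi>: "continuous_map X (strong_top k) \<phi>" and \<psi>: "continuous_map X (strong_top k) \<psi>"
  shows "continuous_map X (strong_top k) (\<lambda>x f. \<phi> x f + \<psi> x f)"
proof (rule continuous_map_into_strong_top)
  fix \<gamma> :: "('d config \<Rightarrow> real) \<Rightarrow> real" and B :: "('d config \<Rightarrow> real) set" and \<epsilon> :: real
  assume \<gamma>: "\<gamma> \<in> g_dual k" and B: "g_bounded k B" "B \<noteq> {}"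
  let ?q = "\<lambda>\<gamma>' \<gamma>. SUP f\<in>B. \<bar>\<gamma>' f - \<gamma> f\<bar>"
  let ?s = "\<lambda>x f. \<phi> x f + \<psi> x f"
  show "openin X {x \<in> topspace X. ?q (?s x) \<gamma> < \<epsilon>}"
  proof (subst openin_subopen, rule ballI)
    fix x assume x: "x \<in> {x \<in> topspace X. ?q (?s x) \<gamma> < \<epsilon>}"
    then have xd: "\<phi> x \<in> g_dual k" "\<psi> x \<in> g_dual k"
      using continuous_map_strong_in_dual[OF \<phi>] continuous_map_strong_in_dual[OF \<psi>] by simp_all
    \<comment> \<open>Two thirds of the gap are spent on the perturbations of \<open>\<phi>\<close>
      and \<open>\<psi>\<close>; the last third keeps the inequality strict, since a supremum of
      small terms is bounded only by \<open>\<le>\<close>.\<close>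
    define \<delta> where "\<delta> = (\<epsilon> - ?q (?s x) \<gamma>) / 3"
    have \<delta>: "\<delta> > 0" using x by (simp add: \<delta>_def)
    let ?U = "\<lambda>\<phi>. {y \<in> topspace X. \<phi> y \<in> {\<gamma>' \<in> g_dual k. ?q \<gamma>' (\<phi> x) < \<delta>}}"
    have "openin X (?U \<phi>)" "openin X (?U \<psi>)"
      using xd B \<delta> by (intro openin_continuous_map_preimage[OF \<phi>]
        openin_continuous_map_preimage[OF \<psi>] openin_strong_ball; simp)+
    moreover have "?q (?s y) \<gamma> < \<epsilon>" if y: "y \<in> ?U \<phi>" "y \<in> ?U \<psi>" for y
    proof -
      have "?q (?s y) \<gamma> \<le> ?q (?s x) \<gamma> + \<delta> + \<delta>"
      proof (rule strong_least[OF B(2)])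
        fix f assume f: "f \<in> B"
        have "\<bar>\<phi> y f - \<phi> x f\<bar> \<le> \<delta>" "\<bar>\<psi> y f - \<psi> x f\<bar> \<le> \<delta>"
          using strong_upper[OF xd(1) _ B(1) f, of "\<phi> y"] strong_upper[OF xd(2) _ B(1) f, of "\<psi> y"] y
          by simp_all
        moreover have "\<bar>?s x f - \<gamma> f\<bar> \<le> ?q (?s x) \<gamma>"
          by (rule strong_upper[OF \<gamma> add_in_g_dual[OF xd] B(1) f])
        ultimately show "\<bar>?s y f - \<gamma> f\<bar> \<le> ?q (?s x) \<gamma> + \<delta> + \<delta>" by linarith
      qed
      also have "\<dots> < \<epsilon>" using \<delta> by (simp add: \<delta>_def field_simps)
      finally show ?thesis .
    qed
    moreover have "?q (\<phi> x) (\<phi> x) < \<delta>" "?q (\<psi> x) (\<psi> x) < \<delta>" using B(2) \<delta> by simp_all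
    ultimately show "\<exists>T. openin X T \<and> x \<in> T \<and> T \<subseteq> {x \<in> topspace X. ?q (?s x) \<gamma> < \<epsilon>}"
      using x xd by (intro exI[of _ "?U \<phi> \<inter> ?U \<psi>"] conjI openin_Int subsetI) simp_all
  qed
qed (simp add: add_in_g_dual continuous_map_strong_in_dual[OF \<phi>] continuous_map_strong_in_dual[OF \<psi>])

lemma continuous_map_strong_zero:
  "continuous_map X (strong_top k) (\<lambda>x (f :: 'd::finite config \<Rightarrow> real). 0)"
proof (rule continuous_map_into_strong_top)
  fix \<gamma> :: "('d config \<Rightarrow> real) \<Rightarrow> real" and B :: "('d config \<Rightarrow> real) set" and \<epsilon> :: real
  show "openin X {x \<in> topspace X. (SUP f\<in>B. \<bar>0 - \<gamma> f\<bar>) < \<epsilon>}"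
    by (cases "(SUP f\<in>B. \<bar>0 - \<gamma> f\<bar>) < \<epsilon>") simp_all
qed (rule zero_in_g_dual)

lemma continuous_map_strong_sum:
  fixes \<phi> :: "'b \<Rightarrow> 'a \<Rightarrow> ('d::finite config \<Rightarrow> real) \<Rightarrow> real"
  shows "(\<And>i. i \<in> A \<Longrightarrow> continuous_map X (strong_top k) (\<phi> i)) \<Longrightarrow>
     continuous_map X (strong_top k) (\<lambda>x f. \<Sum>i\<in>A. \<phi> i x f)"
  by (induction A rule: infinite_finite_induct)
    (simp_all add: continuous_map_strong_zero continuous_map_strong_add del: continuous_map_const)

text \<open>The strong distance over \<open>B\<close> between two transposed functionals is the
  distance between the originals over the image of \<open>B\<close> under \<open>T\<close>, which is
  again bounded.\<close>

lemma continuous_map_strong_transpose: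
  fixes T :: "('d::finite config \<Rightarrow> real) \<Rightarrow> 'd config \<Rightarrow> real"
  assumes T: "cont_op k m T" and g: "\<And>f. f \<in> g_space k \<Longrightarrow> T f \<in> g_space m"
  shows "continuous_map (strong_top m) (strong_top k) (\<lambda>\<gamma> f. if f \<in> g_space k then \<gamma> (T f) else 0)"
proof (rule continuous_map_into_strong_top)
  let ?T = "\<lambda>\<gamma> f. if f \<in> g_space k then \<gamma> (T f) else (0 :: real)"
  fix \<gamma> :: "('d config \<Rightarrow> real) \<Rightarrow> real" and B :: "('d config \<Rightarrow> real) set" and \<epsilon> :: real
  assume \<gamma>: "\<gamma> \<in> g_dual k" and B: "g_bounded k B" "B \<noteq> {}"
  let ?q = "\<lambda>B \<gamma>' \<gamma>. SUP f\<in>B. \<bar>\<gamma>' f - \<gamma> f\<bar>"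
  let ?X = "topspace (strong_top m) :: (('d config \<Rightarrow> real) \<Rightarrow> real) set"
  have TB: "g_bounded m (T ` B)" "T ` B \<noteq> {}" using g_bounded_image[OF T g B(1)] B(2) by simp_all
  show "openin (strong_top m) {\<gamma>' \<in> ?X. ?q B (?T \<gamma>') \<gamma> < \<epsilon>}"
  proof (subst openin_subopen, rule ballI)
    fix \<gamma>' assume \<gamma>': "\<gamma>' \<in> {\<gamma>' \<in> ?X. ?q B (?T \<gamma>') \<gamma> < \<epsilon>}"
    then have d': "\<gamma>' \<in> g_dual m" using topspace_strong_top by blast
    define \<delta> where "\<delta> = (\<epsilon> - ?q B (?T \<gamma>') \<gamma>) / 2"
    have \<delta>: "\<delta> > 0" using \<gamma>' by (simp add: \<delta>_def)
    let ?U = "{\<eta> \<in> g_dual m. ?q (T ` B) \<eta> \<gamma>' < \<delta>}"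
    have U: "openin (strong_top m) ?U" by (rule openin_strong_ball[OF d' TB \<delta>])
    have in_ball: "?q B (?T \<eta>) \<gamma> < \<epsilon>" if \<eta>: "\<eta> \<in> ?U" for \<eta>
    proof -
      have "?q B (?T \<eta>) \<gamma> \<le> ?q B (?T \<gamma>') \<gamma> + \<delta>"
      proof (rule strong_least[OF B(2)])
        fix f assume f: "f \<in> B"
        have "\<bar>\<eta> (T f) - \<gamma>' (T f)\<bar> \<le> \<delta>"
          using strong_upper[OF d' _ TB(1) imageI[OF f], of \<eta>] \<eta> by simp
        moreover have "\<bar>?T \<gamma>' f - \<gamma> f\<bar> \<le> ?q B (?T \<gamma>') \<gamma>"
          by (rule strong_upper[OF \<gamma> g_dual_cont_op[OF d' T g] B(1) f])
        moreover have "f \<in> g_space k" using B(1) f unfolding g_bounded_def by blast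
        ultimately show "\<bar>?T \<eta> f - \<gamma> f\<bar> \<le> ?q B (?T \<gamma>') \<gamma> + \<delta>" by (simp only: if_True)
      qed
      also have "\<dots> < \<epsilon>" using \<delta> by (simp add: \<delta>_def field_simps)
      finally show ?thesis .
    qed
    have "?U \<subseteq> {\<gamma>' \<in> ?X. ?q B (?T \<gamma>') \<gamma> < \<epsilon>}"
    proof (intro subsetI CollectI conjI)
      fix \<eta> assume \<eta>: "\<eta> \<in> ?U"
      with openin_subset[OF U] show "\<eta> \<in> ?X" by (rule subsetD)
      show "?q B (?T \<eta>) \<gamma> < \<epsilon>" by (rule in_ball[OF \<eta>])
    qed
    moreover have "\<gamma>' \<in> ?U" using d' \<delta> TB(2) by simp
    ultimately show "\<exists>V. openin (strong_top m) V \<and> \<gamma>' \<in> V \<and>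
        V \<subseteq> {\<gamma>' \<in> ?X. ?q B (?T \<gamma>') \<gamma> < \<epsilon>}"
      using U by (intro exI[of _ ?U] conjI)
  qed
qed (use topspace_strong_top in \<open>intro g_dual_cont_op[OF _ T g]; blast\<close>)

lemma continuous_map_dual_component:
  assumes "k \<ge> 1"
  shows "continuous_map euclidean (strong_top k) (\<lambda>\<Gamma> :: 'd::finite G_dual. dual_component \<Gamma> k)"
proof (rule continuous_map_into_strong_top)
  fix \<gamma> :: "('d config \<Rightarrow> real) \<Rightarrow> real" and B :: "('d config \<Rightarrow> real) set" and \<epsilon> :: real
  assume "\<gamma> \<in> g_dual k" "g_bounded k B" "B \<noteq> {}" "\<epsilon> > 0"
  from open_dual_component[OF assms openin_strong_ball[OF this]]
  show "openin euclidean {\<Gamma> \<in> topspace euclidean. (SUP f\<in>B. \<bar>dual_component \<Gamma> k f - \<gamma> f\<bar>) < \<epsilon>}"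
    by (simp add: dual_component_in_g_dual[OF assms])
qed (rule dual_component_in_g_dual[OF assms])

section \<open>Hamiltonian vector fields of linear functionals\<close>

lemma g_dual_outside: "\<gamma> \<in> g_dual k \<Longrightarrow> f \<notin> g_space k \<Longrightarrow> \<gamma> f = 0"
  by (simp add: g_dual_def)

lemma component_in_g_space: "k \<ge> 1 \<Longrightarrow> component F k \<in> g_space k"
  using component[of F] by simp

lemma component_0: "component F 0 = (\<lambda>_. 0)"
  using component[of F] by simp

lemma finite_component: "finite {k. component F k \<noteq> (\<lambda>_. 0)}"
  using component[of F] by simp

lemma dual_component_0: "dual_component \<Gamma> 0 = (\<lambda>_. 0)"
  using dual_component[of \<Gamma>] by simp

lemma dual_component_zero_fun: "dual_component \<Gamma> k (\<lambda>_. 0) = 0"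
  by (cases "k = 0") (simp_all add: dual_component_0 g_dual_zero[OF dual_component_in_g_dual])

text \<open>Lets pairings with different supports be expanded over one finite index set.\<close>

lemma pairing_superset:
  assumes "finite A" "{k. component F k \<noteq> (\<lambda>_. 0)} \<subseteq> A"
  shows "pairing F \<Gamma> = (\<Sum>k\<in>A. dual_component \<Gamma> k (component F k))"
  unfolding pairing_def
  by (rule sum.mono_neutral_left) (use assms in \<open>auto simp: dual_component_zero_fun\<close>)

lemma pairing_add: "pairing F (\<Gamma> + \<Delta>) = pairing F \<Gamma> + pairing F \<Delta>"
  by (simp add: pairing_def plus_G_dual.rep_eq sum.distrib)

lemma pairing_scaleR: "pairing F (r *\<^sub>R \<Gamma>) = r * pairing F \<Gamma>"
  by (simp add: pairing_def scaleR_G_dual.rep_eq sum_distrib_left)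

lemma component_Abs:
  assumes "F 0 = (\<lambda>_. 0)" "\<And>k. k \<ge> 1 \<Longrightarrow> F k \<in> g_space k" "finite {k. F k \<noteq> (\<lambda>_. 0)}"
  shows "component (Abs_G_inf F) = F"
  by (rule Abs_G_inf_inverse) (use assms in simp)

lemma dual_component_Abs:
  assumes "\<Gamma> 0 = (\<lambda>_. 0)" "\<And>k. k \<ge> 1 \<Longrightarrow> \<Gamma> k \<in> g_dual k"
  shows "dual_component (Abs_G_dual \<Gamma>) = \<Gamma>"
  by (rule Abs_G_dual_inverse) (use assms in simp)

lemma pairing_single:
  assumes k: "k \<ge> 1" and f: "f \<in> g_space k"
  obtains F where "\<And>\<Gamma>. pairing F \<Gamma> = dual_component \<Gamma> k f"
proof
  define s where "s = (\<lambda>m. if m = k then f else (\<lambda>_. 0))"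
  have fin: "finite {m. s m \<noteq> (\<lambda>_. 0)}"
    by (rule finite_subset[of _ "{k}"]) (auto simp: s_def)
  have s: "component (Abs_G_inf s) = s"
    using k f by (intro component_Abs fin) (simp_all add: s_def zero_in_g_space)
  show "pairing (Abs_G_inf s) \<Gamma> = dual_component \<Gamma> k f" for \<Gamma>
    by (subst pairing_superset[of "{k}"]) (unfold s, auto simp: s_def)
qed

text \<open>\<open>G_inf\<close> carries no vector space structure, so a linear combination is
  described by its pairings, the form in which gradients of sums and products use it.\<close>

lemma pairing_lincomb:
  obtains K where "\<And>\<Gamma>. pairing K \<Gamma> = c * pairing F \<Gamma> + d * pairing G \<Gamma>"
proof
  let ?K = "\<lambda>k z. c * component F k z + d * component G k z"
  let ?A = "{k. component F k \<noteq> (\<lambda>_. 0)} \<union> {k. component G k \<noteq> (\<lambda>_. 0)}"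
  have fin: "finite ?A" using finite_component by blast
  have sub: "{k. ?K k \<noteq> (\<lambda>_. 0)} \<subseteq> ?A" by auto
  have K: "component (Abs_G_inf ?K) = ?K"
    by (rule component_Abs)
      (simp_all add: component_0 g_space_lincomb component_in_g_space finite_subset[OF sub fin])
  fix \<Gamma>
  have "dual_component \<Gamma> k (?K k) =
      c * dual_component \<Gamma> k (component F k) + d * dual_component \<Gamma> k (component G k)" for k
    by (cases "k = 0")
      (simp_all add: dual_component_0 g_dual_lincomb[OF dual_component_in_g_dual] component_in_g_space)
  then show "pairing (Abs_G_inf ?K) \<Gamma> = c * pairing F \<Gamma> + d * pairing G \<Gamma>"
    by (subst (1 2 3) pairing_superset[OF fin])
      (use sub in \<open>simp_all add: K sum.distrib sum_distrib_left\<close>)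
qed

text \<open>Justifies the \<open>THE\<close> in \<open>grad\<close>.\<close>

lemma pairing_inject:
  assumes "\<And>\<Gamma>. pairing F \<Gamma> = pairing G \<Gamma>"
  shows "F = G"
proof -
  have "component F k z = component G k z" for k z
  proof (cases "k = 0")
    case False
    \<comment> \<open>The point evaluation at \<open>z\<close> in degree \<open>k\<close>, zero in
      all other degrees, so that pairing with it reads off \<open>component H k z\<close>.\<close>
    define \<Delta> where "\<Delta> = Abs_G_dual
      (\<lambda>m. if m = k then (\<lambda>f. if f \<in> g_space k then f z else 0) else (\<lambda>_. 0))"
    have \<Delta>: "dual_component \<Delta> =
        (\<lambda>m. if m = k then (\<lambda>f. if f \<in> g_space k then f z else 0) else (\<lambda>_. 0))"
      unfolding \<Delta>_def using False
      by (intro dual_component_Abs) (simp_all add: point_evaluation_in_g_dual zero_in_g_dual)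
    have "pairing H \<Delta> = component H k z" for H
    proof -
      have "pairing H \<Delta> = (\<Sum>m\<in>insert k {k. component H k \<noteq> (\<lambda>_. 0)}.
          dual_component \<Delta> m (component H m))"
        by (rule pairing_superset) (use finite_component in auto)
      also have "\<dots> = (\<Sum>m\<in>insert k {k. component H k \<noteq> (\<lambda>_. 0)}.
          if m = k then component H m z else 0)"
        using False by (intro sum.cong refl) (simp add: \<Delta> component_in_g_space)
      finally show ?thesis using finite_component[of H] by simp
    qed
    with assms[of \<Delta>] show ?thesis by simp
  qed (simp add: component_0)
  then show ?thesis by (simp add: component_inject[symmetric] fun_eq_iff)
qed

text \<open>Index \<open>0\<close> and functions outside \<open>g_space k\<close> carry fixed
  default values, so agreement on the meaningful arguments is equality.\<close>

lemma G_dual_eqI: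
  assumes "\<And>k f. k \<ge> 1 \<Longrightarrow> f \<in> g_space k \<Longrightarrow> dual_component \<Gamma> k f = dual_component \<Delta> k f"
  shows "\<Gamma> = \<Delta>"
proof -
  have "dual_component \<Gamma> k f = dual_component \<Delta> k f" for k f
  proof (cases "k \<ge> 1 \<and> f \<in> g_space k")
    case False
    then consider "k = 0" | "k \<ge> 1" "f \<notin> g_space k" by force
    then show ?thesis
      by cases (simp_all add: dual_component_0 g_dual_outside[OF dual_component_in_g_dual])
  qed (simp add: assms)
  then show ?thesis by (simp add: dual_component_inject[symmetric] fun_eq_iff)
qed

text \<open>Elements of \<open>G_inf\<close> concentrated in one degree suffice. This gives the
  uniqueness of the vector field.\<close>

lemma pairing_separates:
  assumes "\<And>F. pairing F \<Gamma> = pairing F \<Delta>"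
  shows "\<Gamma> = \<Delta>"
proof (rule G_dual_eqI)
  fix k and f :: "'a config \<Rightarrow> real" assume "k \<ge> 1" "f \<in> g_space k"
  then obtain F where "\<And>\<Gamma>. pairing F \<Gamma> = dual_component \<Gamma> k f" by (rule pairing_single) blast
  with assms[of F] show "dual_component \<Gamma> k f = dual_component \<Delta> k f" by simp
qed

section \<open>Gradients of functionals\<close>

lemma pairing_has_deriv:
  "((\<lambda>t. pairing F (\<Gamma> + t *\<^sub>R \<Delta>)) has_field_derivative pairing F \<Delta>) (at 0)"
  unfolding pairing_add pairing_scaleR by (auto intro!: derivative_eq_intros)

lemma dir_deriv_pairing: "dir_deriv \<Delta> (pairing F) \<Gamma> = pairing F \<Delta>"
  unfolding dir_deriv_def by (rule DERIV_imp_deriv[OF pairing_has_deriv])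

text \<open>Stated with a true derivative, because the rules for sums and products require
  differentiability, which a value of \<open>dir_deriv\<close> does not express.\<close>

lemma A_inf_has_gradient:
  assumes "\<F> \<in> A_inf"
  shows "\<exists>F. \<forall>\<Delta>. ((\<lambda>t. \<F> (\<Gamma> + t *\<^sub>R \<Delta>)) has_field_derivative pairing F \<Delta>) (at 0)"
  using assms
proof induction
  case (const c)
  \<comment> \<open>The zero element of \<open>G_inf\<close>, written as a trivial combination of an
    arbitrary element.\<close>
  obtain K :: "'a G_inf" where "\<And>\<Gamma>. pairing K \<Gamma> = 0 * pairing undefined \<Gamma> + 0 * pairing undefined \<Gamma>"
    by (rule pairing_lincomb) blast
  then show ?case by (intro exI[of _ K]) simp
next
  case (linear F)
  then show ?case using pairing_has_deriv by blast
next
  case (add \<F> \<G>)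
  then obtain F G where F: "\<And>\<Delta>. ((\<lambda>t. \<F> (\<Gamma> + t *\<^sub>R \<Delta>)) has_field_derivative pairing F \<Delta>) (at 0)"
    and G: "\<And>\<Delta>. ((\<lambda>t. \<G> (\<Gamma> + t *\<^sub>R \<Delta>)) has_field_derivative pairing G \<Delta>) (at 0)" by blast
  obtain K where "\<And>\<Gamma>. pairing K \<Gamma> = 1 * pairing F \<Gamma> + 1 * pairing G \<Gamma>"
    by (rule pairing_lincomb) blast
  with DERIV_add[OF F G] show ?case by (intro exI[of _ K]) simp
next
  case (mult \<F> \<G>)
  then obtain F G where F: "\<And>\<Delta>. ((\<lambda>t. \<F> (\<Gamma> + t *\<^sub>R \<Delta>)) has_field_derivative pairing F \<Delta>) (at 0)"
    and G: "\<And>\<Delta>. ((\<lambda>t. \<G> (\<Gamma> + t *\<^sub>R \<Delta>)) has_field_derivative pairing G \<Delta>) (at 0)" by blast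
  obtain K where "\<And>\<Delta>. pairing K \<Delta> = \<G> \<Gamma> * pairing F \<Delta> + \<F> \<Gamma> * pairing G \<Delta>"
    by (rule pairing_lincomb) blast
  with DERIV_mult[OF F G] show ?case by (intro exI[of _ K]) (simp add: mult.commute)
qed

lemma grad_eqI: "(\<And>\<Delta>. pairing F \<Delta> = dir_deriv \<Delta> \<F> \<Gamma>) \<Longrightarrow> grad \<F> \<Gamma> = F"
  unfolding grad_def by (rule the_equality) (auto intro: pairing_inject)

lemma pairing_grad:
  assumes "\<F> \<in> A_inf"
  shows "pairing (grad \<F> \<Gamma>) \<Delta> = dir_deriv \<Delta> \<F> \<Gamma>"
proof -
  obtain F where F: "\<And>\<Delta>. ((\<lambda>t. \<F> (\<Gamma> + t *\<^sub>R \<Delta>)) has_field_derivative pairing F \<Delta>) (at 0)"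
    using A_inf_has_gradient[OF assms, of \<Gamma>] by blast
  have F': "pairing F \<Delta> = dir_deriv \<Delta> \<F> \<Gamma>" for \<Delta>
    unfolding dir_deriv_def by (rule DERIV_imp_deriv[OF F, symmetric])
  show ?thesis using grad_eqI[OF F'] F' by simp
qed

lemma grad_pairing: "grad (pairing F) \<Gamma> = F"
  by (rule grad_eqI) (simp add: dir_deriv_pairing)

text \<open>The difference quotients of a linear map do not depend on the step, and those of its
  derivatives vanish, so the limits exist without any continuity of the vector space
  operations.\<close>

lemma gateaux_smooth_linear:
  fixes X :: "'a::{real_vector,topological_space} \<Rightarrow> 'b::{real_vector,topological_space}"
  assumes cont: "continuous_on UNIV X" and lin: "\<And>x y r. X (x + r *\<^sub>R y) = X x + r *\<^sub>R X y"
  shows "gateaux_smooth X"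
  unfolding gateaux_smooth_def
proof (rule exI[of _ "\<lambda>n x h. if n = 0 then X x else if n = 1 then X (h 0) else 0"], intro conjI allI)
  let ?D = "\<lambda>(n::nat) x h. if n = 0 then X x else if n = 1 then X (h (0::nat)) else 0"
  show "?D 0 x h = X x" for x h by simp
  show "has_curve_deriv (\<lambda>t. ?D n (x + t *\<^sub>R h n) h) (?D (Suc n) x h) 0 UNIV" for n x h
  proof (cases "n = 0")
    case True
    have "\<forall>\<^sub>F s in at 0. X (h 0) = (X (x + s *\<^sub>R h 0) - X (x + 0 *\<^sub>R h 0)) /\<^sub>R (s - 0)"
      unfolding eventually_at_filter lin by simp
    with True show ?thesis
      unfolding has_curve_deriv_def by (simp add: tendsto_eventually eventually_mono)
  qed (simp add: has_curve_deriv_def)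
  have "continuous_on UNIV (\<lambda>p :: 'a \<times> (nat \<Rightarrow> 'a). X (fst p))"
    by (rule continuous_on_compose2[OF cont continuous_on_fst]) auto
  moreover have "continuous_on UNIV (\<lambda>p :: 'a \<times> (nat \<Rightarrow> 'a). snd p 0)"
    by (rule continuous_on_compose2[OF continuous_on_product_coordinates continuous_on_snd]) auto
  then have "continuous_on UNIV (\<lambda>p :: 'a \<times> (nat \<Rightarrow> 'a). X (snd p 0))"
    by (rule continuous_on_compose2[OF cont]) auto
  ultimately show "continuous_on UNIV (\<lambda>(x, h). ?D n x h)" for n
    by (cases "n = 0"; cases "n = 1") (simp_all add: case_prod_unfold)
qed

section \<open>The Hamiltonian vector field of a linear functional\<close>

definition bracket_op ::
    "'d::finite G_inf \<Rightarrow> nat \<Rightarrow> nat \<Rightarrow> ('d config \<Rightarrow> real) \<Rightarrow> 'd config \<Rightarrow> real" where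
  "bracket_op H k j f = Sym (k + j - 1) (wedge1 k j f (component H j))"

text \<open>The \<open>if\<close> stands inside the sum so that each summand is by itself a
  transposed functional and continuity follows term by term.\<close>

definition linear_hamiltonian_vf :: "'d::finite G_inf \<Rightarrow> 'd G_dual \<Rightarrow> 'd G_dual" where
  "linear_hamiltonian_vf H \<Gamma> = Abs_G_dual (\<lambda>k f. \<Sum>j | component H j \<noteq> (\<lambda>_. 0).
     if k \<ge> 1 \<and> f \<in> g_space k then dual_component \<Gamma> (k + j - 1) (bracket_op H k j f) else 0)"

lemma cont_op_bracket_op:
  assumes "k \<ge> 1" "j \<ge> 1"
  shows "cont_op k (k + j - 1) (bracket_op H k j)"
  unfolding bracket_op_def
  by (rule cont_op_compose[OF cont_op_wedge1 cont_op_Sym])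
    (use assms component_in_g_space g_space_smooth in auto)

lemma bracket_op_in_g_space:
  assumes "k \<ge> 1" "j \<ge> 1" "f \<in> g_space k"
  shows "bracket_op H k j f \<in> g_space (k + j - 1)"
  unfolding bracket_op_def
  by (rule Sym_in_g_space, rule smooth_fns_wedge1)
    (use assms component_in_g_space g_space_smooth in auto)

lemma component_support: "component H j \<noteq> (\<lambda>_. 0) \<Longrightarrow> j \<ge> 1"
  by (cases j) (auto simp: component_0)

lemma continuous_map_transposed_bracket_op:
  assumes "k \<ge> 1" "j \<ge> 1"
  shows "continuous_map euclidean (strong_top k)
    (\<lambda>\<Gamma> f. if f \<in> g_space k then dual_component \<Gamma> (k + j - 1) (bracket_op H k j f) else 0)"
proof -
  have "k + j - 1 \<ge> 1" using assms by simp
  from continuous_map_compose[OF continuous_map_dual_component[OF this]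
      continuous_map_strong_transpose[OF cont_op_bracket_op[OF assms] bracket_op_in_g_space[OF assms]]]
  show ?thesis by (simp only: o_def)
qed

lemma continuous_map_linear_hamiltonian_vf:
  fixes H :: "'d::finite G_inf"
  assumes "k \<ge> 1"
  shows "continuous_map euclidean (strong_top k) (\<lambda>\<Gamma> f. \<Sum>j | component H j \<noteq> (\<lambda>_. 0).
     if k \<ge> 1 \<and> f \<in> g_space k then dual_component \<Gamma> (k + j - 1) (bracket_op H k j f) else 0)"
  using assms continuous_map_transposed_bracket_op[OF assms component_support]
  by (intro continuous_map_strong_sum) simp

lemma dual_component_linear_hamiltonian_vf:
  "dual_component (linear_hamiltonian_vf H \<Gamma>) = (\<lambda>k f. \<Sum>j | component H j \<noteq> (\<lambda>_. 0).
     if k \<ge> 1 \<and> f \<in> g_space k then dual_component \<Gamma> (k + j - 1) (bracket_op H k j f) else 0)"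
  unfolding linear_hamiltonian_vf_def
proof (rule dual_component_Abs)
  fix k :: nat assume "k \<ge> 1"
  from continuous_map_strong_in_dual[OF continuous_map_linear_hamiltonian_vf[OF this]]
  show "(\<lambda>f. \<Sum>j | component H j \<noteq> (\<lambda>_. 0). if k \<ge> 1 \<and> f \<in> g_space k
      then dual_component \<Gamma> (k + j - 1) (bracket_op H k j f) else 0) \<in> g_dual k" by simp
qed simp

lemma gateaux_smooth_linear_hamiltonian_vf: "gateaux_smooth (linear_hamiltonian_vf H)"
proof (rule gateaux_smooth_linear)
  show "continuous_on UNIV (linear_hamiltonian_vf H)"
    unfolding dual_component_linear_hamiltonian_vf
    by (rule continuous_on_G_dual, unfold dual_component_linear_hamiltonian_vf)
      (rule continuous_map_linear_hamiltonian_vf)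
  fix \<Gamma> \<Delta> :: "'a G_dual" and r
  show "linear_hamiltonian_vf H (\<Gamma> + r *\<^sub>R \<Delta>) =
      linear_hamiltonian_vf H \<Gamma> + r *\<^sub>R linear_hamiltonian_vf H \<Delta>"
    by (rule G_dual_eqI)
      (simp add: dual_component_linear_hamiltonian_vf plus_G_dual.rep_eq scaleR_G_dual.rep_eq
        sum.distrib sum_distrib_left)
qed

lemma finite_index_pairs: "finite {(l, j). l \<ge> 1 \<and> j \<ge> 1 \<and> l + j - 1 = (k::nat)}"
  by (rule finite_subset[of _ "{..k} \<times> {..k}"]) auto

text \<open>The double sum over the supports of \<open>F\<close> and \<open>H\<close> is regrouped
  by the degree \<open>l + j - 1\<close> to which each pair contributes. Pairs outside the supports
  add nothing, because \<open>wedge1\<close> vanishes when one of its arguments does.\<close>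

lemma pairing_linear_hamiltonian_vf:
  "pairing F (linear_hamiltonian_vf H \<Gamma>) = pairing (lie F H) \<Gamma>"
proof -
  let ?A = "{k. component F k \<noteq> (\<lambda>_. 0)}" and ?B = "{k. component H k \<noteq> (\<lambda>_. 0)}"
  let ?m = "\<lambda>(l, j). l + j - 1"
  let ?t = "\<lambda>(l, j). dual_component \<Gamma> (l + j - 1)
    (Sym (l + j - 1) (wedge1 l j (component F l) (component H j)))"
  \<comment> \<open>The degrees reached by pairs serve the regrouping, the support of the bracket
    serves the expansion of the pairing with \<open>lie F H\<close>.\<close>
  let ?M = "?m ` (?A \<times> ?B) \<union> {k. component (lie F H) k \<noteq> (\<lambda>_. 0)}"
  have fin: "finite ?A" "finite ?B" "finite ?M" using finite_component by auto
  have "pairing F (linear_hamiltonian_vf H \<Gamma>) = (\<Sum>l\<in>?A. \<Sum>j\<in>?B. ?t (l, j))"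
    unfolding pairing_def dual_component_linear_hamiltonian_vf bracket_op_def prod.case
    using component_support[of F] component_in_g_space[of _ F]
    by (intro sum.cong refl) simp
  also have "\<dots> = (\<Sum>p\<in>?A \<times> ?B. ?t p)"
    by (simp add: sum.cartesian_product case_prod_unfold)
  also have "\<dots> = (\<Sum>k\<in>?M. \<Sum>p | p \<in> ?A \<times> ?B \<and> ?m p = k. ?t p)"
    by (rule sum.group[symmetric]) (use fin in auto)
  also have "\<dots> = (\<Sum>k\<in>?M. dual_component \<Gamma> k (component (lie F H) k))"
  proof (rule sum.cong[OF refl])
    fix k :: nat
    let ?P = "{(l, j). l \<ge> 1 \<and> j \<ge> 1 \<and> l + j - 1 = k}"
    let ?s = "\<lambda>(l, j). Sym k (wedge1 l j (component F l) (component H j))"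
    show "(\<Sum>p | p \<in> ?A \<times> ?B \<and> ?m p = k. ?t p) = dual_component \<Gamma> k (component (lie F H) k)"
    proof (cases "k = 0")
      case True
      then show ?thesis by (simp add: dual_component_0 case_prod_unfold)
    next
      case False
      have s: "?s p \<in> g_space k" if "p \<in> ?P" for p
      proof -
        from that obtain l j where p: "p = (l, j)" "l \<ge> 1" "j \<ge> 1" "l + j - 1 = k" by auto
        then show ?thesis
          unfolding p(1) prod.case
          by (intro Sym_in_g_space smooth_fns_wedge1 g_space_smooth component_in_g_space)
      qed
      have "component (lie F H) k = (\<lambda>z. \<Sum>p\<in>?P. ?s p z)"
        unfolding lie.rep_eq lie_seq_def by (simp add: case_prod_unfold)
      then have "dual_component \<Gamma> k (component (lie F H) k) =
          dual_component \<Gamma> k (\<lambda>z. \<Sum>p\<in>?P. ?s p z)" by (rule arg_cong)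
      also have "\<dots> = (\<Sum>p\<in>?P. dual_component \<Gamma> k (?s p))"
        by (rule g_dual_sum[OF dual_component_in_g_dual s]) (use False in simp_all)
      also have "\<dots> = (\<Sum>p | p \<in> ?A \<times> ?B \<and> ?m p = k. dual_component \<Gamma> k (?s p))"
      proof (rule sum.mono_neutral_right[OF finite_index_pairs])
        show "{p. p \<in> ?A \<times> ?B \<and> ?m p = k} \<subseteq> ?P"
          using component_support[of F] component_support[of H] by auto
        show "\<forall>p\<in>?P - {p. p \<in> ?A \<times> ?B \<and> ?m p = k}. dual_component \<Gamma> k (?s p) = 0"
          by (auto simp: wedge1_zero Sym_zero dual_component_zero_fun)
      qed
      also have "\<dots> = (\<Sum>p | p \<in> ?A \<times> ?B \<and> ?m p = k. ?t p)"
        by (rule sum.cong) auto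
      finally show ?thesis by simp
    qed
  qed
  also have "\<dots> = pairing (lie F H) \<Gamma>"
    by (rule pairing_superset[symmetric]) (use fin in auto)
  finally show ?thesis .
qed

text \<open>Both sides of the defining equation see a functional only through its gradient at
  \<open>\<Gamma>\<close>, so linear functionals determine the field, and the equation extends from
  them to all of \<open>A_inf\<close>.\<close>

lemma is_hamiltonian_vf_pairing_iff:
  "is_hamiltonian_vf (pairing H) X \<longleftrightarrow> X = linear_hamiltonian_vf H"
proof
  assume "is_hamiltonian_vf (pairing H) X"
  then have X: "dir_deriv (X \<Gamma>) (pairing F) \<Gamma> = poisson (pairing F) (pairing H) \<Gamma>" for F \<Gamma>
    using A_inf.linear unfolding is_hamiltonian_vf_def by blast
  show "X = linear_hamiltonian_vf H"
  proof (rule ext, rule pairing_separates)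
    fix \<Gamma> F
    show "pairing F (X \<Gamma>) = pairing F (linear_hamiltonian_vf H \<Gamma>)"
      using X[of \<Gamma> F]
      by (simp add: pairing_linear_hamiltonian_vf dir_deriv_pairing poisson_def grad_pairing)
  qed
next
  assume X: "X = linear_hamiltonian_vf H"
  have "dir_deriv (X \<Gamma>) \<F> \<Gamma> = poisson \<F> (pairing H) \<Gamma>" if "\<F> \<in> A_inf" for \<F> \<Gamma>
    unfolding poisson_def grad_pairing X
    by (simp add: pairing_grad[OF that, symmetric] pairing_linear_hamiltonian_vf)
  then show "is_hamiltonian_vf (pairing H) X"
    unfolding is_hamiltonian_vf_def X by (simp add: gateaux_smooth_linear_hamiltonian_vf)
qed

section \<open>Symmetrization of first-order operators\<close>

lemma Sym_sum: "Sym k (\<lambda>z. \<Sum>i\<in>A. h i z) = (\<lambda>z. \<Sum>i\<in>A. Sym k (h i) z)"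
proof
  fix z
  have "(\<Sum>\<pi> | \<pi> permutes {1..k}. \<Sum>i\<in>A. h i (z \<circ> \<pi>)) =
      (\<Sum>i\<in>A. \<Sum>\<pi> | \<pi> permutes {1..k}. h i (z \<circ> \<pi>))" by (rule sum.swap)
  then show "Sym k (\<lambda>z. \<Sum>i\<in>A. h i z) z = (\<Sum>i\<in>A. Sym k (h i) z)"
    by (simp only: Sym_def sum_divide_distrib)
qed

lemma Sym_cmult: "Sym k (\<lambda>z. c * h z) = (\<lambda>z. c * Sym k h z)"
  by (simp add: Sym_def fun_eq_iff sum_distrib_left)

lemma Sym_reindex:
  assumes "\<rho> permutes {1..k}"
  shows "Sym k (\<lambda>z. h (z \<circ> \<rho>)) = Sym k h"
proof
  fix z
  have "(\<Sum>\<pi> | \<pi> permutes {1..k}. h (z \<circ> \<pi> \<circ> \<rho>)) = (\<Sum>\<pi> | \<pi> permutes {1..k}. h (z \<circ> \<pi>))"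
    using assms
    by (intro sum.reindex_bij_witness[of _ "\<lambda>\<pi>. \<pi> \<circ> inv \<rho>" "\<lambda>\<pi>. \<pi> \<circ> \<rho>"])
      (auto simp: permutes_compose permutes_inv o_assoc[symmetric] permutes_inv_o)
  then show "Sym k (\<lambda>z. h (z \<circ> \<rho>)) z = Sym k h z" by (simp only: Sym_def)
qed

lemma card_permutes: "card {\<pi>. \<pi> permutes {1..k}} = fact k"
  by (rule card_permutations) simp_all

text \<open>A permutation of the first \<open>k\<close> indices is also one of the first
  \<open>m\<close>, so \<open>Sym m\<close> turns all \<open>fact k\<close> terms of the inner
  average into the same function.\<close>

lemma Sym_Sym:
  assumes "k \<le> m"
  shows "Sym m (Sym k h) = Sym m h"
proof -
  have "Sym m (Sym k h) = Sym m (\<lambda>z. (1 / fact k) * (\<Sum>\<pi> | \<pi> permutes {1..k}. h (z \<circ> \<pi>)))"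
    by (simp add: Sym_def[of k, abs_def])
  also have "\<dots> = (\<lambda>z. (1 / fact k) * (\<Sum>\<pi> | \<pi> permutes {1..k}. Sym m (\<lambda>z. h (z \<circ> \<pi>)) z))"
    unfolding Sym_cmult Sym_sum ..
  also have "\<dots> = (\<lambda>z. (1 / fact k) * (\<Sum>\<pi> | \<pi> permutes {1..k}. Sym m h z))"
  proof -
    have "Sym m (\<lambda>z. h (z \<circ> \<pi>)) = Sym m h" if "\<pi> permutes {1..k}" for \<pi>
      using that assms by (intro Sym_reindex permutes_subset[OF that]) simp
    then show ?thesis by simp
  qed
  finally show ?thesis by (simp add: card_permutes[unfolded One_nat_def] fun_eq_iff)
qed

lemma Sym_g_space:
  assumes "f \<in> g_space k"
  shows "Sym k f = f"
  using assms by (simp add: Sym_def g_space_def card_permutes[unfolded One_nat_def] fun_eq_iff)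

lemma dir_deriv_permute:
  assumes "\<pi> permutes S"
  shows "dir_deriv (dir i b) (\<lambda>z. \<phi> (z \<circ> \<pi>)) z = dir_deriv (dir (inv \<pi> i) b) \<phi> (z \<circ> \<pi>)"
proof -
  have "(z + t *\<^sub>R dir i b) \<circ> \<pi> = (z \<circ> \<pi>) + t *\<^sub>R dir (inv \<pi> i) b" for t
  proof
    fix j
    have "\<pi> j = i \<longleftrightarrow> j = inv \<pi> i" by (metis permutes_inverses[OF assms])
    then show "((z + t *\<^sub>R dir i b) \<circ> \<pi>) j = ((z \<circ> \<pi>) + t *\<^sub>R dir (inv \<pi> i) b) j"
      by (simp add: dir_def)
  qed
  then show ?thesis by (simp add: dir_deriv_def)
qed

text \<open>
  The part of a transport or interaction operator that acts on particle \<open>i\<close>; \<open>n\<close> is the index of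
  the partner that is integrated out, and irrelevant for transport.
\<close>

definition first_order_term ::
    "((real^'d) \<Rightarrow> 'd phase \<Rightarrow> 'd phase \<Rightarrow> real) \<Rightarrow> ((real^'d) \<Rightarrow> 'd phase) \<Rightarrow> nat \<Rightarrow>
     ('d::finite config \<Rightarrow> real) \<Rightarrow> nat \<Rightarrow> 'd config \<Rightarrow> real" where
  "first_order_term c u n \<phi> i z =
     (\<Sum>b\<in>Basis. c b (z i) (z n) * dir_deriv (dir i (u b)) \<phi> z)"

text \<open>The partner index \<open>n\<close> is fixed by \<open>\<pi>\<close>, so only the
  differentiated particle changes its label.\<close>

lemma first_order_term_permute:
  assumes "\<pi> permutes S" "n \<notin> S"
  shows "first_order_term c u n (\<lambda>z. \<phi> (z \<circ> \<pi>)) i z = first_order_term c u n \<phi> (inv \<pi> i) (z \<circ> \<pi>)"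
  unfolding first_order_term_def dir_deriv_permute[OF assms(1)]
  using permutes_not_in[OF assms] permutes_inverses(1)[OF assms(1), of i] by simp

lemma first_order_term_Sym:
  fixes \<phi> :: "'d::finite config \<Rightarrow> real"
  assumes \<phi>: "\<phi> \<in> smooth_fns k" and u: "\<And>b. b \<in> Basis \<Longrightarrow> u b \<in> Basis" and i: "i \<in> {1..k}"
    and n: "n \<notin> {1..k}"
  shows "first_order_term c u n (Sym k \<phi>) i z =
    (1 / fact k) * (\<Sum>\<pi> | \<pi> permutes {1..k}. first_order_term c u n \<phi> (inv \<pi> i) (z \<circ> \<pi>))"
proof -
  let ?P = "{\<pi>. \<pi> permutes {1..k}}"
  have S: "Sym k \<phi> = (\<lambda>z. (1 / fact k) * (\<Sum>\<pi>\<in>?P. \<phi> (z \<circ> \<pi>)))"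
    by (simp add: Sym_def fun_eq_iff)
  have D: "dir_deriv (dir i (u b)) (Sym k \<phi>) z =
      (1 / fact k) * (\<Sum>\<pi>\<in>?P. dir_deriv (dir i (u b)) (\<lambda>z. \<phi> (z \<circ> \<pi>)) z)"
    if b: "b \<in> Basis" for b
  proof -
    have e: "dir i (u b) \<in> dirs k" using i u[OF b] by (intro dirs_I) simp_all
    have d: "dir_diff (dir i (u b)) (\<lambda>z. \<phi> (z \<circ> \<pi>))" if "\<pi> \<in> ?P" for \<pi>
    proof (rule smooth_fns_dir_diff[OF smooth_fns_reindex[OF \<phi>] e])
      from that have \<pi>: "\<pi> permutes {1..k}" by simp
      show "inj_on \<pi> {1..k}" by (rule permutes_inj_on[OF \<pi>])
      show "\<pi> ` {1..k} \<subseteq> {1..k}" by (simp only: permutes_image[OF \<pi>] order_refl)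
    qed
    have "dir_diff (dir i (u b)) (\<lambda>z. \<Sum>\<pi>\<in>?P. \<phi> (z \<circ> \<pi>))" using d by (rule dir_diff_sum)
    moreover have "dir_deriv (dir i (u b)) (\<lambda>z. \<Sum>\<pi>\<in>?P. \<phi> (z \<circ> \<pi>)) =
        (\<lambda>z. \<Sum>\<pi>\<in>?P. dir_deriv (dir i (u b)) (\<lambda>z. \<phi> (z \<circ> \<pi>)) z)"
      using d by (rule dir_deriv_sum)
    ultimately show ?thesis unfolding S by (simp only: dir_deriv_cmult)
  qed
  have "first_order_term c u n (Sym k \<phi>) i z =
      (\<Sum>b\<in>Basis. c b (z i) (z n) * ((1 / fact k) *
        (\<Sum>\<pi>\<in>?P. dir_deriv (dir i (u b)) (\<lambda>z. \<phi> (z \<circ> \<pi>)) z)))"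
    unfolding first_order_term_def by (intro sum.cong refl) (simp only: D)
  also have "\<dots> = (1 / fact k) * (\<Sum>\<pi>\<in>?P. first_order_term c u n (\<lambda>z. \<phi> (z \<circ> \<pi>)) i z)"
    unfolding first_order_term_def sum_distrib_left
    by (subst sum.swap) (simp only: mult.left_commute)
  also have "\<dots> = (1 / fact k) * (\<Sum>\<pi>\<in>?P. first_order_term c u n \<phi> (inv \<pi> i) (z \<circ> \<pi>))"
    by (intro arg_cong[where f = "(*) _"] sum.cong refl first_order_term_permute[OF _ n]) simp
  finally show ?thesis .
qed

text \<open>
  By symmetry of \<open>Sym k \<phi>\<close> all particles contribute equally, which trades the factor \<open>k\<close> in the
  bracket for the sum over the particles in the hierarchy.
\<close>

lemma Sym_first_order_term:
  fixes \<phi> :: "'d::finite config \<Rightarrow> real"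
  assumes \<phi>: "\<phi> \<in> smooth_fns k" and u: "\<And>b. b \<in> Basis \<Longrightarrow> u b \<in> Basis"
    and n: "n \<notin> {1..k}" and m: "k \<le> m"
  shows "Sym m (\<lambda>z. real k * first_order_term c u n (Sym k \<phi>) 1 z) =
    Sym m (\<lambda>z. \<Sum>i=1..k. first_order_term c u n \<phi> i z)"
proof -
  let ?T = "first_order_term c u n" and ?f = "Sym k \<phi>"
  have first: "Sym m (?T ?f i) = Sym m (?T ?f 1)" if i: "i \<in> {1..k}" for i
  proof -
    \<comment> \<open>Exchanging the particles \<open>1\<close> and \<open>i\<close> carries one
      term into the other, and \<open>Sym m\<close> does not see the exchange.\<close>
    let ?\<tau> = "Transposition.transpose 1 i"
    have \<tau>: "?\<tau> permutes {1..k}" using i by (intro permutes_swap_id) auto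
    have "?T ?f i = ?T (\<lambda>z. ?f (z \<circ> ?\<tau>)) i" by (simp only: Sym_permute[OF \<tau>])
    also have "\<dots> = (\<lambda>z. ?T ?f 1 (z \<circ> ?\<tau>))"
      by (rule ext) (simp only: first_order_term_permute[OF \<tau> n] inv_transpose_eq transpose_apply_second)
    finally have "Sym m (?T ?f i) = Sym m (\<lambda>z. ?T ?f 1 (z \<circ> ?\<tau>))" by (rule arg_cong)
    also have "\<dots> = Sym m (?T ?f 1)"
      by (rule Sym_reindex, rule permutes_subset[OF \<tau>]) (use m in simp)
    finally show ?thesis .
  qed
  have "Sym m (\<lambda>z. real k * ?T ?f 1 z) = (\<lambda>z. \<Sum>i=1..k. Sym m (?T ?f 1) z)"
    unfolding Sym_cmult by simp
  also have "\<dots> = (\<lambda>z. \<Sum>i=1..k. Sym m (?T ?f i) z)"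
    by (intro ext sum.cong refl) (simp only: first)
  also have "\<dots> = Sym m (\<lambda>z. \<Sum>i=1..k. ?T ?f i z)" by (rule Sym_sum[symmetric])
  also have "(\<lambda>z. \<Sum>i=1..k. ?T ?f i z) = Sym k (\<lambda>z. \<Sum>i=1..k. ?T \<phi> i z)"
  proof
    fix z
    let ?P = "{\<pi>. \<pi> permutes {1..k}}"
    have "(\<Sum>i=1..k. ?T ?f i z) = (\<Sum>i=1..k. (1 / fact k) * (\<Sum>\<pi>\<in>?P. ?T \<phi> (inv \<pi> i) (z \<circ> \<pi>)))"
      by (intro sum.cong refl first_order_term_Sym \<phi> u n)
    also have "\<dots> = (1 / fact k) * (\<Sum>\<pi>\<in>?P. \<Sum>i=1..k. ?T \<phi> (inv \<pi> i) (z \<circ> \<pi>))"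
      unfolding sum_distrib_left by (rule sum.swap)
    \<comment> \<open>For fixed \<open>\<pi>\<close> the label \<open>inv \<pi> i\<close> runs
      through all particles as \<open>i\<close> does.\<close>
    also have "\<dots> = (1 / fact k) * (\<Sum>\<pi>\<in>?P. \<Sum>i=1..k. ?T \<phi> i (z \<circ> \<pi>))"
    proof -
      have "(\<Sum>i=1..k. ?T \<phi> (inv \<pi> i) (z \<circ> \<pi>)) = (\<Sum>i=1..k. ?T \<phi> i (z \<circ> \<pi>))" if "\<pi> \<in> ?P" for \<pi>
        using sum.permute[OF permutes_inv, of \<pi> "{1..k}" "\<lambda>i. ?T \<phi> i (z \<circ> \<pi>)"] that
        by (simp add: o_def)
      then show ?thesis by simp
    qed
    finally show "(\<Sum>i=1..k. ?T ?f i z) = Sym k (\<lambda>z. \<Sum>i=1..k. ?T \<phi> i z) z"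
      by (simp add: Sym_def)
  qed
  finally show ?thesis unfolding Sym_Sym[OF m] .
qed

text \<open>Linearity brings the averaged operator into the shape of the hierarchy, a sum over
  particles and coordinates.\<close>

lemma dual_first_order_term:
  fixes \<phi> :: "'d::finite config \<Rightarrow> real"
  assumes \<phi>: "\<phi> \<in> smooth_fns k" and u: "\<And>b. b \<in> Basis \<Longrightarrow> u b \<in> Basis"
    and c: "\<And>i b. i \<in> {1..k} \<Longrightarrow> b \<in> Basis \<Longrightarrow> (\<lambda>z. c b (z i) (z n)) \<in> smooth_fns m"
    and m: "k \<le> m" "1 \<le> m"
  shows "dual_component \<Gamma> m (Sym m (\<lambda>z. \<Sum>i=1..k. first_order_term c u n \<phi> i z)) =
    (\<Sum>i=1..k. \<Sum>b\<in>Basis.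
      dual_component \<Gamma> m (Sym m (\<lambda>z. c b (z i) (z n) * dir_deriv (dir i (u b)) \<phi> z)))"
proof -
  have s: "Sym m (\<lambda>z. c b (z i) (z n) * dir_deriv (dir i (u b)) \<phi> z) \<in> g_space m"
    if "i \<in> {1..k}" "b \<in> Basis" for i b
    using that
    by (intro Sym_in_g_space smooth_fns_mult c smooth_fns_mono[OF smooth_fns_dir_deriv[OF \<phi>] m(1)]
        dirs_I u) simp_all
  have "Sym m (\<lambda>z. \<Sum>i=1..k. first_order_term c u n \<phi> i z) =
      (\<lambda>z. \<Sum>i=1..k. \<Sum>b\<in>Basis. Sym m (\<lambda>z. c b (z i) (z n) * dir_deriv (dir i (u b)) \<phi> z) z)"
    unfolding first_order_term_def Sym_sum ..
  then have "dual_component \<Gamma> m (Sym m (\<lambda>z. \<Sum>i=1..k. first_order_term c u n \<phi> i z)) =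
      dual_component \<Gamma> m (\<lambda>z. \<Sum>i=1..k. \<Sum>b\<in>Basis.
        Sym m (\<lambda>z. c b (z i) (z n) * dir_deriv (dir i (u b)) \<phi> z) z)" by (rule arg_cong)
  also have "\<dots> = (\<Sum>i=1..k. dual_component \<Gamma> m
      (\<lambda>z. \<Sum>b\<in>Basis. Sym m (\<lambda>z. c b (z i) (z n) * dir_deriv (dir i (u b)) \<phi> z) z))"
    by (intro g_dual_sum[where k = m] dual_component_in_g_dual m g_space_sum s)
  also have "\<dots> = (\<Sum>i=1..k. \<Sum>b\<in>Basis.
      dual_component \<Gamma> m (Sym m (\<lambda>z. c b (z i) (z n) * dir_deriv (dir i (u b)) \<phi> z)))"
    by (intro sum.cong refl g_dual_sum[where k = m] dual_component_in_g_dual m s)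
  finally show ?thesis .
qed

section \<open>The Vlasov hierarchy as a Hamiltonian flow\<close>

lemma dx_kinetic: "dx 1 b (W_VlH_seq W 1) = (\<lambda>_. 0)"
  by (simp add: dx_def dir_deriv_def W_VlH_seq_def dir_def fun_eq_iff)

lemma dv_kinetic: "dv 1 b (W_VlH_seq W 1) = (\<lambda>z. snd (z 1) \<bullet> b)"
proof
  fix z :: "'a config"
  have deriv: "((\<lambda>t. (1/2) * (snd (z 1) \<bullet> snd (z 1) + 2 * t * (snd (z 1) \<bullet> b) + t\<^sup>2 * (b \<bullet> b)))
      has_field_derivative snd (z 1) \<bullet> b) (at 0)"
    by (auto intro!: derivative_eq_intros)
  have "(norm (snd (z 1) + t *\<^sub>R b))\<^sup>2 =
      snd (z 1) \<bullet> snd (z 1) + 2 * t * (snd (z 1) \<bullet> b) + t\<^sup>2 * (b \<bullet> b)" for t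
    unfolding power2_norm_eq_inner
    by (simp add: inner_add_left inner_add_right inner_commute[of b "snd _"] power2_eq_square
        algebra_simps)
  then have line: "W_VlH_seq W 1 (z + t *\<^sub>R dir 1 (0, b)) =
      (1/2) * (snd (z 1) \<bullet> snd (z 1) + 2 * t * (snd (z 1) \<bullet> b) + t\<^sup>2 * (b \<bullet> b))" for t
    by (simp add: W_VlH_seq_def dir_def)
  show "dv 1 b (W_VlH_seq W 1) z = snd (z 1) \<bullet> b"
    unfolding dv_def dir_deriv_def line by (rule DERIV_imp_deriv[OF deriv])
qed

lemma dv_potential: "dv 1 b (W_VlH_seq W 2) = (\<lambda>_. 0)"
  by (simp add: dv_def dir_deriv_def W_VlH_seq_def dir_def fun_eq_iff)

lemma dx_potential: "dx 1 b (W_VlH_seq W 2) = (\<lambda>z. dir_deriv b W (fst (z 1) - fst (z 2)))"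
  by (simp add: dx_def dir_deriv_def W_VlH_seq_def dir_def fun_eq_iff algebra_simps)

text \<open>The velocity is the \<open>v\<close>-gradient of the kinetic energy, moved from slot
  \<open>1\<close> to slot \<open>i\<close>; the zero potential merely instantiates
  \<open>W_VlH_seq\<close>.\<close>

lemma smooth_fns_velocity:
  fixes b :: "real^'d::finite"
  assumes "b \<in> Basis" "i \<in> {1..k}"
  shows "(\<lambda>z. snd (z i) \<bullet> b) \<in> smooth_fns k"
proof -
  have "W_VlH_seq (\<lambda>_. 0) 1 \<in> g_space 1"
    by (rule W_VlH_seq_in_g_space) (simp_all add: smooth_along_const)
  then have "dv 1 b (W_VlH_seq (\<lambda>_. 0) 1) \<in> smooth_fns 1"
    by (intro smooth_fns_dv g_space_smooth assms(1)) simp_all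
  then have "(\<lambda>z. dv 1 b (W_VlH_seq (\<lambda>_. 0) 1) (z \<circ> (\<lambda>_. i))) \<in> smooth_fns k"
    by (rule smooth_fns_reindex) (use assms(2) in auto)
  then show ?thesis unfolding dv_kinetic by simp
qed

text \<open>The \<open>x\<close>-gradient of the potential, moved from the slots \<open>1\<close>
  and \<open>2\<close> to \<open>i\<close> and \<open>j\<close>; the substitution is injective
  because \<open>i \<noteq> j\<close>.\<close>

lemma smooth_fns_force:
  fixes W :: "real^'d::finite \<Rightarrow> real"
  assumes W: "smooth_along Basis W" "\<And>x. W (- x) = W x"
    and "b \<in> Basis" "i \<in> {1..k}" "j \<in> {1..k}" "i \<noteq> j"
  shows "(\<lambda>z. dir_deriv b W (fst (z i) - fst (z j))) \<in> smooth_fns k"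
proof -
  have "dx 1 b (W_VlH_seq W 2) \<in> smooth_fns 2"
    using assms(3) by (intro smooth_fns_dx g_space_smooth W_VlH_seq_in_g_space W) simp_all
  then have "(\<lambda>z. dx 1 b (W_VlH_seq W 2) (z \<circ> (\<lambda>p. if p = 1 then i else j))) \<in> smooth_fns k"
    by (rule smooth_fns_reindex) (use assms(4-) in \<open>auto simp: inj_on_def\<close>)
  then show ?thesis unfolding dx_potential by simp
qed

definition velocity_weight :: "(real^'d) \<Rightarrow> 'd::finite phase \<Rightarrow> 'd phase \<Rightarrow> real" where
  "velocity_weight b p q = snd p \<bullet> b"

definition force_weight ::
    "((real^'d) \<Rightarrow> real) \<Rightarrow> (real^'d) \<Rightarrow> 'd::finite phase \<Rightarrow> 'd phase \<Rightarrow> real" where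
  "force_weight W b p q = dir_deriv b W (fst p - fst q)"

text \<open>The \<open>x\<close>-gradient of the kinetic energy vanishes, so only the first half of
  \<open>wedge1\<close> is left, with the factor \<open>k * 1\<close>. The partner
  \<open>k + 1\<close> is chosen to lie outside the permuted indices.\<close>

lemma bracket_op_kinetic:
  assumes W: "smooth_along Basis W" "\<And>x. W (- x) = W x" and \<phi>: "\<phi> \<in> smooth_fns k"
  shows "bracket_op (W_VlH W) k 1 (Sym k \<phi>) =
    Sym k (\<lambda>z. \<Sum>i=1..k. first_order_term velocity_weight (\<lambda>b. (b, 0)) (k + 1) \<phi> i z)"
proof -
  have "wedge1 k 1 (Sym k \<phi>) (W_VlH_seq W 1) =
      (\<lambda>z. real k * first_order_term velocity_weight (\<lambda>b. (b, 0)) (k + 1) (Sym k \<phi>) 1 z)"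
    unfolding wedge1_def dx_kinetic dv_kinetic first_order_term_def velocity_weight_def
    by (simp add: dx_def fun_eq_iff skip_def mult.commute)
  then show ?thesis
    unfolding bracket_op_def component_W_VlH[OF W] add_diff_cancel_right'
    by (simp only:) (rule Sym_first_order_term[OF \<phi>], auto simp: Basis_prod_def)
qed

text \<open>In \<open>wedge1 k 2\<close> the potential couples particle \<open>1\<close> to particle
  \<open>2\<close>, and the other factor reads the entries \<open>1, 3, \<dots>, k + 1\<close>. The
  hierarchy integrates out particle \<open>k + 1\<close> instead; \<open>\<rho>\<close> is the
  relabelling between the two conventions.\<close>

lemma skip_2_section:
  assumes "k \<ge> 1"
  obtains \<rho> where "\<rho> permutes {1..k + 1}" "\<rho> 1 = 1" "\<rho> 2 = k + 1"
    "\<And>i. i \<in> {1..k} \<Longrightarrow> \<rho> (skip 2 i) = i"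
proof
  let ?\<rho> = "\<lambda>i. if i = 2 then k + 1 else if i \<in> {3..k + 1} then i - 1 else i"
  show "?\<rho> permutes {1..k + 1}"
    by (rule inj_imp_permutes) (use assms in \<open>auto simp: inj_on_def split: if_splits\<close>)
qed (use assms in \<open>auto simp: skip_def\<close>)

text \<open>The \<open>v\<close>-gradient of the potential vanishes, so the second half of
  \<open>wedge1\<close> survives with its minus sign; after the relabelling, the factor
  \<open>k\<close> is traded for the sum over particles and 2 remains.\<close>

lemma bracket_op_potential:
  fixes W :: "real^'d::finite \<Rightarrow> real"
  assumes W: "smooth_along Basis W" "\<And>x. W (- x) = W x" and k: "k \<ge> 1" and \<phi>: "\<phi> \<in> smooth_fns k"
  shows "bracket_op (W_VlH W) k 2 (Sym k \<phi>) = (\<lambda>z. (- 2) *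
    Sym (k + 1) (\<lambda>z. \<Sum>i=1..k. first_order_term (force_weight W) (\<lambda>b. (0, b)) (k + 1) \<phi> i z) z)"
proof -
  let ?T = "first_order_term (force_weight W) (\<lambda>b. (0, b)) (k + 1)"
  obtain \<rho> where \<rho>: "\<rho> permutes {1..k + 1}" "\<rho> 1 = 1" "\<rho> 2 = k + 1"
    "\<And>i. i \<in> {1..k} \<Longrightarrow> \<rho> (skip 2 i) = i" by (rule skip_2_section[OF k]) blast
  \<comment> \<open>After the relabelling the test function reads the entries \<open>1\<close> to
    \<open>k\<close> again.\<close>
  have dv: "dv 1 b (Sym k \<phi>) (z \<circ> \<rho> \<circ> skip 2) = dir_deriv (dir 1 (0, b)) (Sym k \<phi>) z"
    for b and z :: "'d config"
  proof -
    have "depends_upto k (dv 1 b (Sym k \<phi>))"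
      unfolding dv_def using smooth_fns_Sym[OF \<phi>]
      by (intro depends_upto_dir_deriv) (simp add: smooth_fns_def)
    moreover have "(z \<circ> \<rho> \<circ> skip 2) i = z i" if "i \<in> {1..k}" for i using \<rho>(4)[OF that] by simp
    ultimately show ?thesis unfolding depends_upto_def dv_def by blast
  qed
  have "wedge1 k 2 (Sym k \<phi>) (W_VlH_seq W 2) (z \<circ> \<rho>) = (- 2) * (real k * ?T (Sym k \<phi>) 1 z)"
    for z :: "'d config"
    unfolding wedge1_def dx_potential dv_potential dv first_order_term_def force_weight_def
    by (simp add: \<rho> \<rho>(2)[unfolded One_nat_def])
  then have "Sym (k + 1) (\<lambda>z. wedge1 k 2 (Sym k \<phi>) (W_VlH_seq W 2) (z \<circ> \<rho>)) =
      Sym (k + 1) (\<lambda>z. (- 2) * (real k * ?T (Sym k \<phi>) 1 z))" by (simp only:)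
  also have "\<dots> = (\<lambda>z. (- 2) * Sym (k + 1) (\<lambda>z. \<Sum>i=1..k. ?T \<phi> i z) z)"
    unfolding Sym_cmult[of _ "- 2"]
    by (subst Sym_first_order_term[OF \<phi>]) (simp_all add: Basis_prod_def)
  finally show ?thesis
    unfolding Sym_reindex[OF \<rho>(1)] bracket_op_def component_W_VlH[OF W] by simp
qed

lemma linear_hamiltonian_vf_VlH:
  assumes W: "smooth_along Basis W" "\<And>x. W (- x) = W x" and k: "k \<ge> 1" and f: "f \<in> g_space k"
  shows "dual_component (linear_hamiltonian_vf (W_VlH W) \<Gamma>) k f =
    dual_component \<Gamma> k (bracket_op (W_VlH W) k 1 f) +
    dual_component \<Gamma> (k + 1) (bracket_op (W_VlH W) k 2 f)"
proof -
  have "bracket_op (W_VlH W) k j f = (\<lambda>_. 0)" if "component (W_VlH W) j = (\<lambda>_. 0)" for j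
    by (simp add: bracket_op_def that wedge1_zero Sym_zero)
  \<comment> \<open>The sum is extended to both indices by zero terms, since the support is smaller
    than \<open>{1, 2}\<close> when \<open>W\<close> vanishes.\<close>
  then have "(\<Sum>j | component (W_VlH W) j \<noteq> (\<lambda>_. 0).
        dual_component \<Gamma> (k + j - 1) (bracket_op (W_VlH W) k j f)) =
      (\<Sum>j\<in>{1, 2}. dual_component \<Gamma> (k + j - 1) (bracket_op (W_VlH W) k j f))"
    by (intro sum.mono_neutral_left)
      (auto simp: component_W_VlH[OF W] W_VlH_seq_def dual_component_zero_fun)
  with k f show ?thesis by (simp add: dual_component_linear_hamiltonian_vf)
qed

section \<open>The hierarchy tested against functions\<close>

lemma sum_fun_apply: "(\<Sum>i\<in>A. f i) x = (\<Sum>i\<in>A. f i x)" for f :: "'i \<Rightarrow> 'a \<Rightarrow> real"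
  by (induction A rule: infinite_finite_induct) simp_all

text \<open>In the hierarchy the weight multiplies a differentiated distribution, so the derivative
  falls on the product of weight and test function. The velocity of a particle does not vary with
  its position, nor the force on it with its velocity, so the weight comes out.\<close>

lemma dir_deriv_mult_constant_along:
  assumes "\<And>z t. a (z + t *\<^sub>R e) = a z" "dir_diff e \<phi>"
  shows "dir_deriv e (\<lambda>z. a z * \<phi> z) = (\<lambda>z. a z * dir_deriv e \<phi> z)"
  using assms by (simp add: dir_deriv_def dir_diff_def fun_eq_iff)

lemma sum_transport_term:
  fixes \<phi> :: "'d::finite config \<Rightarrow> real"
  assumes k: "k \<ge> 1" and \<phi>: "\<phi> \<in> smooth_fns k"
  shows "(\<Sum>i=1..k. transport_term \<Gamma> k i \<phi>) = - dual_component \<Gamma> k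
    (Sym k (\<lambda>z. \<Sum>i=1..k. first_order_term velocity_weight (\<lambda>b. (b, 0)) (k + 1) \<phi> i z))"
proof -
  have "transport_term \<Gamma> k i \<phi> = - (\<Sum>b\<in>Basis. dual_component \<Gamma> k
      (Sym k (\<lambda>z. velocity_weight b (z i) (z (k + 1)) * dir_deriv (dir i (b, 0)) \<phi> z)))"
    if i: "i \<in> {1..k}" for i
  proof -
    have "dx i b (\<lambda>z. (snd (z i) \<bullet> b) * \<phi> z) = (\<lambda>z. (snd (z i) \<bullet> b) * dir_deriv (dir i (b, 0)) \<phi> z)"
      if "b \<in> Basis" for b :: "real^'d"
      unfolding dx_def
    proof (rule dir_deriv_mult_constant_along)
      show "dir_diff (dir i (b, 0)) \<phi>"
        using i that by (intro smooth_fns_dir_diff[OF \<phi>] dirs_I) (simp_all add: Basis_prod_def)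
    qed (simp add: dir_def)
    then show ?thesis
      by (simp add: transport_term_def sum_fun_apply distr_mult_def distr_dx_def distr_of_def
          velocity_weight_def sum_negf)
  qed
  then show ?thesis
    by (subst dual_first_order_term[OF \<phi>])
      (use k in \<open>simp_all add: sum_negf Basis_prod_def velocity_weight_def smooth_fns_velocity\<close>)
qed

lemma sum_interaction_term:
  fixes \<phi> :: "'d::finite config \<Rightarrow> real"
  assumes W: "smooth_along Basis W" "\<And>x. W (- x) = W x" and \<phi>: "\<phi> \<in> smooth_fns k"
  shows "(\<Sum>i=1..k. interaction_term W \<Gamma> k i \<phi>) = - dual_component \<Gamma> (k + 1)
    (Sym (k + 1) (\<lambda>z. \<Sum>i=1..k. first_order_term (force_weight W) (\<lambda>b. (0, b)) (k + 1) \<phi> i z))"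
proof -
  \<comment> \<open>\<open>\<phi> \<otimes> 1\<close> is \<open>\<phi>\<close> itself, because a
    function of \<open>k\<close> entries already counts as one of \<open>k + 1\<close>
    entries.\<close>
  have \<phi>_cut: "(\<lambda>z. \<phi> (\<lambda>i. if i \<in> {1..k} then z i else 0)) = \<phi>"
  proof
    fix z
    have "depends_upto k \<phi>" using \<phi> by (simp add: smooth_fns_def)
    then show "\<phi> (\<lambda>i. if i \<in> {1..k} then z i else 0) = \<phi> z"
      by (rule depends_upto_def[THEN iffD1, rule_format]) simp
  qed
  have "interaction_term W \<Gamma> k i \<phi> = - (\<Sum>b\<in>Basis. dual_component \<Gamma> (k + 1)
      (Sym (k + 1) (\<lambda>z. force_weight W b (z i) (z (k + 1)) * dir_deriv (dir i (0, b)) \<phi> z)))"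
    if i: "i \<in> {1..k}" for i
  proof -
    have "dv i b (\<lambda>z. dir_deriv b W (fst (z i) - fst (z (k + 1))) * \<phi> z) =
        (\<lambda>z. dir_deriv b W (fst (z i) - fst (z (k + 1))) * dir_deriv (dir i (0, b)) \<phi> z)"
      if "b \<in> Basis" for b :: "real^'d"
      unfolding dv_def
    proof (rule dir_deriv_mult_constant_along)
      show "dir_diff (dir i (0, b)) \<phi>"
        using i that by (intro smooth_fns_dir_diff[OF \<phi>] dirs_I) (simp_all add: Basis_prod_def)
    qed (simp add: dir_def)
    then show ?thesis
      unfolding interaction_term_def distr_marginal_def \<phi>_cut
      by (simp add: sum_fun_apply distr_mult_def distr_dv_def distr_of_def force_weight_def sum_negf)
  qed
  moreover have "(\<lambda>z. force_weight W b (z i) (z (k + 1))) \<in> smooth_fns (k + 1)"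
    if "i \<in> {1..k}" "b \<in> Basis" for i b
    unfolding force_weight_def using that by (intro smooth_fns_force W) simp_all
  ultimately show ?thesis
    by (subst dual_first_order_term[OF \<phi>]) (simp_all add: sum_negf Basis_prod_def)
qed

section \<open>Derivatives of curves in \<open>G_dual\<close>\<close>

lemma has_curve_deriv_evaluation:
  fixes c :: "real \<Rightarrow> 'd::finite G_dual"
  assumes c: "has_curve_deriv c y t I" and k: "k \<ge> 1" and f: "f \<in> g_space k"
  shows "((\<lambda>s. dual_component (c s) k f) has_real_derivative dual_component y k f) (at t within I)"
proof -
  have "((\<lambda>s. dual_component ((c s - c t) /\<^sub>R (s - t)) k f) \<longlongrightarrow> dual_component y k f) (at t within I)"
    by (rule continuous_on_tendsto_compose[OF continuous_on_evaluation[OF k f]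
          c[unfolded has_curve_deriv_def]]) simp_all
  moreover have "dual_component ((c s - c t) /\<^sub>R (s - t)) k f =
      (dual_component (c s) k f - dual_component (c t) k f) / (s - t)" for s
    unfolding minus_G_dual_def uminus_G_dual_def plus_G_dual.rep_eq scaleR_G_dual.rep_eq
    by (simp add: divide_inverse mult.commute)
  ultimately show ?thesis by (simp add: has_field_derivative_iff)
qed

text \<open>\<open>G_dual\<close> is not declared a Hausdorff space; uniqueness of the limit is
  inherited from the real values at all \<open>f\<close>.\<close>

lemma has_curve_deriv_unique:
  fixes c :: "real \<Rightarrow> 'd::finite G_dual"
  assumes "has_curve_deriv c y t I" "has_curve_deriv c y' t I" "at t within I \<noteq> bot"
  shows "y = y'"
proof (rule G_dual_eqI)
  fix k and f :: "'d config \<Rightarrow> real" assume "k \<ge> 1" "f \<in> g_space k"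
  from has_curve_deriv_evaluation[OF assms(1) this] has_curve_deriv_evaluation[OF assms(2) this]
  show "dual_component y k f = dual_component y' k f"
    unfolding has_field_derivative_iff by (rule tendsto_unique[OF assms(3)])
qed

text \<open>\<open>smooth_curve_on\<close> ties \<open>D 0\<close> to the curve only on the
  interval, which suffices for quotients taken within it.\<close>

lemma has_curve_deriv_cong:
  assumes "\<And>s. s \<in> I \<Longrightarrow> c s = c' s" "t \<in> I" "has_curve_deriv c y t I"
  shows "has_curve_deriv c' y t I"
proof -
  have "\<forall>\<^sub>F s in at t within I. (c s - c t) /\<^sub>R (s - t) = (c' s - c' t) /\<^sub>R (s - t)"
    unfolding eventually_at_filter using assms(1,2) by simp
  with assms(3) show ?thesis unfolding has_curve_deriv_def by (simp add: tendsto_cong)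
qed

theorem theorem2p12:
  fixes W :: "real^'d::finite \<Rightarrow> real" and a b :: real and \<Gamma> :: "real \<Rightarrow> 'd G_dual"
  assumes "smooth_along Basis W"
    and "\<And>x. W (- x) = W x"
    and "a < b"
    and "smooth_curve_on {a..b} \<Gamma>"
  shows "(\<exists>!X. is_hamiltonian_vf (H_VlH W) X) \<and>
    (vlasov_hierarchy W {a..b} \<Gamma> \<longleftrightarrow>
      (\<forall>t\<in>{a..b}. has_curve_deriv \<Gamma> (hamiltonian_vf (H_VlH W) (\<Gamma> t)) t {a..b}))"
proof -
  note W = assms(1,2)
  let ?X = "linear_hamiltonian_vf (W_VlH W)" and ?I = "{a..b}"
  have iff: "is_hamiltonian_vf (H_VlH W) X \<longleftrightarrow> X = ?X" for X
    unfolding H_VlH_def by (rule is_hamiltonian_vf_pairing_iff)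
  then have X: "hamiltonian_vf (H_VlH W) = ?X" by (simp add: hamiltonian_vf_def)
  obtain D where D: "\<forall>t\<in>?I. D 0 t = \<Gamma> t"
    "\<forall>n. \<forall>t\<in>?I. has_curve_deriv (D n) (D (Suc n) t) t ?I"
    using assms(4) unfolding smooth_curve_on_def by (elim exE conjE)
  have deriv: "has_curve_deriv \<Gamma> (D 1 t) t ?I" if "t \<in> ?I" for t
  proof (rule has_curve_deriv_cong[OF _ that])
    show "has_curve_deriv (D 0) (D 1 t) t ?I" using D(2) that by simp
  qed (use D(1) in simp)
  have "(\<forall>k\<ge>1. \<forall>t\<in>?I. \<forall>\<phi>\<in>smooth_fns k.
      vector_derivative (\<lambda>s. distr_of (\<Gamma> s) k \<phi>) (at t within ?I)
        + (\<Sum>i=1..k. transport_term (\<Gamma> t) k i \<phi>)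
      = 2 * (\<Sum>i=1..k. interaction_term W (\<Gamma> t) k i \<phi>)) \<longleftrightarrow>
    (\<forall>k\<ge>1. \<forall>t\<in>?I. \<forall>\<phi>\<in>smooth_fns k.
      dual_component (D 1 t) k (Sym k \<phi>) = dual_component (?X (\<Gamma> t)) k (Sym k \<phi>))"
  proof (intro all_cong ball_cong refl imp_cong)
    fix k t and \<phi> :: "'d config \<Rightarrow> real"
    assume k: "1 \<le> k" and t: "t \<in> ?I" and \<phi>: "\<phi> \<in> smooth_fns k"
    note S = Sym_in_g_space[OF \<phi>]
    have "vector_derivative (\<lambda>s. distr_of (\<Gamma> s) k \<phi>) (at t within ?I) =
        dual_component (D 1 t) k (Sym k \<phi>)"
      \<comment> \<open>As \<open>a < b\<close>, the derivative within the interval is unique at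
        every point, endpoints included, so \<open>vector_derivative\<close> returns the one that
        comes from the curve.\<close>
      unfolding distr_of_def using assms(3) t has_curve_deriv_evaluation[OF deriv[OF t] k S]
      by (intro vector_derivative_within_closed_interval)
        (simp_all add: has_real_derivative_iff_has_vector_derivative)
    \<comment> \<open>The distributional derivative puts a minus sign on both terms: the kinetic
      bracket is minus the transport sum, and the potential bracket with its factor
      \<open>- 2\<close> is twice the interaction sum.\<close>
    moreover have "dual_component (?X (\<Gamma> t)) k (Sym k \<phi>) =
        - (\<Sum>i=1..k. transport_term (\<Gamma> t) k i \<phi>) + 2 * (\<Sum>i=1..k. interaction_term W (\<Gamma> t) k i \<phi>)"
    proof -
      let ?h = "Sym (k + 1)
        (\<lambda>z. \<Sum>i=1..k. first_order_term (force_weight W) (\<lambda>b. (0, b)) (k + 1) \<phi> i z)"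
      have "?h \<in> g_space (k + 1)"
        unfolding first_order_term_def force_weight_def
        by (intro Sym_in_g_space smooth_fns_sum smooth_fns_mult smooth_fns_force W
            smooth_fns_mono[OF smooth_fns_dir_deriv[OF \<phi>]] dirs_I) (simp_all add: Basis_prod_def)
      then have "dual_component (\<Gamma> t) (k + 1) (\<lambda>z. (- 2) * ?h z) = (- 2) * dual_component (\<Gamma> t) (k + 1) ?h"
        using g_dual_lincomb[OF dual_component_in_g_dual, of "k + 1" ?h ?h "\<Gamma> t" "- 2" 0] by simp
      then show ?thesis
        unfolding linear_hamiltonian_vf_VlH[OF W k S] bracket_op_kinetic[OF W \<phi>]
          bracket_op_potential[OF W k \<phi>] sum_transport_term[OF k \<phi>] sum_interaction_term[OF W \<phi>]
        by simp
    qed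
    ultimately show "(vector_derivative (\<lambda>s. distr_of (\<Gamma> s) k \<phi>) (at t within ?I)
        + (\<Sum>i=1..k. transport_term (\<Gamma> t) k i \<phi>)
        = 2 * (\<Sum>i=1..k. interaction_term W (\<Gamma> t) k i \<phi>)) \<longleftrightarrow>
      dual_component (D 1 t) k (Sym k \<phi>) = dual_component (?X (\<Gamma> t)) k (Sym k \<phi>)"
      by linarith
  qed
  \<comment> \<open>The functions \<open>Sym k \<phi>\<close> exhaust \<open>g_space k\<close>,
    because \<open>Sym k\<close> fixes symmetric functions.\<close>
  also have "\<dots> \<longleftrightarrow> (\<forall>t\<in>?I. D 1 t = ?X (\<Gamma> t))"
  proof (intro iffI ballI)
    fix t assume t: "t \<in> ?I"
      and eq: "\<forall>k\<ge>1. \<forall>t\<in>?I. \<forall>\<phi>\<in>smooth_fns k.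
        dual_component (D 1 t) k (Sym k \<phi>) = dual_component (?X (\<Gamma> t)) k (Sym k \<phi>)"
    show "D 1 t = ?X (\<Gamma> t)"
    proof (rule G_dual_eqI)
      fix k and f :: "'d config \<Rightarrow> real" assume "k \<ge> 1" and f: "f \<in> g_space k"
      with eq t g_space_smooth[OF f]
      have "dual_component (D 1 t) k (Sym k f) = dual_component (?X (\<Gamma> t)) k (Sym k f)" by simp
      then show "dual_component (D 1 t) k f = dual_component (?X (\<Gamma> t)) k f"
        by (simp only: Sym_g_space[OF f])
    qed
  qed simp
  also have "\<dots> \<longleftrightarrow> (\<forall>t\<in>?I. has_curve_deriv \<Gamma> (?X (\<Gamma> t)) t ?I)"
  proof (rule ball_cong[OF refl])
    fix t assume t: "t \<in> ?I"
    \<comment> \<open>A nondegenerate interval has no isolated points, so the derivative within it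
      is unique.\<close>
    have bot: "at t within ?I \<noteq> bot"
      using assms(3) t by (simp add: trivial_limit_within islimpt_Icc)
    show "D 1 t = ?X (\<Gamma> t) \<longleftrightarrow> has_curve_deriv \<Gamma> (?X (\<Gamma> t)) t ?I"
    proof
      assume "D 1 t = ?X (\<Gamma> t)"
      with deriv[OF t] show "has_curve_deriv \<Gamma> (?X (\<Gamma> t)) t ?I" by (simp only:)
    next
      assume "has_curve_deriv \<Gamma> (?X (\<Gamma> t)) t ?I"
      from has_curve_deriv_unique[OF deriv[OF t] this bot] show "D 1 t = ?X (\<Gamma> t)" .
    qed
  qed
  finally show ?thesis unfolding vlasov_hierarchy_def X by (simp add: iff)
qed

end
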